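(* Let $X=(X(t))_{t\ge 0}$ be a spectrally positive Lévy process such that for every $t>0$ the random variable $X(t)$ is absolutely continuous with density $x\mapsto f(x,t)$. Let $c_1,c_2\ge 0$, $u>0$, $0<T<S\le\infty$ ($S$ is finite or $S=\infty$), and let $c(t)=c_1t$ for $t\in[0,T]$ and $c(t)=c_2(t-T)+c_1T$ for $t\in(T,\infty)$. Then $$\mathbb{P}\Big(\sup_{t<S}(X(t)-c(t))>u\Big)=A+B,$$ where $$A:=\mathbb{P}\Big(\sup_{t<T}(X(t)-c_1t)>u\Big),$$ $$B:=\mathbb{P}\Big(\sup_{t<T}(X(t)-c_1t)\le u,\ \sup_{0<t<S-T}\big(X(t+T)-X(T)-c_2t\big)>u-X(T)+c_1T\Big),$$ and these are given by $$A=\mathbb{P}(X(T)-c_1T>u)+\int_0^T\frac{\mathbb{E}\big(X(T-s)-c_1(T-s)\big)^-}{T-s}\,f(u+c_1s,s)\,ds$$ and $$B=\int_0^\infty \mathbb{P}\Big(\sup_{t<S-T}(X(t)-c_2t)>z\Big)f(-z+u+c_1T,T)\,dz$$ $$\qquad-\int_0^\infty z\,\mathbb{P}\Big(\sup_{t<S-T}(X(t)-c_2t)>z\Big)\left(\int_0^T\frac{f(u+c_1s,s)}{T-s}\,f(-z+c_1(T-s),T-s)\,ds\right)dz.$$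
   Context: All processes are real-valued with time parameter $t\in[0,\infty)$. A spectrally positive Lévy process is a Lévy process (started at $0$) with no negative jumps. Notation: $x^-=-\min\{x,0\}$; $\sup_{t<r}$ means the supremum over $t\in[0,r)$; and $S-T=\infty$ when $S=\infty$.
   Formalization: The densities f(·,t) are taken in the version satisfying f(x,s+t)=∫f(x−y,s)f(y,t)dy at every x (such a version always exists); for an arbitrary version the formulas fail, since f can be altered on the curve (u+c₁s, s). *)

theory Defs
  imports "HOL-Probability.Probability"
begin

definition cadlag_on_nonneg :: "(real \<Rightarrow> real) \<Rightarrow> bool" where
  "cadlag_on_nonneg x \<longleftrightarrow>
     (\<forall>t\<ge>0. (x \<longlongrightarrow> x t) (at_right t)) \<and>
     (\<forall>t>0. \<exists>l. (x \<longlongrightarrow> l) (at_left t))"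

text \<open>
  Only the values \<open>X t\<close> with \<open>t \<ge> 0\<close> matter. Path properties are required almost surely.
  Continuity in probability is not listed, since it follows from right-continuity at \<open>0\<close> and
  stationarity of the increments.
\<close>

definition levy_process :: "'a measure \<Rightarrow> (real \<Rightarrow> 'a \<Rightarrow> real) \<Rightarrow> bool" where
  "levy_process M X \<longleftrightarrow>
     prob_space M \<and>
     (\<forall>t\<ge>0. X t \<in> borel_measurable M) \<and>
     (AE \<omega> in M. X 0 \<omega> = 0) \<and>
     (\<forall>(t :: nat \<Rightarrow> real) n. 0 \<le> t 0 \<longrightarrow> (\<forall>i<n. t i \<le> t (Suc i)) \<longrightarrow>
        prob_space.indep_vars M (\<lambda>_. borel)
          (\<lambda>i \<omega>. X (t (Suc i)) \<omega> - X (t i) \<omega>) {..<n}) \<and>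
     (\<forall>s\<ge>0. \<forall>h\<ge>0. distr M borel (\<lambda>\<omega>. X (s + h) \<omega> - X s \<omega>) = distr M borel (X h)) \<and>
     (AE \<omega> in M. cadlag_on_nonneg (\<lambda>t. X t \<omega>))"

definition spectrally_positive_levy_process ::
    "'a measure \<Rightarrow> (real \<Rightarrow> 'a \<Rightarrow> real) \<Rightarrow> bool" where
  "spectrally_positive_levy_process M X \<longleftrightarrow>
     levy_process M X \<and>
     (AE \<omega> in M. \<forall>t>0. \<forall>l. ((\<lambda>s. X s \<omega>) \<longlongrightarrow> l) (at_left t) \<longrightarrow> l \<le> X t \<omega>)"

text \<open>
  A density of \<open>X t\<close> is determined only up to Lebesgue null sets, while formulas such as
  \<open>\<integral> f (u + c * s) s ds\<close> evaluate the family of densities along a curve meeting each \<open>f _ s\<close> in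
  a single point. The version therefore has to be fixed, and it is fixed by requiring the
  convolution (Chapman-Kolmogorov) identity at every point instead of almost everywhere.
  If every \<open>X t\<close> with \<open>t > 0\<close> has some density \<open>g _ t\<close>, then exactly one version for positive
  times satisfies this, namely \<open>f x t = (\<integral>\<^sup>+ y. g (x - y) (t / 2) * g y (t / 2) \<partial>lborel)\<close>, so this
  is no restriction on the process. That version may be infinite at some points, whence the
  codomain \<^typ>\<open>ennreal\<close>. Joint measurability of \<open>f\<close> is a consequence.
\<close>

definition transition_density ::
    "'a measure \<Rightarrow> (real \<Rightarrow> 'a \<Rightarrow> real) \<Rightarrow> (real \<Rightarrow> real \<Rightarrow> ennreal) \<Rightarrow> bool" where
  "transition_density M X f \<longleftrightarrow>
     (\<forall>t>0. distributed M lborel (X t) (\<lambda>x. f x t)) \<and>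
     (\<forall>s>0. \<forall>t>0. \<forall>x. f x (s + t) = (\<integral>\<^sup>+ y. f (x - y) s * f y t \<partial>lborel))"

definition piecewise_drift :: "real \<Rightarrow> real \<Rightarrow> real \<Rightarrow> real \<Rightarrow> real" where
  "piecewise_drift c1 c2 T t = (if t \<le> T then c1 * t else c2 * (t - T) + c1 * T)"

text \<open>
  Suprema are taken in \<^typ>\<open>ereal\<close>: over an unbounded time set they can be infinite.
\<close>

definition sup_before :: "ereal \<Rightarrow> (real \<Rightarrow> real) \<Rightarrow> ereal" where
  "sup_before r x = (SUP t\<in>{t. 0 \<le> t \<and> ereal t < r}. ereal (x t))"

definition sup_before_pos :: "ereal \<Rightarrow> (real \<Rightarrow> real) \<Rightarrow> ereal" where
  "sup_before_pos r x = (SUP t\<in>{t. 0 < t \<and> ereal t < r}. ereal (x t))"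

definition neg_part :: "real \<Rightarrow> real" where
  "neg_part x = - min x 0"

text \<open>
  Since paths are cadlag only almost surely, events involving suprema over a continuum of times
  need only be measurable with respect to the completion of the probability space; their
  probabilities are taken there.
\<close>

abbreviation tail_sup ::
    "'a measure \<Rightarrow> (real \<Rightarrow> 'a \<Rightarrow> real) \<Rightarrow> real \<Rightarrow> ereal \<Rightarrow> real \<Rightarrow> real" where
  "tail_sup M X c r z \<equiv>
     \<P>(\<omega> in completion M. sup_before r (\<lambda>t. X t \<omega> - c * t) > ereal z)"

end

theory Submission
  imports Defs
begin

text \<open>
  Write \<open>Y t = X t - c1 * t\<close>. For the partial sums \<open>W\<close> of a sequence with period \<open>n\<close> and
  \<open>W n < 0\<close>, the maximum of the future \<open>max {W j | j > k}\<close> drops by exactly \<open>- W n\<close> over one period.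
  Averaging over the cyclic shifts of exchangeable increments turns this into a ballot identity:
  the negative part of \<open>max {W 1, ..., W n}\<close> and \<open>1 / n\<close> times the negative part of \<open>W n\<close> have the
  same expectation, even against a function of \<open>W n\<close>.

  Decompose a path on a grid of \<open>{0..T}\<close> that exceeds a level \<open>v\<close> but ends below it according to its
  last time above \<open>v\<close>. Averaged over \<open>v\<close> against a continuous weight, the ballot identity evaluates
  each term approximately, and the error is controlled by the largest downward step on the grid. This
  step tends to \<open>0\<close> because there are no negative jumps. In the limit, the law of the end point of such
  a path has, for almost every \<open>v\<close>, the density \<open>\<integral> z / (T - s) * p v s * p (- z) (T - s) ds\<close> in the distance
  \<open>z\<close> below \<open>v\<close>. Conditioning on \<open>Y \<epsilon>\<close> and using the Chapman-Kolmogorov identity at every point upgrades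
  this to every level \<open>v\<close>. The formula for \<open>A\<close> is the integral over \<open>z\<close>, and the formula for \<open>B\<close> follows
  with the Markov property at time \<open>T\<close>.
\<close>

text \<open>The formulas evaluate the densities at the single level \<open>u\<close>, while the
  ballot argument speaks only about averages over levels: for a fixed path, it is the length of the
  set of levels last exceeded at a given grid time that is the negative part of a future maximum.
  This conflict shapes the proof. Cyclic shifts need finitely many exchangeable increments, which
  forces the grid; on the grid the value at the last exit only converges to the level, which forces
  continuous weights. The last exit is used rather than the first passage, since a path may jump
  upwards over a level but cannot jump downwards over it. The drift \<open>c1\<close> is built into
  \<open>Y\<close>, so that up to time \<open>T\<close> the level is constant and afterwards only
  the drift \<open>c2 - c1\<close> remains. The minus sign in \<open>B\<close> is a set difference:
  among the paths that are below \<open>u\<close> at time \<open>T\<close> and pass \<open>u\<close>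
  later, those that had already passed \<open>u\<close> before \<open>T\<close> are removed, and the
  end point of exactly these has the last exit density.\<close>

section \<open>A ballot identity for cyclically exchangeable increments\<close>

text \<open>
  If the total is negative, each summand on the left is the drop of the future maximum \<open>R\<close> of the
  partial sums in one step, and these drops telescope over a period. Otherwise every summand is \<open>0\<close>.
\<close>

lemma sum_cyclic_max_neg:
  fixes x :: "nat \<Rightarrow> real"
  assumes m: "m > 0" and per: "\<And>i. x (i + m) = x i"
  shows "(\<Sum>v<m. max 0 (- Max ((\<lambda>j. \<Sum>i<j. x (v + i)) ` {1..m}))) = max 0 (- (\<Sum>i<m. x i))"
proof -
  define W where "W j = (\<Sum>i<j. x i)" for j
  \<comment> \<open>One period is enough: if \<open>W m < 0\<close>, every later value lies below
    the value one period earlier, so this is the maximum of the whole future.\<close>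
  define R where "R k = Max (W ` {k..<k + m})" for k
  have W_add: "W (v + j) = W v + (\<Sum>i<j. x (v + i))" for v j
    by (induction j) (auto simp: W_def)
  have W_per: "W (k + m) = W k + W m" for k
  proof (induction k)
    case (Suc k)
    have "W (Suc k + m) = W (k + m) + x (k + m)" by (simp add: W_def)
    also have "\<dots> = W (Suc k) + W m" using Suc per by (simp add: W_def)
    finally show ?case .
  qed (simp add: W_def)
  have max_eq: "Max ((\<lambda>j. \<Sum>i<j. x (v + i)) ` {1..m}) = R (Suc v) - W v" for v
  proof -
    have "(\<lambda>j. \<Sum>i<j. x (v + i)) ` {1..m} = (\<lambda>y. y - W v) ` (W ` {Suc v..<Suc v + m})"
    proof -
      have "{Suc v..<Suc v + m} = (\<lambda>j. v + j) ` {1..m}"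
        by (auto simp: image_iff intro!: bexI[of _ "_ - v"])
      then show ?thesis by (simp only: image_image W_add) simp
    qed
    also have "Max \<dots> = Max (W ` {Suc v..<Suc v + m}) - W v"
      using m by (intro mono_Max_commute[symmetric] monoI) auto
    finally show ?thesis by (simp add: R_def)
  qed
  show ?thesis
  proof (cases "W m < 0")
    case False
    have "max 0 (- Max ((\<lambda>j. \<Sum>i<j. x (v + i)) ` {1..m})) = 0" for v
    proof -
      \<comment> \<open>The last partial sum of every shift is the total over a period, here
        nonnegative, so no maximum is negative.\<close>
      have "(\<Sum>i<m. x (v + i)) \<le> Max ((\<lambda>j. \<Sum>i<j. x (v + i)) ` {1..m})"
        using m by (intro Max_ge) auto
      moreover have "(\<Sum>i<m. x (v + i)) = W m" using W_add[of v m] W_per[of v] by simp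
      ultimately show ?thesis using False by simp
    qed
    then have "(\<Sum>v<m. max 0 (- Max ((\<lambda>j. \<Sum>i<j. x (v + i)) ` {1..m}))) = 0"
      by (intro sum.neutral) blast
    then show ?thesis using False by (simp add: W_def)
  next
    case True
    have step: "max 0 (- Max ((\<lambda>j. \<Sum>i<j. x (v + i)) ` {1..m})) = R v - R (Suc v)" for v
    proof -
      \<comment> \<open>Moving the window from \<open>v\<close> to \<open>Suc v\<close> loses
        \<open>W v\<close> and gains \<open>W (v + m) = W v + W m\<close>, which is below the lost
        value. So the maximum can only fall.\<close>
      have "R v = max (W v) (R (Suc v))"
      proof (rule antisym)
        show "R v \<le> max (W v) (R (Suc v))"
          unfolding R_def
        proof (intro Max.boundedI, goal_cases)
          case (3 y)
          then obtain i where i: "y = W i" "v \<le> i" "i < v + m" by auto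
          show ?case
          proof (cases "i = v")
            case False
            then have "W i \<le> Max (W ` {Suc v..<Suc v + m})" using i by (intro Max_ge) auto
            then show ?thesis using i by auto
          qed (use i in auto)
        qed (use m in auto)
        have "R (Suc v) \<le> R v"
          unfolding R_def
        proof (intro Max.boundedI, goal_cases)
          case (3 y)
          then obtain i where i: "y = W i" "Suc v \<le> i" "i < Suc v + m" by auto
          show ?case
          proof (cases "i = v + m")
            case True
            then have "y \<le> W v" using i W_per[of v] \<open>W m < 0\<close> by simp
            also have "W v \<le> Max (W ` {v..<v + m})" using m by (intro Max_ge) auto
            finally show ?thesis .
          qed (use i in \<open>auto intro!: Max_ge\<close>)
        qed (use m in auto)
        moreover have "W v \<le> R v" unfolding R_def using m by (intro Max_ge) auto
        ultimately show "max (W v) (R (Suc v)) \<le> R v" by simp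
      qed
      then show ?thesis unfolding max_eq by (auto simp: max_def)
    qed
    have "R m = R 0 + W m"
    proof -
      have "{m..<m + m} = (\<lambda>j. j + m) ` {0..<0 + m}" by simp
      then have "W ` {m..<m + m} = (\<lambda>y. y + W m) ` (W ` {0..<0 + m})"
        by (simp only: image_image W_per)
      then show ?thesis unfolding R_def
        using m by (subst mono_Max_commute[where f="\<lambda>y. y + W m"]) (auto simp: mono_def)
    qed
    moreover have "(\<Sum>v<m. R v - R (Suc v)) = R 0 - R m" by (rule sum_lessThan_telescope')
    ultimately show ?thesis unfolding step using True by (simp add: W_def)
  qed
qed

text \<open>
  Paths vanish at negative times, which makes \<open>(t, \<omega>) \<mapsto> Y t \<omega>\<close> measurable on the whole line.
\<close>

locale spos_levy = prob_space M for M :: "'a measure" +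
  fixes Y :: "real \<Rightarrow> 'a \<Rightarrow> real"
  assumes Y_measurable[measurable]: "\<And>t. Y t \<in> borel_measurable M"
    and Y_nonpos: "\<And>t \<omega>. t \<le> 0 \<Longrightarrow> Y t \<omega> = 0"
    and right_cont: "\<And>t \<omega>. t \<ge> 0 \<Longrightarrow> ((\<lambda>s. Y s \<omega>) \<longlongrightarrow> Y t \<omega>) (at_right t)"
    and left_lim: "\<And>t \<omega>. t > 0 \<Longrightarrow> \<exists>l\<le>Y t \<omega>. ((\<lambda>s. Y s \<omega>) \<longlongrightarrow> l) (at_left t)"
    and indep_increments: "\<And>(t :: nat \<Rightarrow> real) n. 0 \<le> t 0 \<Longrightarrow> (\<And>i. i < n \<Longrightarrow> t i \<le> t (Suc i)) \<Longrightarrow>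
        indep_vars (\<lambda>_. borel) (\<lambda>i \<omega>. Y (t (Suc i)) \<omega> - Y (t i) \<omega>) {..<n}"
    and stationary: "\<And>s h. 0 \<le> s \<Longrightarrow> 0 \<le> h \<Longrightarrow>
        distr M borel (\<lambda>\<omega>. Y (s + h) \<omega> - Y s \<omega>) = distr M borel (Y h)"
begin

lemma Y_zero[simp]: "Y 0 \<omega> = 0"
  by (simp add: Y_nonpos)

definition incr :: "real \<Rightarrow> nat \<Rightarrow> 'a \<Rightarrow> real" where
  "incr d i \<omega> = Y (real (Suc i) * d) \<omega> - Y (real i * d) \<omega>"

lemma incr_measurable[measurable]: "incr d i \<in> borel_measurable M"
  unfolding incr_def[abs_def] by measurable

lemma sum_incr: "(\<Sum>i<j. incr d (k + i) \<omega>) = Y (real (k + j) * d) \<omega> - Y (real k * d) \<omega>"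
  by (induction j) (auto simp: incr_def)

lemma sum_incr0: "(\<Sum>i<j. incr d i \<omega>) = Y (real j * d) \<omega>"
  using sum_incr[of d 0 \<omega> j] by simp

lemma indep_incr:
  assumes "d \<ge> 0"
  shows "indep_vars (\<lambda>_. borel) (incr d) {..<n}"
  unfolding incr_def[abs_def] using assms
  by (intro indep_increments) (auto intro!: mult_right_mono)

lemma distr_incr:
  assumes "d \<ge> 0"
  shows "distr M borel (incr d i) = distr M borel (Y d)"
  unfolding incr_def[abs_def] using stationary[of "real i * d" d] assms
  by (simp add: algebra_simps)

text \<open>Increments over one mesh are independent and identically distributed, so any choice of
  distinct indices gives the same product law. This exchangeability serves both the cyclic shifts
  and the restart at a grid time.\<close>

lemma distr_incr_vector:
  fixes f :: "nat \<Rightarrow> nat"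
  assumes d: "d \<ge> 0" and f: "inj_on f {..<m}"
  shows "distr M (PiM {..<m} (\<lambda>_. borel)) (\<lambda>\<omega>. \<lambda>i\<in>{..<m}. incr d (f i) \<omega>)
    = PiM {..<m} (\<lambda>_. distr M borel (Y d))"
proof (cases "m = 0")
  case True
  have "distr M (PiM {} (\<lambda>_. borel)) (\<lambda>\<omega> i. undefined) = PiM {} (\<lambda>_. distr M borel (Y d))"
    by (rule measure_eqI) (auto simp: sets_PiM_empty emeasure_distr space_PiM_empty emeasure_space_1
        PiM_empty subset_singleton_iff)
  then show ?thesis using True by (simp add: restrict_def)
next
  case False
  have "finite (f ` {..<m})" by simp
  then obtain n where n: "f ` {..<m} \<subseteq> {..<n}" using finite_nat_iff_bounded by blast
  have ind: "indep_vars (\<lambda>_. borel) (\<lambda>i. incr d (f i)) {..<m}"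
  proof -
    have "indep_vars (\<lambda>j. PiM {f j} (\<lambda>_. borel)) (\<lambda>j \<omega>. restrict (\<lambda>i. incr d i \<omega>) {f j}) {..<m}"
      using f n by (intro indep_vars_restrict[OF indep_incr[OF d, of n]])
        (auto simp: disjoint_family_on_def inj_on_def)
    then have "indep_vars (\<lambda>_. borel) (\<lambda>j \<omega>. (\<lambda>x. x (f j)) (restrict (\<lambda>i. incr d i \<omega>) {f j})) {..<m}"
      by (rule indep_vars_compose2) simp
    then show ?thesis by simp
  qed
  show ?thesis
    using indep_vars_iff_distr_eq_PiM'[THEN iffD1, OF _ _ ind] False
    by (simp add: distr_incr[OF d] lessThan_empty_iff)
qed

lemma nn_integral_incr_vector:
  fixes f :: "nat \<Rightarrow> nat"
  assumes d: "d \<ge> 0" and f: "inj_on f {..<m}"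
    and F[measurable]: "F \<in> borel_measurable (PiM {..<m} (\<lambda>_. borel))"
  shows "(\<integral>\<^sup>+\<omega>. F (\<lambda>i\<in>{..<m}. incr d (f i) \<omega>) \<partial>M) = (\<integral>\<^sup>+\<omega>. F (\<lambda>i\<in>{..<m}. incr d i \<omega>) \<partial>M)"
proof -
  have "(\<integral>\<^sup>+\<omega>. F (\<lambda>i\<in>{..<m}. incr d (f i) \<omega>) \<partial>M)
      = (\<integral>\<^sup>+x. F x \<partial>distr M (PiM {..<m} (\<lambda>_. borel)) (\<lambda>\<omega>. \<lambda>i\<in>{..<m}. incr d (f i) \<omega>))"
    by (subst nn_integral_distr) (auto intro!: measurable_restrict)
  also have "\<dots> = (\<integral>\<^sup>+x. F x \<partial>distr M (PiM {..<m} (\<lambda>_. borel)) (\<lambda>\<omega>. \<lambda>i\<in>{..<m}. incr d i \<omega>))"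
    unfolding distr_incr_vector[OF d f] distr_incr_vector[OF d inj_on_id2] ..
  also have "\<dots> = (\<integral>\<^sup>+\<omega>. F (\<lambda>i\<in>{..<m}. incr d i \<omega>) \<partial>M)"
    by (subst nn_integral_distr) (auto intro!: measurable_restrict)
  finally show ?thesis .
qed

text \<open>Rotating the increments between \<open>k\<close> and \<open>N\<close> changes neither
  \<open>Y (k * d)\<close> nor the total increment after it, hence neither weight. Averaging the
  left integrand over the \<open>N - k\<close> rotations therefore acts on the maximum alone, and
  \<open>sum_cyclic_max_neg\<close> evaluates that sum pathwise.\<close>

lemma nn_integral_future_max:
  fixes \<phi> g :: "real \<Rightarrow> ennreal"
  assumes d: "d \<ge> 0" and kN: "k < N"
    and [measurable]: "\<phi> \<in> borel_measurable borel" "g \<in> borel_measurable borel"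
  shows "(\<integral>\<^sup>+\<omega>. \<phi> (Y (real k * d) \<omega>) * g (Y (real k * d) \<omega> - Y (real N * d) \<omega>)
        * ennreal (max 0 (- Max ((\<lambda>j. Y (real (k + j) * d) \<omega> - Y (real k * d) \<omega>) ` {1..N - k}))) \<partial>M)
    = ennreal (1 / real (N - k)) * (\<integral>\<^sup>+\<omega>. \<phi> (Y (real k * d) \<omega>) * g (Y (real k * d) \<omega> - Y (real N * d) \<omega>)
        * ennreal (max 0 (Y (real k * d) \<omega> - Y (real N * d) \<omega>)) \<partial>M)"
    (is "?L = _ * ?R")
proof -
  define m where "m = N - k"
  have m: "m > 0" "N = k + m" using kN by (auto simp: m_def)
  define G where "G = (\<lambda>\<xi> :: nat \<Rightarrow> real. \<phi> (\<Sum>i<k. \<xi> i) * g (- (\<Sum>i<m. \<xi> (k + i)))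
    * ennreal (max 0 (- Max ((\<lambda>j. \<Sum>i<j. \<xi> (k + i)) ` {1..m}))))"
  \<comment> \<open>Only the first \<open>N\<close> coordinates enter, so whole sequences and their
    restrictions in the product space can be exchanged freely.\<close>
  have G_cong: "G \<xi> = G \<xi>'" if "\<And>i. i < N \<Longrightarrow> \<xi> i = \<xi>' i" for \<xi> \<xi>'
  proof -
    have "(\<lambda>j. \<Sum>i<j. \<xi> (k + i)) ` {1..m} = (\<lambda>j. \<Sum>i<j. \<xi>' (k + i)) ` {1..m}"
      using that m by (intro image_cong sum.cong) auto
    moreover have "(\<Sum>i<k. \<xi> i) = (\<Sum>i<k. \<xi>' i)" "(\<Sum>i<m. \<xi> (k + i)) = (\<Sum>i<m. \<xi>' (k + i))"
      using that m by (auto intro!: sum.cong)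
    ultimately show ?thesis unfolding G_def by (simp only:)
  qed
  have G_meas[measurable]: "G \<in> borel_measurable (PiM {..<N} (\<lambda>_. borel))"
  proof -
    have 1: "(\<lambda>\<xi>. \<Sum>i<j. \<xi> (k + i)) \<in> borel_measurable (PiM {..<N} (\<lambda>_. borel :: real measure))" if "j \<le> m" for j
      using that m by (intro borel_measurable_sum measurable_component_singleton) auto
    have 2: "(\<lambda>\<xi>. \<Sum>i<k. \<xi> i) \<in> borel_measurable (PiM {..<N} (\<lambda>_. borel :: real measure))"
      using m by (intro borel_measurable_sum measurable_component_singleton) auto
    have 3: "(\<lambda>\<xi>. Max ((\<lambda>j. \<Sum>i<j. \<xi> (k + i)) ` {1..m})) \<in> borel_measurable (PiM {..<N} (\<lambda>_. borel :: real measure))"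
      using 1 by (intro borel_measurable_Max) auto
    note [measurable] = 1[OF order_refl] 2 3
    show ?thesis unfolding G_def by measurable
  qed
  define \<pi> where "\<pi> v i = (if i < k then i else k + ((i - k) + v) mod m)" for v i :: nat
  have inj: "inj_on (\<pi> v) {..<N}" if "v < m" for v
  proof (rule inj_onI)
    fix i j assume ij: "i \<in> {..<N}" "j \<in> {..<N}" "\<pi> v i = \<pi> v j"
    have cancel: "a = b" if *: "(a + v) mod m = (b + v) mod m" "a < m" "b < m" for a b
    proof -
      have aux: "b' \<le> a'" if "(a' + v) mod m = (b' + v) mod m" "a' < m" "b' < m" for a' b'
      proof (rule ccontr)
        assume "\<not> b' \<le> a'"
        then have "m dvd (b' + v) - (a' + v)"
          using that(1) by (subst mod_eq_dvd_iff_nat[symmetric]) auto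
        then have "m \<le> b' - a'" using \<open>\<not> b' \<le> a'\<close> by (intro dvd_imp_le) auto
        then show False using that by simp
      qed
      show ?thesis using aux[OF *] aux[OF *(1)[symmetric] *(3,2)] by simp
    qed
    show "i = j"
    proof (cases "i < k \<or> j < k")
      case True
      moreover have "\<pi> v i < k \<longleftrightarrow> i < k" "\<pi> v j < k \<longleftrightarrow> j < k" by (simp_all add: \<pi>_def)
      ultimately have "i < k" "j < k" using ij(3) by metis+
      then show ?thesis using ij(3) by (simp add: \<pi>_def)
    next
      case False
      then have "(i - k + v) mod m = (j - k + v) mod m" using ij(3) by (simp add: \<pi>_def)
      moreover have "i - k < m" "j - k < m" using ij(1,2) m False by auto
      ultimately have "i - k = j - k" by (rule cancel)
      then show ?thesis using False by auto
    qed
  qed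
  have shift: "(\<integral>\<^sup>+\<omega>. G (\<lambda>i. incr d (\<pi> v i) \<omega>) \<partial>M) = (\<integral>\<^sup>+\<omega>. G (\<lambda>i. incr d i \<omega>) \<partial>M)" if "v < m" for v
  proof -
    have "(\<integral>\<^sup>+\<omega>. G (\<lambda>i. incr d (\<pi> v i) \<omega>) \<partial>M) = (\<integral>\<^sup>+\<omega>. G (\<lambda>i\<in>{..<N}. incr d (\<pi> v i) \<omega>) \<partial>M)"
      by (intro nn_integral_cong G_cong) auto
    also have "\<dots> = (\<integral>\<^sup>+\<omega>. G (\<lambda>i\<in>{..<N}. incr d i \<omega>) \<partial>M)"
      by (intro nn_integral_incr_vector d inj that) simp
    also have "\<dots> = (\<integral>\<^sup>+\<omega>. G (\<lambda>i. incr d i \<omega>) \<partial>M)"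
      by (intro nn_integral_cong G_cong) auto
    finally show ?thesis .
  qed
  have L: "?L = (\<integral>\<^sup>+\<omega>. G (\<lambda>i. incr d i \<omega>) \<partial>M)"
    unfolding G_def sum_incr sum_incr0 m_def[symmetric] m(2)[symmetric] by (simp only: minus_diff_eq)
  have G_sum: "(\<Sum>v<m. G (\<lambda>i. incr d (\<pi> v i) \<omega>)) = \<phi> (Y (real k * d) \<omega>) * g (Y (real k * d) \<omega> - Y (real N * d) \<omega>)
        * ennreal (max 0 (Y (real k * d) \<omega> - Y (real N * d) \<omega>))" for \<omega>
  proof -
    \<comment> \<open>Periodic continuation of the increments after \<open>k\<close>: rotating by
      \<open>v\<close> becomes starting at \<open>v\<close>, which is the form required by
      \<open>sum_cyclic_max_neg\<close>.\<close>
    define x where "x i = incr d (k + i mod m) \<omega>" for i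
    have per: "x (i + m) = x i" for i by (simp add: x_def)
    have xs: "(\<Sum>i<m. x i) = Y (real N * d) \<omega> - Y (real k * d) \<omega>"
      using m sum_incr[where j=m and k=k and d=d and \<omega>=\<omega>] by (simp add: x_def)
    have xv: "(\<Sum>i<m. x (v + i)) = (\<Sum>i<m. x i)" for v
    proof (induction v)
      case (Suc v)
      have "(\<Sum>i<m. x (Suc v + i)) + x v = (\<Sum>i<Suc m. x (v + i))"
        by (subst sum.lessThan_Suc_shift) simp
      then show ?case using Suc per[of v] by simp
    qed simp
    have "G (\<lambda>i. incr d (\<pi> v i) \<omega>) = \<phi> (Y (real k * d) \<omega>) * g (- (\<Sum>i<m. x (v + i)))
      * ennreal (max 0 (- Max ((\<lambda>j. \<Sum>i<j. x (v + i)) ` {1..m})))" for v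
    proof -
      have "incr d (\<pi> v (k + i)) \<omega> = x (v + i)" for i by (simp add: \<pi>_def x_def add.commute)
      moreover have "(\<Sum>i<k. incr d (\<pi> v i) \<omega>) = Y (real k * d) \<omega>"
        by (simp add: \<pi>_def sum_incr0[symmetric])
      ultimately show ?thesis unfolding G_def by (simp only:)
    qed
    then have "G (\<lambda>i. incr d (\<pi> v i) \<omega>) = \<phi> (Y (real k * d) \<omega>) * g (Y (real k * d) \<omega> - Y (real N * d) \<omega>)
      * ennreal (max 0 (- Max ((\<lambda>j. \<Sum>i<j. x (v + i)) ` {1..m})))" for v
      by (simp only: xv xs minus_diff_eq)
    then have "(\<Sum>v<m. G (\<lambda>i. incr d (\<pi> v i) \<omega>)) = \<phi> (Y (real k * d) \<omega>) * g (Y (real k * d) \<omega> - Y (real N * d) \<omega>)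
      * ennreal (\<Sum>v<m. max 0 (- Max ((\<lambda>j. \<Sum>i<j. x (v + i)) ` {1..m})))"
      by (subst sum_ennreal[symmetric]) (auto simp: sum_distrib_left)
    then show ?thesis unfolding sum_cyclic_max_neg[where x=x, OF \<open>m > 0\<close> per] xs by simp
  qed
  have "of_nat m * ?L = (\<Sum>v<m. \<integral>\<^sup>+\<omega>. G (\<lambda>i. incr d (\<pi> v i) \<omega>) \<partial>M)"
    using shift L by simp
  also have "\<dots> = (\<integral>\<^sup>+\<omega>. (\<Sum>v<m. G (\<lambda>i. incr d (\<pi> v i) \<omega>)) \<partial>M)"
  proof (intro nn_integral_sum[symmetric])
    fix v
    have "(\<lambda>\<omega>. G (\<lambda>i. incr d (\<pi> v i) \<omega>)) = (\<lambda>\<omega>. G (\<lambda>i\<in>{..<N}. incr d (\<pi> v i) \<omega>))"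
      by (intro ext G_cong) auto
    also have "\<dots> \<in> borel_measurable M"
      by (rule measurable_compose[OF _ G_meas]) (auto intro!: measurable_restrict)
    finally show "(\<lambda>\<omega>. G (\<lambda>i. incr d (\<pi> v i) \<omega>)) \<in> borel_measurable M" .
  qed
  also have "\<dots> = ?R" unfolding G_sum ..
  finally have "?R = of_nat m * ?L" by simp
  moreover have "ennreal (1 / real m) * (of_nat m * ?L) = ?L"
    using m by (simp add: ennreal_of_nat_eq_real_of_nat mult.assoc[symmetric] ennreal_mult[symmetric])
  ultimately show ?thesis unfolding m_def[symmetric] by simp
qed

end

section \<open>Paths without negative jumps\<close>

lemma right_cont_seq:
  fixes x :: "real \<Rightarrow> real"
  assumes "(x \<longlongrightarrow> x s) (at_right s)" "t \<longlonglongrightarrow> s" "\<And>i. s \<le> t i"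
  shows "(\<lambda>i. x (t i)) \<longlonglongrightarrow> x s"
proof -
  have "(x \<longlongrightarrow> x s) (inf (nhds s) (principal {s..}))"
    using assms(1) unfolding at_within_Ici_at_right[symmetric] tendsto_at_within_iff_tendsto_nhds .
  moreover have "filterlim t (inf (nhds s) (principal {s..})) sequentially"
    using assms(2,3) by (auto simp: filterlim_inf filterlim_principal)
  ultimately show ?thesis by (rule filterlim_compose)
qed

lemma dyadic_tendsto_0: "(\<lambda>n. c / 2 ^ n :: real) \<longlonglongrightarrow> 0"
  using tendsto_mult[OF tendsto_const[of c] LIMSEQ_power_zero[of "1/2 :: real"]]
  by (simp add: power_one_over field_simps)

text \<open>Right-continuity keeps \<open>x\<close> above \<open>v\<close> on an interval to the
  right of \<open>t\<close>, and every mesh shorter than this interval has a point in it. The grid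
  point is strictly later than \<open>t\<close>, so even \<open>t = 0\<close> leads to a positive
  time.\<close>

lemma dyadic_exceedance:
  fixes x :: "real \<Rightarrow> real"
  assumes x: "(x \<longlongrightarrow> x t) (at_right t)" and t: "0 \<le> t" "t < b" "v < x t" and T: "T > 0"
  shows "\<exists>n0. \<forall>n\<ge>n0. \<exists>k>0. t < real k * (T / 2 ^ n) \<and> real k * (T / 2 ^ n) < b \<and> v < x (real k * (T / 2 ^ n))"
proof -
  obtain b' where b': "t < b'" "\<And>y. t < y \<Longrightarrow> y < b' \<Longrightarrow> v < x y"
    using order_tendstoD(1)[OF x t(3)] unfolding eventually_at_right_field by blast
  have "eventually (\<lambda>n. T / 2 ^ n < min b b' - t) sequentially"
    using order_tendstoD(2)[OF dyadic_tendsto_0[of T]] b' t by simp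
  then obtain n0 where n0: "\<And>n. n \<ge> n0 \<Longrightarrow> T / 2 ^ n < min b b' - t"
    by (auto simp: eventually_sequentially)
  show ?thesis
  proof (rule exI[of _ n0], intro allI impI)
    fix n assume n: "n \<ge> n0"
    define d where "d = T / 2 ^ n"
    have d: "d > 0" "t + d < b" "t + d < b'" using n0[OF n] T by (auto simp: d_def)
    define k where "k = nat (\<lfloor>t / d\<rfloor> + 1)"
    have "real k = of_int \<lfloor>t / d\<rfloor> + 1" using t d by (simp add: k_def)
    then have "t / d < real k" "real k \<le> t / d + 1" by linarith+
    then have "t < real k * d" "real k * d \<le> t + d" using d by (auto simp: field_simps)
    moreover have "k > 0" using t d by (simp add: k_def)
    ultimately show "\<exists>k>0. t < real k * (T / 2 ^ n) \<and> real k * (T / 2 ^ n) < b \<and> v < x (real k * (T / 2 ^ n))"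
      using d unfolding d_def[symmetric] by (intro exI[of _ k]) (auto intro!: b')
  qed
qed

text \<open>Near a point \<open>a\<close>, values to the left are close to a left limit
  \<open>l \<le> x a\<close> and values from \<open>a\<close> on are close to \<open>x a\<close>, so
  going forward in time loses little. Compactness makes this uniform: \<open>\<delta>\<close> is a
  Lebesgue number of the cover by open sets that contain no descent of size
  \<open>e\<close>.\<close>

lemma small_downsteps:
  fixes x :: "real \<Rightarrow> real"
  assumes right: "\<And>t. t \<ge> 0 \<Longrightarrow> (x \<longlongrightarrow> x t) (at_right t)"
    and left: "\<And>t. t > 0 \<Longrightarrow> \<exists>l\<le>x t. (x \<longlongrightarrow> l) (at_left t)"
    and e: "e > 0"
  shows "\<exists>\<delta>>0. \<forall>s t. 0 \<le> s \<longrightarrow> s \<le> t \<longrightarrow> t \<le> T \<longrightarrow> t - s < \<delta> \<longrightarrow> x s - x t < e"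
proof -
  define e' where "e' = e / 3"
  have e': "e' > 0" "e = 3 * e'" using e by (auto simp: e'_def)
  define \<G> where "\<G> = {G. open G \<and> (\<forall>s\<in>G. \<forall>t\<in>G. 0 \<le> s \<longrightarrow> s \<le> t \<longrightarrow> x s - x t < e)}"
  have "{0..T} \<subseteq> \<Union>\<G>"
  proof
    fix a assume a: "a \<in> {0..T}"
    obtain b where b: "a < b" "\<And>y. a < y \<Longrightarrow> y < b \<Longrightarrow> dist (x y) (x a) < e'"
      using tendstoD[OF right[of a], of "e'"] a e' unfolding eventually_at_right_field by auto
    have "\<exists>c<a. \<exists>l. \<forall>s. c < s \<longrightarrow> s < a \<longrightarrow> 0 \<le> s \<longrightarrow> dist (x s) l < e' \<and> l \<le> x a"
    proof (cases "a = 0")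
      case False
      then obtain l where l: "l \<le> x a" "(x \<longlongrightarrow> l) (at_left a)" using left[of a] a by auto
      obtain c where "c < a" "\<And>y. c < y \<Longrightarrow> y < a \<Longrightarrow> dist (x y) l < e'"
        using tendstoD[OF l(2), of "e'"] e' unfolding eventually_at_left_field by auto
      then show ?thesis using l by blast
    \<comment> \<open>At \<open>a = 0\<close> there are no nonnegative times to the left, so any
      negative \<open>c\<close> will do.\<close>
    qed (auto intro!: exI[of _ "-1"])
    then obtain c l where c: "c < a" "\<And>s. c < s \<Longrightarrow> s < a \<Longrightarrow> 0 \<le> s \<Longrightarrow> dist (x s) l < e' \<and> l \<le> x a"
      by blast
    have "x s - x t < e" if "s \<in> {c<..<b}" "t \<in> {c<..<b}" "0 \<le> s" "s \<le> t" for s t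
    proof -
      have s: "if s < a then dist (x s) l < e' \<and> l \<le> x a else dist (x s) (x a) < e'"
        using c(2)[of s] b(2)[of s] that e' by (cases "s = a") auto
      have t: "if t < a then dist (x t) l < e' \<and> l \<le> x a else dist (x t) (x a) < e'"
        using c(2)[of t] b(2)[of t] that e' by (cases "t = a") auto
      show ?thesis using s t that unfolding dist_real_def e'(2) by (auto simp: abs_less_iff split: if_splits)
    qed
    then have "{c<..<b} \<in> \<G>" unfolding \<G>_def by auto
    moreover have "a \<in> {c<..<b}" using b c by simp
    ultimately show "a \<in> \<Union>\<G>" by blast
  qed
  then obtain \<delta> where \<delta>: "0 < \<delta>" "\<And>a. a \<in> {0..T} \<Longrightarrow> \<exists>G\<in>\<G>. ball a \<delta> \<subseteq> G"
    using Heine_Borel_lemma[of "{0..T}" \<G>] unfolding \<G>_def by (metis (no_types, lifting) compact_Icc mem_Collect_eq)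
  have "x s - x t < e" if st: "0 \<le> s" "s \<le> t" "t \<le> T" "t - s < \<delta>" for s t
  proof -
    obtain G where "G \<in> \<G>" "ball s \<delta> \<subseteq> G" using \<delta>(2)[of s] st by auto
    moreover have "s \<in> ball s \<delta>" "t \<in> ball s \<delta>" using st \<delta>(1) by (auto simp: dist_real_def)
    ultimately show ?thesis using st unfolding \<G>_def by blast
  qed
  then show ?thesis using \<delta>(1) by blast
qed

context spos_levy
begin

text \<open>Rounding the time up to the next dyadic point leaves countably many times, each with a
  measurable value, and right-continuity gives the limit. Negative times are first moved to
  \<open>0\<close>, as right-continuity is only assumed from \<open>0\<close> on.\<close>

lemma Y_pair_measurable: "(\<lambda>p. Y (snd p) (fst p)) \<in> borel_measurable (M \<Otimes>\<^sub>M borel)"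
proof (rule borel_measurable_LIMSEQ_metric)
  fix n :: nat
  define f where "f i p = Y ((of_int i + 1) / 2 ^ n) (fst p)" for i :: int and p :: "'a \<times> real"
  have "(\<lambda>p :: 'a \<times> real. f \<lfloor>max 0 (snd p) * 2 ^ n\<rfloor> p) \<in> borel_measurable (M \<Otimes>\<^sub>M borel)"
    by (rule measurable_compose_countable) (auto simp: f_def)
  then show "(\<lambda>p :: 'a \<times> real. Y ((of_int \<lfloor>max 0 (snd p) * 2 ^ n\<rfloor> + 1) / 2 ^ n) (fst p)) \<in> borel_measurable (M \<Otimes>\<^sub>M borel)"
    by (simp add: f_def)
next
  fix p :: "'a \<times> real"
  define t where "t = max 0 (snd p)"
  have t0: "0 \<le> t" by (simp add: t_def)
  define s where "s n = (of_int \<lfloor>t * 2 ^ n\<rfloor> + 1) / (2 ^ n :: real)" for n :: nat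
  have s: "t \<le> s n" "s n \<le> t + 1 / 2 ^ n" for n
  proof -
    have "t * 2 ^ n \<le> of_int \<lfloor>t * 2 ^ n\<rfloor> + 1" "of_int \<lfloor>t * 2 ^ n\<rfloor> + 1 \<le> t * 2 ^ n + 1" by linarith+
    then show "t \<le> s n" "s n \<le> t + 1 / 2 ^ n" by (auto simp: s_def field_simps)
  qed
  have "s \<longlonglongrightarrow> t"
    using s tendsto_add[OF tendsto_const dyadic_tendsto_0[of 1], of t]
    by (intro tendsto_sandwich[of "\<lambda>_. t" s _ "\<lambda>n. t + 1 / 2 ^ n"]) auto
  then have "(\<lambda>n. Y (s n) (fst p)) \<longlonglongrightarrow> Y t (fst p)"
    by (rule right_cont_seq[where x="\<lambda>s. Y s (fst p)", OF right_cont[OF t0] _ s(1)])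
  moreover have "Y t (fst p) = Y (snd p) (fst p)" by (auto simp: t_def max_def Y_nonpos)
  ultimately show "(\<lambda>n. Y ((of_int \<lfloor>max 0 (snd p) * 2 ^ n\<rfloor> + 1) / 2 ^ n) (fst p)) \<longlonglongrightarrow> Y (snd p) (fst p)"
    by (simp add: s_def t_def)
qed

lemma measurable_Y[measurable (raw)]:
  assumes [measurable]: "h \<in> borel_measurable N" "w \<in> measurable N M"
  shows "(\<lambda>x. Y (h x) (w x)) \<in> borel_measurable N"
proof -
  have "(\<lambda>x. (w x, h x)) \<in> measurable N (M \<Otimes>\<^sub>M borel)" by measurable
  from measurable_compose[OF this Y_pair_measurable] show ?thesis by simp
qed

end

section \<open>The last exit decomposition\<close>

text \<open>
  The last stretch of length \<open>T / 2 ^ j\<close> is cut off, since the weight \<open>1 / (T - s)\<close> is not integrable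
  up to \<open>T\<close> and gives no dominating function there. The limit \<open>j \<rightarrow> \<infinity>\<close> is taken by monotone
  convergence afterwards.
\<close>

locale last_exit_setup = spos_levy +
  fixes T C G :: real and \<phi> g :: "real \<Rightarrow> real" and j :: nat
  assumes T: "T > 0" and j: "j > 0"
    and cont: "continuous_on UNIV \<phi>" "continuous_on UNIV g"
    and bounds: "\<And>v. 0 \<le> \<phi> v" "\<And>v. \<phi> v \<le> C" "\<And>z. 0 \<le> g z" "\<And>z. g z \<le> C"
    and supp: "\<And>z. z \<le> 0 \<Longrightarrow> g z = 0" "\<And>z. z \<ge> G \<Longrightarrow> g z = 0" and G: "G \<ge> 0"
begin

lemma [measurable]: "\<phi> \<in> borel_measurable borel" "g \<in> borel_measurable borel"
  using cont by (auto intro: borel_measurable_continuous_onI)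

lemma C: "C \<ge> 0"
  using bounds(1,2)[of 0] by simp

text \<open>The exponent \<open>i + j\<close> in the mesh makes the cut-off \<open>a\<close> a grid
  point at every stage \<open>i\<close>, with index \<open>K i\<close>, just as \<open>T\<close> has
  index \<open>N i\<close>.\<close>

definition a :: real where "a = T - T / 2 ^ j"
definition d :: "nat \<Rightarrow> real" where "d i = T / 2 ^ (i + j)"
definition N :: "nat \<Rightarrow> nat" where "N i = 2 ^ (i + j)"
definition K :: "nat \<Rightarrow> nat" where "K i = 2 ^ i * (2 ^ j - 1)"

lemma d_pos: "d i > 0" using T by (simp add: d_def)
lemma Nd: "real (N i) * d i = T" by (simp add: d_def N_def)
lemma Kd: "real (K i) * d i = a"
  using T by (simp add: d_def K_def a_def of_nat_diff field_simps power_add)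
lemma a_less: "a < T" "0 < a"
  using T j by (auto simp: a_def field_simps)
lemma K_less: "K i < N i"
proof -
  have "real (K i) * d i < real (N i) * d i" using Kd Nd a_less by simp
  then show ?thesis using d_pos[of i] by simp
qed
lemma K_pos: "K i > 0"
proof -
  have "0 < real (K i) * d i" using Kd a_less by simp
  then show ?thesis using d_pos[of i] by (simp add: zero_less_mult_iff)
qed
lemma d_tendsto: "d \<longlonglongrightarrow> 0"
  using dyadic_tendsto_0[of "T / 2 ^ j"] by (simp add: d_def[abs_def] power_add mult.commute)

text \<open>All later indices up to \<open>N i\<close> are inspected, although
  \<open>exit_sum\<close> runs only over \<open>k \<le> K i\<close>: a path that is above the level
  after the cut-off contributes nothing instead of being truncated.\<close>

definition last_at :: "nat \<Rightarrow> 'a \<Rightarrow> real \<Rightarrow> nat \<Rightarrow> bool" where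
  "last_at i \<omega> v k \<longleftrightarrow> v < Y (real k * d i) \<omega> \<and> (\<forall>l\<in>{k<..N i}. Y (real l * d i) \<omega> \<le> v)"

definition F :: "'a \<Rightarrow> real \<Rightarrow> real" where
  "F \<omega> y = \<phi> y * g (y - Y T \<omega>)"

text \<open>The weight \<open>F\<close> at \<open>Y s\<close> times the ballot factor, which is the
  drop from \<open>Y s\<close> to \<open>Y T\<close> divided by the remaining time.\<close>

definition H :: "'a \<Rightarrow> real \<Rightarrow> real" where
  "H \<omega> s = \<phi> (Y s \<omega>) * (g (Y s \<omega> - Y T \<omega>) * (Y s \<omega> - Y T \<omega>)) / (T - s)"

lemma F_bounds: "0 \<le> F \<omega> y" "F \<omega> y \<le> C * C"
  using bounds C by (auto simp: F_def intro!: mult_mono)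

lemma g_id_bounds: "0 \<le> g z * z" "g z * z \<le> C * G"
proof -
  show "0 \<le> g z * z" using bounds(3)[of z] supp(1)[of z] by (cases "z \<le> 0") auto
  show "g z * z \<le> C * G"
  proof (cases "z \<le> 0 \<or> z \<ge> G")
    case True then show ?thesis using supp C G by auto
  next
    case False then show ?thesis using bounds C by (intro mult_mono) auto
  qed
qed

lemma H_nonneg: "s < T \<Longrightarrow> 0 \<le> H \<omega> s"
  using g_id_bounds bounds by (simp add: H_def)

text \<open>
  Integrating \<open>exit_sum\<close> over the level gives a sum of future maxima, to which the ballot identity
  applies. The steps of \<open>step_sum\<close> use right end points because paths are only right-continuous.
\<close>

definition exit_sum :: "nat \<Rightarrow> 'a \<times> real \<Rightarrow> ennreal" where
  "exit_sum i p = (\<Sum>k\<in>{1..K i}. ennreal (F (fst p) (Y (real k * d i) (fst p))) * of_bool (last_at i (fst p) (snd p) k))"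

definition step_sum :: "nat \<Rightarrow> 'a \<times> real \<Rightarrow> ennreal" where
  "step_sum i p = (\<Sum>k\<in>{1..K i}. ennreal (H (fst p) (real k * d i)) * indicator {real (k - 1) * d i<..real k * d i} (snd p))"

lemma exit_sum_measurable[measurable]: "exit_sum i \<in> borel_measurable (M \<Otimes>\<^sub>M lborel)"
  unfolding exit_sum_def[abs_def] last_at_def F_def by measurable

lemma step_sum_measurable[measurable]: "step_sum i \<in> borel_measurable (M \<Otimes>\<^sub>M lborel)"
  unfolding step_sum_def[abs_def] H_def by measurable

text \<open>Exchanging sums and integrals reduces the claim to one \<open>k\<close>. There the
  ballot identity divides the drop by the number \<open>N i - k\<close> of remaining steps, and this
  is the division by the remaining time \<open>T - k * d i\<close> together with a factor
  \<open>d i\<close>, the width of one step of \<open>step_sum\<close>.\<close>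

lemma exit_sum_integral: "(\<integral>\<^sup>+p. exit_sum i p \<partial>(M \<Otimes>\<^sub>M lborel)) = (\<integral>\<^sup>+p. step_sum i p \<partial>(M \<Otimes>\<^sub>M lborel))"
proof -
  have [measurable]: "Measurable.pred borel (\<lambda>v. last_at i \<omega> v k)" for \<omega> k
    unfolding last_at_def by measurable
  \<comment> \<open>For a fixed path, the levels whose last exceedance is at \<open>k\<close> form
    the half-open interval from the largest later value up to \<open>Y (k * d i)\<close>; it is
    empty if a later value is at least as large.\<close>
  have len: "(\<integral>\<^sup>+v. of_bool (last_at i \<omega> v k) \<partial>lborel)
    = ennreal (max 0 (- Max ((\<lambda>l. Y (real (k + l) * d i) \<omega> - Y (real k * d i) \<omega>) ` {1..N i - k})))"
    if k: "k < N i" for \<omega> k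
  proof -
    define m where "m = Max ((\<lambda>l. Y (real (k + l) * d i) \<omega> - Y (real k * d i) \<omega>) ` {1..N i - k})"
    have im: "{k<..N i} = (\<lambda>l. k + l) ` {1..N i - k}"
      using k by (auto simp: image_iff intro!: bexI[of _ "_ - k"])
    have "(\<forall>l\<in>{k<..N i}. Y (real l * d i) \<omega> \<le> v) \<longleftrightarrow> m \<le> v - Y (real k * d i) \<omega>" for v
    proof -
      have "(\<forall>l\<in>{k<..N i}. Y (real l * d i) \<omega> \<le> v) \<longleftrightarrow> (\<forall>l\<in>{1..N i - k}. Y (real (k + l) * d i) \<omega> - Y (real k * d i) \<omega> \<le> v - Y (real k * d i) \<omega>)"
      proof -
        have "(\<forall>l\<in>{k<..N i}. Y (real l * d i) \<omega> \<le> v) \<longleftrightarrow> (\<forall>l\<in>{1..N i - k}. Y (real (k + l) * d i) \<omega> \<le> v)"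
          unfolding im by (simp only: Set.ball_simps)
        then show ?thesis by simp
      qed
      also have "\<dots> \<longleftrightarrow> m \<le> v - Y (real k * d i) \<omega>"
        unfolding m_def using k by (subst Max_le_iff) (auto simp del: of_nat_add)
      finally show ?thesis .
    qed
    then have "of_bool (last_at i \<omega> v k) = (indicator {Y (real k * d i) \<omega> + m..<Y (real k * d i) \<omega>} v :: ennreal)" for v
      by (auto simp: last_at_def indicator_def algebra_simps)
    then show ?thesis
      unfolding m_def[symmetric] by (cases "m \<le> 0") (auto simp: max_def ennreal_neg)
  qed
  define mx where "mx k \<omega> = ennreal (max 0 (- Max ((\<lambda>l. Y (real (k + l) * d i) \<omega> - Y (real k * d i) \<omega>) ` {1..N i - k})))" for k \<omega>
  have [measurable]: "mx k \<in> borel_measurable M" for k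
    unfolding mx_def[abs_def] by (intro measurable_ennreal measurable_compose[OF _ measurable_ennreal] borel_measurable_max borel_measurable_const borel_measurable_uminus borel_measurable_Max borel_measurable_diff Y_measurable) simp
  note len = len[folded mx_def]
  have F_meas[measurable]: "(\<lambda>\<omega>. F \<omega> (Y t \<omega>)) \<in> borel_measurable M" for t
    unfolding F_def by measurable
  have H_meas[measurable]: "(\<lambda>\<omega>. H \<omega> t) \<in> borel_measurable M" for t
    unfolding H_def by measurable
  have "(\<integral>\<^sup>+p. exit_sum i p \<partial>(M \<Otimes>\<^sub>M lborel)) = (\<integral>\<^sup>+\<omega>. (\<integral>\<^sup>+v. exit_sum i (\<omega>, v) \<partial>lborel) \<partial>M)"
    by (rule lborel.nn_integral_fst[symmetric]) simp
  also have "\<dots> = (\<integral>\<^sup>+\<omega>. (\<Sum>k\<in>{1..K i}. ennreal (F \<omega> (Y (real k * d i) \<omega>)) * mx k \<omega>) \<partial>M)"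
  proof (intro nn_integral_cong)
    fix \<omega>
    have "(\<integral>\<^sup>+v. exit_sum i (\<omega>, v) \<partial>lborel) = (\<Sum>k\<in>{1..K i}. \<integral>\<^sup>+v. ennreal (F \<omega> (Y (real k * d i) \<omega>)) * of_bool (last_at i \<omega> v k) \<partial>lborel)"
      unfolding exit_sum_def fst_conv snd_conv by (rule nn_integral_sum) simp
    also have "\<dots> = (\<Sum>k\<in>{1..K i}. ennreal (F \<omega> (Y (real k * d i) \<omega>)) * mx k \<omega>)"
    proof (intro sum.cong refl)
      fix k assume "k \<in> {1..K i}"
      then have k: "k < N i" using K_less[of i] by simp
      show "(\<integral>\<^sup>+v. ennreal (F \<omega> (Y (real k * d i) \<omega>)) * of_bool (last_at i \<omega> v k) \<partial>lborel) = ennreal (F \<omega> (Y (real k * d i) \<omega>)) * mx k \<omega>"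
        unfolding len[OF k, symmetric] by (rule nn_integral_cmult) simp
    qed
    finally show "(\<integral>\<^sup>+v. exit_sum i (\<omega>, v) \<partial>lborel) = \<dots>" .
  qed
  also have "\<dots> = (\<Sum>k\<in>{1..K i}. \<integral>\<^sup>+\<omega>. ennreal (F \<omega> (Y (real k * d i) \<omega>)) * mx k \<omega> \<partial>M)"
    by (rule nn_integral_sum) measurable
  also have "\<dots> = (\<Sum>k\<in>{1..K i}. \<integral>\<^sup>+\<omega>. ennreal (H \<omega> (real k * d i)) * ennreal (d i) \<partial>M)"
  proof (intro sum.cong refl)
    fix k assume "k \<in> {1..K i}"
    then have k: "k < N i" using K_less[of i] by simp
    have "(\<integral>\<^sup>+\<omega>. ennreal (F \<omega> (Y (real k * d i) \<omega>)) * mx k \<omega> \<partial>M)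
      = (\<integral>\<^sup>+\<omega>. ennreal (\<phi> (Y (real k * d i) \<omega>)) * ennreal (g (Y (real k * d i) \<omega> - Y (real (N i) * d i) \<omega>)) * mx k \<omega> \<partial>M)"
      unfolding F_def Nd using bounds by (simp add: ennreal_mult')
    also have "\<dots> = ennreal (1 / real (N i - k)) * (\<integral>\<^sup>+\<omega>. ennreal (\<phi> (Y (real k * d i) \<omega>))
        * ennreal (g (Y (real k * d i) \<omega> - Y (real (N i) * d i) \<omega>))
        * ennreal (max 0 (Y (real k * d i) \<omega> - Y (real (N i) * d i) \<omega>)) \<partial>M)"
      unfolding mx_def using d_pos[of i] k
      by (intro nn_integral_future_max[where \<phi>="\<lambda>x. ennreal (\<phi> x)" and g="\<lambda>x. ennreal (g x)"]) simp_all
    also have "\<dots> = (\<integral>\<^sup>+\<omega>. ennreal (1 / real (N i - k)) * (ennreal (\<phi> (Y (real k * d i) \<omega>))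
        * ennreal (g (Y (real k * d i) \<omega> - Y (real (N i) * d i) \<omega>))
        * ennreal (max 0 (Y (real k * d i) \<omega> - Y (real (N i) * d i) \<omega>))) \<partial>M)"
      by (rule nn_integral_cmult[symmetric]) measurable
    also have "\<dots> = (\<integral>\<^sup>+\<omega>. ennreal (H \<omega> (real k * d i)) * ennreal (d i) \<partial>M)"
    proof (intro nn_integral_cong)
      fix \<omega>
      define z where "z = Y (real k * d i) \<omega> - Y (real (N i) * d i) \<omega>"
      have gen: "ennreal r * (ennreal a * ennreal b * ennreal c) = ennreal (r * (a * b * c))"
        if "0 \<le> r" "0 \<le> a" "0 \<le> b" "0 \<le> c" for r a b c
        using that by (simp add: ennreal_mult)
      have z: "g z * max 0 z = g z * z" using supp(1)[of z] by (cases "z \<le> 0") auto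
      have "T - real k * d i = real (N i - k) * d i" using k Nd[of i] by (simp add: of_nat_diff algebra_simps)
      then have "H \<omega> (real k * d i) = \<phi> (Y (real k * d i) \<omega>) * (g z * z) / (real (N i - k) * d i)"
        by (simp only: H_def z_def Nd)
      then have "H \<omega> (real k * d i) * d i = 1 / real (N i - k) * (\<phi> (Y (real k * d i) \<omega>) * g z * max 0 z)"
        using d_pos[of i] by (simp add: z mult.assoc)
      moreover have "0 \<le> H \<omega> (real k * d i)"
      proof (rule H_nonneg)
        have "real k * d i < real (N i) * d i" using k d_pos by simp
        then show "real k * d i < T" using Nd by simp
      qed
      ultimately show "ennreal (1 / real (N i - k)) * (ennreal (\<phi> (Y (real k * d i) \<omega>))
        * ennreal (g (Y (real k * d i) \<omega> - Y (real (N i) * d i) \<omega>))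
        * ennreal (max 0 (Y (real k * d i) \<omega> - Y (real (N i) * d i) \<omega>))) = ennreal (H \<omega> (real k * d i)) * ennreal (d i)"
        unfolding z_def[symmetric] using d_pos[of i]
        by (subst gen) (auto simp: bounds ennreal_mult[symmetric] less_imp_le simp del: ennreal_max_0)
    qed
    finally show "(\<integral>\<^sup>+\<omega>. ennreal (F \<omega> (Y (real k * d i) \<omega>)) * mx k \<omega> \<partial>M) = \<dots>" .
  qed
  also have "\<dots> = (\<integral>\<^sup>+\<omega>. (\<Sum>k\<in>{1..K i}. ennreal (H \<omega> (real k * d i)) * ennreal (d i)) \<partial>M)"
    by (rule nn_integral_sum[symmetric]) measurable
  also have "\<dots> = (\<integral>\<^sup>+\<omega>. (\<integral>\<^sup>+v. step_sum i (\<omega>, v) \<partial>lborel) \<partial>M)"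
  proof (intro nn_integral_cong)
    fix \<omega>
    have "(\<integral>\<^sup>+v. step_sum i (\<omega>, v) \<partial>lborel) = (\<Sum>k\<in>{1..K i}. \<integral>\<^sup>+v. ennreal (H \<omega> (real k * d i)) * indicator {real (k - 1) * d i<..real k * d i} v \<partial>lborel)"
      unfolding step_sum_def fst_conv snd_conv by (rule nn_integral_sum) simp
    also have "\<dots> = (\<Sum>k\<in>{1..K i}. ennreal (H \<omega> (real k * d i)) * ennreal (d i))"
      using d_pos[of i] by (intro sum.cong refl) (simp add: nn_integral_cmult_indicator of_nat_diff left_diff_distrib)
    finally show "(\<Sum>k\<in>{1..K i}. ennreal (H \<omega> (real k * d i)) * ennreal (d i)) = (\<integral>\<^sup>+v. step_sum i (\<omega>, v) \<partial>lborel)" by (rule sym)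
  qed
  also have "\<dots> = (\<integral>\<^sup>+p. step_sum i p \<partial>(M \<Otimes>\<^sub>M lborel))"
    by (rule lborel.nn_integral_fst) simp
  finally show ?thesis .
qed

lemma last_at_unique:
  assumes "last_at i \<omega> v k" "last_at i \<omega> v k'" "k \<le> N i" "k' \<le> N i"
  shows "k = k'"
proof (rule ccontr)
  assume ne: "k \<noteq> k'"
  have later: "Y (real l * d i) \<omega> \<le> v" if "last_at i \<omega> v m" "m < l" "l \<le> N i" for m l
    using that unfolding last_at_def by (metis greaterThanAtMost_iff)
  have above: "v < Y (real m * d i) \<omega>" if "last_at i \<omega> v m" for m
    using that unfolding last_at_def by (rule conjunct1)
  consider "k < k'" | "k' < k" using ne by linarith
  then show False
  proof cases
    case 1
    show False using later[OF assms(1) 1 assms(4)] above[OF assms(2)] by simp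
  next
    case 2
    show False using later[OF assms(2) 2 assms(3)] above[OF assms(1)] by simp
  qed
qed

lemma exit_sum_eq:
  assumes "k \<in> {1..K i}" "last_at i \<omega> v k"
  shows "exit_sum i (\<omega>, v) = ennreal (F \<omega> (Y (real k * d i) \<omega>))"
proof -
  have "exit_sum i (\<omega>, v) = (\<Sum>k'\<in>{1..K i}. if k' = k then ennreal (F \<omega> (Y (real k * d i) \<omega>)) else 0)"
    unfolding exit_sum_def fst_conv snd_conv
  proof (intro sum.cong refl)
    fix k' assume "k' \<in> {1..K i}"
    then have "k' \<le> N i" "k \<le> N i" using assms(1) K_less[of i] by auto
    then have "last_at i \<omega> v k' \<longleftrightarrow> k' = k"
      using assms(2) last_at_unique[of i \<omega> v k' k] by blast
    then show "ennreal (F \<omega> (Y (real k' * d i) \<omega>)) * of_bool (last_at i \<omega> v k') = (if k' = k then ennreal (F \<omega> (Y (real k * d i) \<omega>)) else 0)"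
      by simp
  qed
  then show ?thesis using assms by simp
qed

lemma exit_sum_eq_0: "(\<And>k. k \<in> {1..K i} \<Longrightarrow> \<not> last_at i \<omega> v k) \<Longrightarrow> exit_sum i (\<omega>, v) = 0"
  unfolding exit_sum_def fst_conv snd_conv by (intro sum.neutral) auto

text \<open>An integrable majorant that does not depend on the mesh. As \<open>k < N i\<close>, time
  \<open>T\<close> is among the later times, which gives \<open>Y T \<omega> \<le> v\<close>; a
  level above \<open>Y T \<omega> + G\<close> would put the exit value outside the support of
  \<open>g\<close>.\<close>

lemma exit_sum_le:
  "exit_sum i (\<omega>, v) \<le> ennreal (C * C) * indicator {Y T \<omega>..Y T \<omega> + G} v"
proof (cases "\<exists>k\<in>{1..K i}. last_at i \<omega> v k")
  case True
  then obtain k where k: "k \<in> {1..K i}" "last_at i \<omega> v k" by blast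
  define y where "y = Y (real k * d i) \<omega>"
  have kN: "k < N i" using k K_less[of i] by simp
  have y: "v < y" using k by (simp add: last_at_def y_def)
  have "Y (real (N i) * d i) \<omega> \<le> v" using k kN unfolding last_at_def by simp
  then have v: "Y T \<omega> \<le> v" by (simp add: Nd)
  show ?thesis
  proof (cases "v \<le> Y T \<omega> + G")
    case True
    then show ?thesis using exit_sum_eq[OF k] F_bounds(2)[of \<omega> y] v by (simp add: y_def ennreal_leI)
  next
    case False
    then have "g (y - Y T \<omega>) = 0" using y by (intro supp) simp
    then show ?thesis using exit_sum_eq[OF k] by (simp add: F_def y_def)
  qed
next
  case False
  then have "exit_sum i (\<omega>, v) = 0" by (intro exit_sum_eq_0) blast
  then show ?thesis by simp
qed

text \<open>In the limit \<open>F\<close> is evaluated at the level itself, no longer at a path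
  value: without negative jumps the path leaves the region above the level through the
  level.\<close>

definition exit_limit :: "'a \<times> real \<Rightarrow> ennreal" where
  "exit_limit p = ennreal (F (fst p) (snd p)) *
     of_bool ((\<exists>t\<in>{0<..a}. snd p < Y t (fst p)) \<and> (\<forall>t\<in>{a<..T}. Y t (fst p) \<le> snd p))"

lemma K_d_le_T: "k \<in> {1..K i} \<Longrightarrow> real k * d i \<le> a"
proof -
  assume "k \<in> {1..K i}"
  then have "real k * d i \<le> real (K i) * d i" using d_pos[of i] by simp
  then show ?thesis using Kd by simp
qed

lemma eventually_grid_exceeds:
  assumes "0 \<le> t" "t < b" "v < Y t \<omega>"
  shows "eventually (\<lambda>i. \<exists>k>0. t < real k * d i \<and> real k * d i < b \<and> v < Y (real k * d i) \<omega>) sequentially"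
proof -
  obtain n0 where "\<forall>n\<ge>n0. \<exists>k>0. t < real k * (T / 2 ^ n) \<and> real k * (T / 2 ^ n) < b \<and> v < Y (real k * (T / 2 ^ n)) \<omega>"
    using dyadic_exceedance[where x="\<lambda>t. Y t \<omega>", OF right_cont assms T] assms by blast
  then show ?thesis
    unfolding eventually_sequentially d_def by (intro exI[of _ n0]) auto
qed

text \<open>If the level is exceeded after \<open>a\<close>, right-continuity places a grid time
  there and every term vanishes. In the one case with a possibly nonzero limit it is the value at
  the last grid time above the level that has to converge; nothing is needed about that time
  itself.\<close>

lemma exit_sum_tendsto: "(\<lambda>i. exit_sum i p) \<longlonglongrightarrow> exit_limit p"
proof -
  obtain \<omega> v where p: "p = (\<omega>, v)" by (cases p)
  show ?thesis
  proof (cases "\<forall>t\<in>{a<..T}. Y t \<omega> \<le> v")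
    case False
    then obtain t where t: "a < t" "t \<le> T" "v < Y t \<omega>" by force
    have "eventually (\<lambda>i. \<exists>l. a < real l * d i \<and> l \<le> N i \<and> v < Y (real l * d i) \<omega>) sequentially"
    \<comment> \<open>No grid time later than \<open>T\<close> is available in the interval, but
      \<open>T\<close> lies on the grid itself. The end point \<open>a\<close> is treated in the
      same way below.\<close>
    proof (cases "t = T")
      case True
      then show ?thesis using t a_less Nd by (intro always_eventually allI exI[of _ "N _"]) auto
    next
      case False
      then have "t < T" using t by simp
      then have "eventually (\<lambda>i. \<exists>k>0. t < real k * d i \<and> real k * d i < T \<and> v < Y (real k * d i) \<omega>) sequentially"
        using t a_less by (intro eventually_grid_exceeds) auto
      then show ?thesis
      proof eventually_elim
        case (elim i)
        then obtain k where k: "t < real k * d i" "real k * d i < T" "v < Y (real k * d i) \<omega>" by blast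
        then have "real k * d i < real (N i) * d i" using Nd by simp
        then show ?case using k t d_pos[of i] by (intro exI[of _ k]) simp
      qed
    qed
    then have "eventually (\<lambda>i. exit_sum i p = 0) sequentially"
    proof eventually_elim
      case (elim i)
      then obtain l where l: "a < real l * d i" "l \<le> N i" "v < Y (real l * d i) \<omega>" by blast
      show ?case unfolding p
      proof (rule exit_sum_eq_0)
        fix k assume k: "k \<in> {1..K i}"
        then have "real k * d i < real l * d i" using K_d_le_T[OF k] l by simp
        then have "k < l" using d_pos[of i] by simp
        then have "l \<in> {k<..N i}" using l by simp
        then show "\<not> last_at i \<omega> v k" using l(3) unfolding last_at_def by (meson not_less)
      qed
    qed
    moreover have "exit_limit p = 0" using False by (auto simp: exit_limit_def p)
    ultimately show ?thesis by (simp add: tendsto_eventually)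
  next
    case after: True
    show ?thesis
    proof (cases "\<exists>t\<in>{0<..a}. v < Y t \<omega>")
      case False
      have "exit_sum i p = 0" for i unfolding p
      proof (rule exit_sum_eq_0)
        fix k assume k: "k \<in> {1..K i}"
        then have "real k * d i \<in> {0<..a}" using K_d_le_T[OF k] d_pos[of i] by simp
        then show "\<not> last_at i \<omega> v k" using False unfolding last_at_def by meson
      qed
      moreover have "exit_limit p = 0" using False by (auto simp: exit_limit_def p)
      ultimately show ?thesis by simp
    next
      case True
      then obtain t where t: "0 < t" "t \<le> a" "v < Y t \<omega>" by auto
      have lim: "exit_limit p = ennreal (F \<omega> v)" using True after by (simp add: exit_limit_def p)
      have "eventually (\<lambda>i. \<exists>k\<in>{1..K i}. v < Y (real k * d i) \<omega>) sequentially"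
      proof (cases "t = a")
        case True
        then show ?thesis using t K_pos Kd
          by (intro always_eventually allI bexI[of _ "K _"]) (auto simp: Suc_le_eq)
      next
        case False
        then have "t < a" using t by simp
        then have "eventually (\<lambda>i. \<exists>k>0. t < real k * d i \<and> real k * d i < a \<and> v < Y (real k * d i) \<omega>) sequentially"
          using t by (intro eventually_grid_exceeds) auto
        then show ?thesis
        proof eventually_elim
          case (elim i)
          then obtain k where k: "k > 0" "real k * d i < a" "v < Y (real k * d i) \<omega>" by blast
          then have "real k * d i < real (K i) * d i" using Kd by simp
          then show ?case using k d_pos[of i] by (intro bexI[of _ k]) auto
        qed
      qed
      then obtain i0 where i0: "\<And>i. i \<ge> i0 \<Longrightarrow> \<exists>k\<in>{1..K i}. v < Y (real k * d i) \<omega>"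
        by (auto simp: eventually_sequentially)
      \<comment> \<open>The candidates stop at \<open>K i\<close>; that no grid time between
        \<open>a\<close> and \<open>T\<close> is above \<open>v\<close> is the assumption of this
        case.\<close>
      define \<kappa> where "\<kappa> i = Max {k\<in>{1..K i}. v < Y (real k * d i) \<omega>}" for i
      have \<kappa>: "\<kappa> i \<in> {1..K i}" "v < Y (real (\<kappa> i) * d i) \<omega>" "last_at i \<omega> v (\<kappa> i)"
        "Y (real (\<kappa> i + 1) * d i) \<omega> \<le> v" if "i \<ge> i0" for i
      proof -
        have ne: "{k\<in>{1..K i}. v < Y (real k * d i) \<omega>} \<noteq> {}" using i0[OF that] by auto
        have "\<kappa> i \<in> {k\<in>{1..K i}. v < Y (real k * d i) \<omega>}"
          unfolding \<kappa>_def by (rule Max_in[OF _ ne]) simp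
        then show 1: "\<kappa> i \<in> {1..K i}" "v < Y (real (\<kappa> i) * d i) \<omega>" by auto
        have later: "Y (real l * d i) \<omega> \<le> v" if l: "\<kappa> i < l" "l \<le> N i" for l
        proof (cases "l \<le> K i")
          case True
          show ?thesis
          proof (rule ccontr)
            assume "\<not> ?thesis"
            then have "l \<le> \<kappa> i" unfolding \<kappa>_def using True l 1 by (intro Max_ge) auto
            then show False using l by simp
          qed
        next
          case False
          then have "real (K i) * d i < real l * d i" "real l * d i \<le> real (N i) * d i"
            using d_pos[of i] l by simp_all
          then show ?thesis using after Kd Nd by simp
        qed
        show "last_at i \<omega> v (\<kappa> i)" using 1 later by (auto simp: last_at_def)
        show "Y (real (\<kappa> i + 1) * d i) \<omega> \<le> v" using 1 K_less[of i] by (intro later) auto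
      qed
      \<comment> \<open>Two consecutive grid values enclose \<open>v\<close>, so the distance to
        \<open>v\<close> is at most one downward step of the grid.\<close>
      have "(\<lambda>i. Y (real (\<kappa> i) * d i) \<omega>) \<longlonglongrightarrow> v"
      proof (rule LIMSEQ_I)
        fix e :: real assume e: "e > 0"
        obtain \<delta> where \<delta>: "\<delta> > 0" "\<And>s t. 0 \<le> s \<Longrightarrow> s \<le> t \<Longrightarrow> t \<le> T \<Longrightarrow> t - s < \<delta> \<Longrightarrow> Y s \<omega> - Y t \<omega> < e"
          using small_downsteps[where x="\<lambda>t. Y t \<omega>" and T=T, OF right_cont left_lim e] by blast
        obtain i1 where i1: "\<And>i. i \<ge> i1 \<Longrightarrow> d i < \<delta>"
          using order_tendstoD(2)[OF d_tendsto \<delta>(1)] by (auto simp: eventually_sequentially)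
        show "\<exists>no. \<forall>i\<ge>no. norm (Y (real (\<kappa> i) * d i) \<omega> - v) < e"
        proof (rule exI[of _ "max i0 i1"], intro allI impI)
          fix i assume i: "max i0 i1 \<le> i"
          note k = \<kappa>[of i]
          have "real (\<kappa> i + 1) * d i \<le> real (N i) * d i"
            using k(1) i K_less[of i] d_pos[of i] by (intro mult_right_mono) auto
          then have "real (\<kappa> i + 1) * d i \<le> T" using Nd by simp
          then have "Y (real (\<kappa> i) * d i) \<omega> - Y (real (\<kappa> i + 1) * d i) \<omega> < e"
            using d_pos[of i] i1[of i] i by (intro \<delta>(2)) (auto simp: algebra_simps)
          then show "norm (Y (real (\<kappa> i) * d i) \<omega> - v) < e"
            using k i by auto
        qed
      qed
      moreover have "continuous_on UNIV (F \<omega>)"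
        unfolding F_def by (intro continuous_intros continuous_on_compose2[OF cont(2)] cont) auto
      ultimately have "(\<lambda>i. F \<omega> (Y (real (\<kappa> i) * d i) \<omega>)) \<longlonglongrightarrow> F \<omega> v"
        by (auto intro: continuous_on_tendsto_compose)
      then have "(\<lambda>i. ennreal (F \<omega> (Y (real (\<kappa> i) * d i) \<omega>))) \<longlonglongrightarrow> exit_limit p"
        unfolding lim by (rule tendsto_ennrealI)
      moreover have "eventually (\<lambda>i. ennreal (F \<omega> (Y (real (\<kappa> i) * d i) \<omega>)) = exit_sum i p) sequentially"
        unfolding eventually_sequentially p
        by (intro exI[of _ i0] allI impI exit_sum_eq[symmetric] \<kappa>)
      ultimately show ?thesis by (rule Lim_transform_eventually)
    qed
  qed
qed

definition step_limit :: "'a \<times> real \<Rightarrow> ennreal" where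
  "step_limit p = ennreal (H (fst p) (snd p)) * indicator {0<..a} (snd p)"

lemma step_sum_eq_0:
  assumes "s \<notin> {0<..a}"
  shows "step_sum i (\<omega>, s) = 0"
  unfolding step_sum_def fst_conv snd_conv
proof (intro sum.neutral ballI)
  fix k assume k: "k \<in> {1..K i}"
  have "0 \<le> real (k - 1) * d i" using d_pos[of i] by simp
  then have "s \<notin> {real (k - 1) * d i<..real k * d i}"
    using assms K_d_le_T[OF k] unfolding greaterThanAtMost_iff by linarith
  then show "ennreal (H \<omega> (real k * d i)) * indicator {real (k - 1) * d i<..real k * d i} s = 0" by simp
qed

lemma step_sum_eq:
  assumes s: "s \<in> {0<..a}"
  shows "\<exists>k\<in>{1..K i}. s \<le> real k * d i \<and> real k * d i \<le> s + d i \<and>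
    (\<forall>\<omega>. step_sum i (\<omega>, s) = ennreal (H \<omega> (real k * d i)))"
proof -
  \<comment> \<open>The cells are open on the left and closed on the right, so rounding up finds the
    one that contains \<open>s\<close>, and its right end point is less than one mesh away.\<close>
  define k where "k = nat \<lceil>s / d i\<rceil>"
  have sd: "0 < s / d i" using s d_pos[of i] by simp
  have "real k = of_int \<lceil>s / d i\<rceil>" using sd by (simp add: k_def)
  then have k: "s / d i \<le> real k" "real k < s / d i + 1" by linarith+
  have k0: "k \<ge> 1" using k sd by (cases k) auto
  have k1: "s \<le> real k * d i" "real k * d i < s + d i" using k d_pos[of i] by (auto simp: field_simps)
  have "real k * d i < real (K i + 1) * d i" using k1 s Kd[of i] by (simp add: algebra_simps)
  then have kK: "k \<in> {1..K i}" using d_pos[of i] k0 by simp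
  have iff: "s \<in> {real (l - 1) * d i<..real l * d i} \<longleftrightarrow> l = k" if l: "l \<in> {1..K i}" for l
  proof
    assume *: "s \<in> {real (l - 1) * d i<..real l * d i}"
    have "real (l - 1) * d i = real l * d i - d i" using l by (simp add: of_nat_diff left_diff_distrib)
    then have "real l * d i < (real k + 1) * d i" "real k * d i < (real l + 1) * d i"
      using * k1 by (auto simp: distrib_right)
    then have "real l < real k + 1" "real k < real l + 1"
      using d_pos[of i] by (simp_all only: mult_less_cancel_right_pos)
    then show "l = k" by linarith
  next
    assume "l = k"
    then show "s \<in> {real (l - 1) * d i<..real l * d i}" using k1 k0 by (auto simp: of_nat_diff algebra_simps)
  qed
  have "step_sum i (\<omega>, s) = (\<Sum>l\<in>{1..K i}. if l = k then ennreal (H \<omega> (real k * d i)) else 0)" for \<omega>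
    unfolding step_sum_def fst_conv snd_conv
    by (intro sum.cong refl) (simp only: indicator_def iff, simp)
  then have "step_sum i (\<omega>, s) = ennreal (H \<omega> (real k * d i))" for \<omega> using kK by simp
  then show ?thesis using k1 by (intro bexI[OF _ kK]) auto
qed

lemma H_le: "s \<le> a \<Longrightarrow> H \<omega> s \<le> C * (C * G) / (T - a)"
  unfolding H_def using a_less C G
  by (intro frac_le mult_mono[OF bounds(2) g_id_bounds(2)] mult_nonneg_nonneg bounds g_id_bounds) auto

lemma step_sum_le: "step_sum i (\<omega>, s) \<le> ennreal (C * (C * G) / (T - a)) * indicator {0..T} s"
proof (cases "s \<in> {0<..a}")
  case True
  obtain k where k: "k \<in> {1..K i}" "step_sum i (\<omega>, s) = ennreal (H \<omega> (real k * d i))"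
    using step_sum_eq[OF True, of i] by blast
  show ?thesis using k True a_less H_le[OF K_d_le_T[OF k(1)], of \<omega>] by (simp add: ennreal_leI)
qed (simp add: step_sum_eq_0)

lemma step_sum_tendsto: "(\<lambda>i. step_sum i p) \<longlonglongrightarrow> step_limit p"
proof -
  obtain \<omega> s where p: "p = (\<omega>, s)" by (cases p)
  show ?thesis
  proof (cases "s \<in> {0<..a}")
    case True
    have "\<forall>i. \<exists>k. k \<in> {1..K i} \<and> s \<le> real k * d i \<and> real k * d i \<le> s + d i \<and> step_sum i (\<omega>, s) = ennreal (H \<omega> (real k * d i))"
      using step_sum_eq[OF True] by blast
    from choice[OF this] obtain k where "\<forall>i. k i \<in> {1..K i} \<and> s \<le> real (k i) * d i \<and> real (k i) * d i \<le> s + d i \<and> step_sum i (\<omega>, s) = ennreal (H \<omega> (real (k i) * d i))"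
      ..
    then have k: "\<And>i. s \<le> real (k i) * d i" "\<And>i. real (k i) * d i \<le> s + d i"
      "\<And>i. step_sum i (\<omega>, s) = ennreal (H \<omega> (real (k i) * d i))" by blast+
    have lim: "(\<lambda>i. real (k i) * d i) \<longlonglongrightarrow> s"
    proof (rule tendsto_sandwich)
      show "eventually (\<lambda>i. s \<le> real (k i) * d i) sequentially"
        by (intro always_eventually allI k)
      show "eventually (\<lambda>i. real (k i) * d i \<le> s + d i) sequentially"
        by (intro always_eventually allI k)
      show "(\<lambda>i. s + d i) \<longlonglongrightarrow> s"
        using tendsto_add[OF tendsto_const d_tendsto, of s] by simp
    qed simp
    have Ylim: "(\<lambda>i. Y (real (k i) * d i) \<omega>) \<longlonglongrightarrow> Y s \<omega>"
      using True by (intro right_cont_seq[where x="\<lambda>s. Y s \<omega>", OF right_cont lim k(1)]) simp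
    have \<phi>: "(\<lambda>i. \<phi> (Y (real (k i) * d i) \<omega>)) \<longlonglongrightarrow> \<phi> (Y s \<omega>)"
      using continuous_on_tendsto_compose[OF cont(1) Ylim] by simp
    have Ydiff: "(\<lambda>i. Y (real (k i) * d i) \<omega> - Y T \<omega>) \<longlonglongrightarrow> Y s \<omega> - Y T \<omega>"
      by (intro tendsto_intros Ylim)
    have g: "(\<lambda>i. g (Y (real (k i) * d i) \<omega> - Y T \<omega>)) \<longlonglongrightarrow> g (Y s \<omega> - Y T \<omega>)"
      using continuous_on_tendsto_compose[OF cont(2) Ydiff] by simp
    have "(\<lambda>i. H \<omega> (real (k i) * d i)) \<longlonglongrightarrow> H \<omega> s"
      unfolding H_def using True a_less by (intro tendsto_intros \<phi> g Ydiff lim) auto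
    then show ?thesis using True unfolding p step_limit_def k(3) by (simp add: tendsto_ennrealI)
  next
    case False
    then show ?thesis by (simp add: p step_sum_eq_0 step_limit_def)
  qed
qed

lemma exit_limit_measurable[measurable]: "exit_limit \<in> borel_measurable (M \<Otimes>\<^sub>M lborel)"
  by (rule borel_measurable_LIMSEQ_order[OF exit_sum_tendsto]) measurable

lemma step_limit_measurable[measurable]: "step_limit \<in> borel_measurable (M \<Otimes>\<^sub>M lborel)"
  unfolding step_limit_def[abs_def] H_def by measurable

definition exit_bound :: "'a \<times> real \<Rightarrow> ennreal" where
  "exit_bound p = ennreal (C * C) * indicator {Y T (fst p)..Y T (fst p) + G} (snd p)"

lemma exit_bound_measurable[measurable]: "exit_bound \<in> borel_measurable (M \<Otimes>\<^sub>M lborel)"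
  unfolding exit_bound_def[abs_def] indicator_def atLeastAtMost_iff by measurable

lemma exit_bound_finite: "(\<integral>\<^sup>+p. exit_bound p \<partial>(M \<Otimes>\<^sub>M lborel)) < \<infinity>"
proof -
  have "(\<integral>\<^sup>+p. exit_bound p \<partial>(M \<Otimes>\<^sub>M lborel)) = (\<integral>\<^sup>+\<omega>. (\<integral>\<^sup>+v. exit_bound (\<omega>, v) \<partial>lborel) \<partial>M)"
    by (rule lborel.nn_integral_fst[symmetric]) simp
  also have "\<dots> = (\<integral>\<^sup>+\<omega>. ennreal (C * C) * ennreal G \<partial>M)"
    using G by (intro nn_integral_cong) (simp add: exit_bound_def nn_integral_cmult_indicator)
  finally show ?thesis by (simp add: emeasure_space_1 ennreal_mult_less_top)
qed

lemma exit_limit_integral: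
  "(\<integral>\<^sup>+p. exit_limit p \<partial>(M \<Otimes>\<^sub>M lborel)) = (\<integral>\<^sup>+p. step_limit p \<partial>(M \<Otimes>\<^sub>M lborel))"
proof -
  have 1: "(\<lambda>i. \<integral>\<^sup>+p. exit_sum i p \<partial>(M \<Otimes>\<^sub>M lborel)) \<longlonglongrightarrow> (\<integral>\<^sup>+p. exit_limit p \<partial>(M \<Otimes>\<^sub>M lborel))"
  proof (rule nn_integral_dominated_convergence[where w=exit_bound])
    show "AE p in M \<Otimes>\<^sub>M lborel. exit_sum i p \<le> exit_bound p" for i
      using exit_sum_le by (intro AE_I2) (auto simp: exit_bound_def)
  qed (use exit_bound_finite exit_sum_tendsto in auto)
  have 2: "(\<lambda>i. \<integral>\<^sup>+p. step_sum i p \<partial>(M \<Otimes>\<^sub>M lborel)) \<longlonglongrightarrow> (\<integral>\<^sup>+p. step_limit p \<partial>(M \<Otimes>\<^sub>M lborel))"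
  proof (rule nn_integral_dominated_convergence[where w="\<lambda>p. ennreal (C * (C * G) / (T - a)) * indicator {0..T} (snd p)"])
    have "(\<integral>\<^sup>+p. ennreal (C * (C * G) / (T - a)) * indicator {0..T} (snd p) \<partial>(M \<Otimes>\<^sub>M lborel))
      = (\<integral>\<^sup>+\<omega>. (\<integral>\<^sup>+s. ennreal (C * (C * G) / (T - a)) * indicator {0..T} s \<partial>lborel) \<partial>M)"
      by (subst lborel.nn_integral_fst[symmetric]) auto
    also have "\<dots> = ennreal (C * (C * G) / (T - a)) * ennreal T"
      using T by (simp add: nn_integral_cmult_indicator emeasure_space_1)
    finally show "(\<integral>\<^sup>+p. ennreal (C * (C * G) / (T - a)) * indicator {0..T} (snd p) \<partial>(M \<Otimes>\<^sub>M lborel)) < \<infinity>"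
      by (simp add: ennreal_mult_less_top)
  qed (auto simp: step_sum_tendsto step_sum_le)
  show ?thesis
    using 1 2 unfolding exit_sum_integral by (rule LIMSEQ_unique)
qed

end

section \<open>Independent increments, exceedance events, and the identity up to time
  \<open>T\<close>\<close>

lemma (in prob_space) indep_var_nn_integral:
  assumes "indep_var S U S' V" and [measurable]: "H \<in> borel_measurable (S \<Otimes>\<^sub>M S')"
  shows "(\<integral>\<^sup>+\<omega>. H (U \<omega>, V \<omega>) \<partial>M) = (\<integral>\<^sup>+\<omega>. (\<integral>\<^sup>+\<omega>'. H (U \<omega>, V \<omega>') \<partial>M) \<partial>M)"
proof -
  have [measurable]: "U \<in> measurable M S" "V \<in> measurable M S'"
    and D: "distr M S U \<Otimes>\<^sub>M distr M S' V = distr M (S \<Otimes>\<^sub>M S') (\<lambda>x. (U x, V x))"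
    using assms(1) unfolding indep_var_distribution_eq by auto
  interpret V: prob_space "distr M S' V" by (rule prob_space_distr) simp
  have "(\<integral>\<^sup>+\<omega>. H (U \<omega>, V \<omega>) \<partial>M) = (\<integral>\<^sup>+z. H z \<partial>(distr M S U \<Otimes>\<^sub>M distr M S' V))"
    unfolding D by (subst nn_integral_distr) auto
  also have "\<dots> = (\<integral>\<^sup>+x. (\<integral>\<^sup>+y. H (x, y) \<partial>distr M S' V) \<partial>distr M S U)"
    by (rule V.nn_integral_fst[symmetric]) simp
  also have "\<dots> = (\<integral>\<^sup>+\<omega>. (\<integral>\<^sup>+y. H (U \<omega>, y) \<partial>distr M S' V) \<partial>M)"
    by (rule nn_integral_distr) (auto intro!: V.borel_measurable_nn_integral)
  also have "\<dots> = (\<integral>\<^sup>+\<omega>. (\<integral>\<^sup>+\<omega>'. H (U \<omega>, V \<omega>') \<partial>M) \<partial>M)"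
    by (intro nn_integral_cong nn_integral_distr) (auto intro!: measurable_Pair2)
  finally show ?thesis .
qed

context spos_levy
begin

lemma two_point_nn_integral:
  fixes H :: "real \<times> real \<Rightarrow> ennreal"
  assumes s: "0 \<le> s" "s \<le> T" and [measurable]: "H \<in> borel_measurable borel"
  shows "(\<integral>\<^sup>+\<omega>. H (Y s \<omega>, Y T \<omega> - Y s \<omega>) \<partial>M) = (\<integral>\<^sup>+\<omega>. (\<integral>\<^sup>+\<omega>'. H (Y s \<omega>, Y (T - s) \<omega>') \<partial>M) \<partial>M)"
proof -
  define t where "t = (\<lambda>i::nat. if i = 0 then 0 else if i = 1 then s else T)"
  define X where "X = (\<lambda>i \<omega>. Y (t (Suc i)) \<omega> - Y (t i) \<omega>)"
  have "indep_vars (\<lambda>_. borel) X {..<2}"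
    unfolding X_def using s by (intro indep_increments) (auto simp: t_def)
  then have "indep_var (PiM {0} (\<lambda>_. borel)) (\<lambda>\<omega>. restrict (\<lambda>i. X i \<omega>) {0}) (PiM {1} (\<lambda>_. borel)) (\<lambda>\<omega>. restrict (\<lambda>i. X i \<omega>) {1})"
    by (rule indep_var_restrict) auto
  then have "indep_var borel ((\<lambda>x. x 0) \<circ> (\<lambda>\<omega>. restrict (\<lambda>i. X i \<omega>) {0})) borel ((\<lambda>x. x 1) \<circ> (\<lambda>\<omega>. restrict (\<lambda>i. X i \<omega>) {1}))"
    by (rule indep_var_compose) auto
  then have ind: "indep_var borel (Y s) borel (\<lambda>\<omega>. Y T \<omega> - Y s \<omega>)"
    by (simp add: comp_def X_def t_def)
  have [measurable]: "H \<in> borel_measurable (borel \<Otimes>\<^sub>M borel)" by (simp add: borel_prod)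
  have "(\<integral>\<^sup>+\<omega>. H (Y s \<omega>, Y T \<omega> - Y s \<omega>) \<partial>M) = (\<integral>\<^sup>+\<omega>. (\<integral>\<^sup>+\<omega>'. H (Y s \<omega>, Y T \<omega>' - Y s \<omega>') \<partial>M) \<partial>M)"
    by (rule indep_var_nn_integral[OF ind]) simp
  also have "\<dots> = (\<integral>\<^sup>+\<omega>. (\<integral>\<^sup>+\<omega>'. H (Y s \<omega>, Y (T - s) \<omega>') \<partial>M) \<partial>M)"
  proof (rule nn_integral_cong)
    fix \<omega>
    have "(\<integral>\<^sup>+\<omega>'. H (Y s \<omega>, Y T \<omega>' - Y s \<omega>') \<partial>M) = (\<integral>\<^sup>+y. H (Y s \<omega>, y) \<partial>distr M borel (\<lambda>\<omega>. Y (s + (T - s)) \<omega> - Y s \<omega>))"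
      by (subst nn_integral_distr) auto
    also have "\<dots> = (\<integral>\<^sup>+y. H (Y s \<omega>, y) \<partial>distr M borel (Y (T - s)))"
      using s by (subst stationary) auto
    also have "\<dots> = (\<integral>\<^sup>+\<omega>'. H (Y s \<omega>, Y (T - s) \<omega>') \<partial>M)"
      by (subst nn_integral_distr) auto
    finally show "(\<integral>\<^sup>+\<omega>'. H (Y s \<omega>, Y T \<omega>' - Y s \<omega>') \<partial>M) = \<dots>" .
  qed
  finally show ?thesis .
qed

text \<open>The existence of a time replaces a supremum: right-continuity reduces it to dyadic
  times, which makes it measurable without completion. The drift \<open>c\<close> is relative to the
  one already contained in \<open>Y\<close>, and \<open>r\<close> is extended to cover an infinite
  horizon.\<close>

definition exceeds :: "real \<Rightarrow> ereal \<Rightarrow> real \<Rightarrow> 'a \<Rightarrow> bool" where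
  "exceeds c r v \<omega> \<longleftrightarrow> (\<exists>t>0. ereal t < r \<and> v < Y t \<omega> - c * t)"

lemma right_cont_drift:
  "0 \<le> t \<Longrightarrow> ((\<lambda>s. Y s \<omega> - c * s) \<longlongrightarrow> Y t \<omega> - c * t) (at_right t)"
  by (intro tendsto_intros right_cont)

lemma exceeds_grid:
  assumes "0 \<le> t" "ereal t < r" "v < Y t \<omega> - c * t" "h > 0"
  shows "\<exists>n0. \<forall>n\<ge>n0. \<exists>k>0. t < real k * (h / 2 ^ n) \<and> ereal (real k * (h / 2 ^ n)) < r \<and>
    v < Y (real k * (h / 2 ^ n)) \<omega> - c * (real k * (h / 2 ^ n))"
proof -
  obtain b where b: "t < b" "ereal b < r" using ereal_dense2[OF assms(2)] by auto
  from dyadic_exceedance[where x="\<lambda>t. Y t \<omega> - c * t", OF right_cont_drift assms(1) b(1) assms(3,4)] assms(1)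
  obtain n0 where n0: "\<forall>n\<ge>n0. \<exists>k>0. t < real k * (h / 2 ^ n) \<and> real k * (h / 2 ^ n) < b \<and>
    v < Y (real k * (h / 2 ^ n)) \<omega> - c * (real k * (h / 2 ^ n))" by blast
  show ?thesis
  proof (rule exI[of _ n0], intro allI impI, goal_cases)
    case (1 n)
    then obtain k where k: "k > 0" "t < real k * (h / 2 ^ n)" "real k * (h / 2 ^ n) < b"
      "v < Y (real k * (h / 2 ^ n)) \<omega> - c * (real k * (h / 2 ^ n))" using n0 by blast
    have "ereal (real k * (h / 2 ^ n)) < r"
      using k(3) b(2) by (metis less_ereal.simps(1) less_trans)
    then show ?case using k by blast
  qed
qed

lemma exceeds_iff_grid:
  assumes "h > 0"
  shows "exceeds c r v \<omega> \<longleftrightarrow> (\<exists>n k. 0 < real k * (h / 2 ^ n) \<and> ereal (real k * (h / 2 ^ n)) < r \<and>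
    v < Y (real k * (h / 2 ^ n)) \<omega> - c * (real k * (h / 2 ^ n)))"
proof
  assume "exceeds c r v \<omega>"
  then obtain t where t: "t > 0" "ereal t < r" "v < Y t \<omega> - c * t" by (auto simp: exceeds_def)
  then show "\<exists>n k. 0 < real k * (h / 2 ^ n) \<and> ereal (real k * (h / 2 ^ n)) < r \<and>
    v < Y (real k * (h / 2 ^ n)) \<omega> - c * (real k * (h / 2 ^ n))"
    using exceeds_grid[of t r v \<omega> c h] assms by (meson less_imp_le less_trans order_refl)
qed (auto simp: exceeds_def)

lemma exceeds_measurable[measurable (raw)]:
  assumes [measurable]: "f \<in> borel_measurable N" "w \<in> measurable N M"
  shows "Measurable.pred N (\<lambda>x. exceeds c r (f x) (w x))"
  unfolding exceeds_iff_grid[OF zero_less_one] by measurable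

text \<open>When the cut-off tends to \<open>T\<close>, exits just before \<open>T\<close> must not
  be lost on the left. If \<open>Y T < v\<close>, the left limit at \<open>T\<close> is at most
  \<open>Y T\<close>, so the path stays below \<open>v\<close> on a whole interval before
  \<open>T\<close> and its last exit precedes \<open>a j\<close> for large \<open>j\<close>. If
  \<open>v \<le> Y T\<close>, the weight \<open>g\<close> vanishes.\<close>

lemma last_exit_identity_pair:
  fixes \<phi> g :: "real \<Rightarrow> real"
  assumes T: "T > 0"
    and cont: "continuous_on UNIV \<phi>" "continuous_on UNIV g"
    and bounds: "\<And>v. 0 \<le> \<phi> v" "\<And>v. \<phi> v \<le> C" "\<And>z. 0 \<le> g z" "\<And>z. g z \<le> C"
    and supp: "\<And>z. z \<le> 0 \<Longrightarrow> g z = 0" "\<And>z. z \<ge> G \<Longrightarrow> g z = 0" and G: "G \<ge> 0"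
  shows "(\<integral>\<^sup>+p. ennreal (\<phi> (snd p) * g (snd p - Y T (fst p))) * of_bool (exceeds 0 (ereal T) (snd p) (fst p)) \<partial>(M \<Otimes>\<^sub>M lborel))
    = (\<integral>\<^sup>+p. ennreal (\<phi> (Y (snd p) (fst p)) * (g (Y (snd p) (fst p) - Y T (fst p)) * (Y (snd p) (fst p) - Y T (fst p))) / (T - snd p))
        * indicator {0<..<T} (snd p) \<partial>(M \<Otimes>\<^sub>M lborel))"
proof -
  interpret L: last_exit_setup M Y T C G \<phi> g "Suc j" for j
    using assms by unfold_locales auto
  define a where "a j = T - T / 2 ^ Suc j" for j
  have a: "0 < a j" "a j < T" for j using L.a_less unfolding L.a_def a_def by auto
  have a_lim: "a \<longlonglongrightarrow> T"
    using tendsto_diff[OF tendsto_const dyadic_tendsto_0[of "T/2"], of T] by (simp add: a_def[abs_def])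
  have a_mono: "a i \<le> a j" if "i \<le> j" for i j
    using that T by (simp add: a_def frac_le power_increasing)
  define E where "E j = L.exit_limit j" for j
  define R where "R j = L.step_limit j" for j
  have [measurable]: "E j \<in> borel_measurable (M \<Otimes>\<^sub>M lborel)" "R j \<in> borel_measurable (M \<Otimes>\<^sub>M lborel)" for j
    unfolding E_def R_def by measurable
  have E: "E j p = ennreal (\<phi> (snd p) * g (snd p - Y T (fst p))) *
     of_bool ((\<exists>t\<in>{0<..a j}. snd p < Y t (fst p)) \<and> (\<forall>t\<in>{a j<..T}. Y t (fst p) \<le> snd p))" for j p
    unfolding E_def L.exit_limit_def L.F_def L.a_def a_def ..
  define h where "h p = ennreal (\<phi> (Y (snd p) (fst p)) * (g (Y (snd p) (fst p) - Y T (fst p)) * (Y (snd p) (fst p) - Y T (fst p))) / (T - snd p))" for p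
  have R: "R j p = h p * indicator {0<..a j} (snd p)" for j p
    unfolding R_def L.step_limit_def L.H_def L.a_def a_def h_def ..
  have [measurable]: "g \<in> borel_measurable borel" "\<phi> \<in> borel_measurable borel"
    using cont by (auto intro: borel_measurable_continuous_onI)
  have E_lim: "(\<lambda>j. E j p) \<longlonglongrightarrow> ennreal (\<phi> (snd p) * g (snd p - Y T (fst p))) * of_bool (exceeds 0 (ereal T) (snd p) (fst p))"
    (is "_ \<longlonglongrightarrow> ?E p") for p
  proof -
    obtain \<omega> v where p: "p = (\<omega>, v)" by (cases p)
    show ?thesis
    proof (cases "v \<le> Y T \<omega>")
      case True
      then have E0: "E j p = 0" and "?E p = 0" for j by (auto simp: E p supp)
      then show ?thesis unfolding E0 by (simp only: tendsto_const)
    next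
      case False
      obtain l where l: "l \<le> Y T \<omega>" "((\<lambda>s. Y s \<omega>) \<longlongrightarrow> l) (at_left T)" using left_lim[OF T] by blast
      obtain b where b: "b < T" "\<And>t. b < t \<Longrightarrow> t < T \<Longrightarrow> Y t \<omega> < v"
        using order_tendstoD(2)[OF l(2), of v] l(1) False unfolding eventually_at_left_field by auto
      have 1: "eventually (\<lambda>j. \<forall>t\<in>{a j<..T}. Y t \<omega> \<le> v) sequentially"
        using order_tendstoD(1)[OF a_lim b(1)]
      proof eventually_elim
        case (elim j)
        show ?case
        proof
          fix t assume "t \<in> {a j<..T}"
          then show "Y t \<omega> \<le> v" using b(2)[of t] elim False by (cases "t = T") auto
        qed
      qed
      have 2: "eventually (\<lambda>j. (\<exists>t\<in>{0<..a j}. v < Y t \<omega>) \<longleftrightarrow> exceeds 0 (ereal T) v \<omega>) sequentially"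
      proof (cases "exceeds 0 (ereal T) v \<omega>")
        case True
        then obtain t where t: "0 < t" "t < T" "v < Y t \<omega>" by (auto simp: exceeds_def)
        show ?thesis using order_tendstoD(1)[OF a_lim t(2)]
          by eventually_elim (use t True in \<open>auto intro!: bexI[of _ t]\<close>)
      next
        case ne: False
        have "\<not> v < Y t \<omega>" if "t \<in> {0<..a j}" for t j
          using that a(2)[of j] ne unfolding exceeds_def by auto
        then have "(\<exists>t\<in>{0<..a j}. v < Y t \<omega>) \<longleftrightarrow> exceeds 0 (ereal T) v \<omega>" for j
          using ne by blast
        then show ?thesis by (intro always_eventually allI)
      qed
      have "eventually (\<lambda>j. E j p = ?E p) sequentially"
        using 1 2 by eventually_elim (simp add: E p)
      then show ?thesis by (rule tendsto_eventually)
    qed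
  qed
  have R_lim: "(\<lambda>j. R j p) \<longlonglongrightarrow> h p * indicator {0<..<T} (snd p)" for p
  proof (cases "snd p \<in> {0<..<T}")
    case True
    then have "eventually (\<lambda>j. snd p < a j) sequentially" by (intro order_tendstoD(1)[OF a_lim]) simp
    then have "eventually (\<lambda>j. R j p = h p * indicator {0<..<T} (snd p)) sequentially"
      by eventually_elim (use True in \<open>simp add: R\<close>)
    then show ?thesis by (rule tendsto_eventually)
  next
    case False
    then have "R j p = 0" for j using a(2)[of j] by (auto simp: R indicator_def)
    then show ?thesis using False by simp
  qed
  have "(\<lambda>j. \<integral>\<^sup>+p. E j p \<partial>(M \<Otimes>\<^sub>M lborel)) \<longlonglongrightarrow> (\<integral>\<^sup>+p. ?E p \<partial>(M \<Otimes>\<^sub>M lborel))"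
  proof (rule nn_integral_dominated_convergence[where w="L.exit_bound"])
    show "AE p in M \<Otimes>\<^sub>M lborel. E j p \<le> L.exit_bound p" for j
    proof (intro AE_I2)
      fix p
      show "E j p \<le> L.exit_bound p"
      proof (cases "snd p - Y T (fst p) \<in> {0<..<G}")
        case True
        have "\<phi> (snd p) * g (snd p - Y T (fst p)) \<le> C * C" using L.F_bounds(2) unfolding L.F_def .
        then show ?thesis using True by (auto simp: E L.exit_bound_def ennreal_leI)
      next
        case False
        then have "g (snd p - Y T (fst p)) = 0" using supp by force
        then show ?thesis by (simp add: E)
      qed
    qed
  qed (use L.exit_bound_finite E_lim in auto)
  moreover have "(\<lambda>j. \<integral>\<^sup>+p. R j p \<partial>(M \<Otimes>\<^sub>M lborel)) \<longlonglongrightarrow> (\<integral>\<^sup>+p. h p * indicator {0<..<T} (snd p) \<partial>(M \<Otimes>\<^sub>M lborel))"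
  proof (rule nn_integral_LIMSEQ)
    show "incseq R"
      using a_mono by (auto simp: incseq_def le_fun_def R indicator_def intro: order_trans)
  qed (use R_lim in auto)
  moreover have "(\<integral>\<^sup>+p. E j p \<partial>(M \<Otimes>\<^sub>M lborel)) = (\<integral>\<^sup>+p. R j p \<partial>(M \<Otimes>\<^sub>M lborel))" for j
    unfolding E_def R_def by (rule L.exit_limit_integral)
  ultimately show ?thesis unfolding h_def using LIMSEQ_unique by simp
qed

text \<open>For \<open>g = 1\<close> this is the mean of the negative part of \<open>Y r\<close>
  divided by \<open>r\<close>, the factor in the formula for \<open>A\<close>;
  \<open>ennreal (- Y r \<omega>)\<close> truncates to the negative part by itself.\<close>

definition ballot_weight :: "(real \<Rightarrow> ennreal) \<Rightarrow> real \<Rightarrow> ennreal" where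
  "ballot_weight g r = (\<integral>\<^sup>+\<omega>. g (- Y r \<omega>) * ennreal (- Y r \<omega>) \<partial>M) / ennreal r"

lemma ballot_weight_measurable[measurable]:
  assumes [measurable]: "g \<in> borel_measurable borel"
  shows "ballot_weight g \<in> borel_measurable borel"
  unfolding ballot_weight_def[abs_def] by measurable

text \<open>\<open>Y s\<close> and \<open>Y T - Y s\<close> are independent, and the latter has the
  law of \<open>Y (T - s)\<close>. This splits the integrand at time \<open>s\<close> into a mean
  over \<open>Y s\<close> and the ballot weight of the remaining time.\<close>

lemma last_exit_identity:
  fixes \<phi> g :: "real \<Rightarrow> real"
  assumes T: "T > 0"
    and cont: "continuous_on UNIV \<phi>" "continuous_on UNIV g"
    and bounds: "\<And>v. 0 \<le> \<phi> v" "\<And>v. \<phi> v \<le> C" "\<And>z. 0 \<le> g z" "\<And>z. g z \<le> C"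
    and supp: "\<And>z. z \<le> 0 \<Longrightarrow> g z = 0" "\<And>z. z \<ge> G \<Longrightarrow> g z = 0" and G: "G \<ge> 0"
  shows "(\<integral>\<^sup>+v. ennreal (\<phi> v) * (\<integral>\<^sup>+\<omega>. ennreal (g (v - Y T \<omega>)) * of_bool (exceeds 0 (ereal T) v \<omega>) \<partial>M) \<partial>lborel)
    = (\<integral>\<^sup>+s\<in>{0<..<T}. (\<integral>\<^sup>+\<omega>. ennreal (\<phi> (Y s \<omega>)) \<partial>M) * ballot_weight (\<lambda>z. ennreal (g z)) (T - s) \<partial>lborel)"
proof -
  interpret P: pair_sigma_finite M lborel ..
  have [measurable]: "g \<in> borel_measurable borel" "\<phi> \<in> borel_measurable borel"
    using cont by (auto intro: borel_measurable_continuous_onI)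
  have "(\<integral>\<^sup>+v. ennreal (\<phi> v) * (\<integral>\<^sup>+\<omega>. ennreal (g (v - Y T \<omega>)) * of_bool (exceeds 0 (ereal T) v \<omega>) \<partial>M) \<partial>lborel)
    = (\<integral>\<^sup>+v. (\<integral>\<^sup>+\<omega>. ennreal (\<phi> v * g (v - Y T \<omega>)) * of_bool (exceeds 0 (ereal T) v \<omega>) \<partial>M) \<partial>lborel)"
    by (intro nn_integral_cong, subst nn_integral_cmult[symmetric])
      (auto simp: ennreal_mult bounds mult.assoc)
  also have "\<dots> = (\<integral>\<^sup>+p. ennreal (\<phi> (snd p) * g (snd p - Y T (fst p))) * of_bool (exceeds 0 (ereal T) (snd p) (fst p)) \<partial>(M \<Otimes>\<^sub>M lborel))"
    by (subst P.nn_integral_snd[symmetric]) auto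
  also have "\<dots> = (\<integral>\<^sup>+p. ennreal (\<phi> (Y (snd p) (fst p)) * (g (Y (snd p) (fst p) - Y T (fst p)) * (Y (snd p) (fst p) - Y T (fst p))) / (T - snd p))
        * indicator {0<..<T} (snd p) \<partial>(M \<Otimes>\<^sub>M lborel))"
    by (rule last_exit_identity_pair[OF assms])
  also have "\<dots> = (\<integral>\<^sup>+s. (\<integral>\<^sup>+\<omega>. ennreal (\<phi> (Y s \<omega>) * (g (Y s \<omega> - Y T \<omega>) * (Y s \<omega> - Y T \<omega>)) / (T - s)) * indicator {0<..<T} s \<partial>M) \<partial>lborel)"
    by (subst P.nn_integral_snd[symmetric]) auto
  also have "\<dots> = (\<integral>\<^sup>+s\<in>{0<..<T}. (\<integral>\<^sup>+\<omega>. ennreal (\<phi> (Y s \<omega>)) \<partial>M) * ballot_weight (\<lambda>z. ennreal (g z)) (T - s) \<partial>lborel)"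
  proof (intro nn_integral_cong)
    fix s
    show "(\<integral>\<^sup>+\<omega>. ennreal (\<phi> (Y s \<omega>) * (g (Y s \<omega> - Y T \<omega>) * (Y s \<omega> - Y T \<omega>)) / (T - s)) * indicator {0<..<T} s \<partial>M)
      = (\<integral>\<^sup>+\<omega>. ennreal (\<phi> (Y s \<omega>)) \<partial>M) * ballot_weight (\<lambda>z. ennreal (g z)) (T - s) * indicator {0<..<T} s"
    proof (cases "s \<in> {0<..<T}")
      case True
      have gz: "ennreal (g z * z) = ennreal (g z) * ennreal z" for z
        using bounds(3)[of z] supp(1)[of z] by (cases "z \<le> 0") (auto simp: ennreal_mult)
      have nn: "0 \<le> g z * z" for z using bounds(3)[of z] supp(1)[of z] by (cases "z \<le> 0") auto
      have "(\<integral>\<^sup>+\<omega>. ennreal (\<phi> (Y s \<omega>) * (g (Y s \<omega> - Y T \<omega>) * (Y s \<omega> - Y T \<omega>)) / (T - s)) \<partial>M)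
        = (\<integral>\<^sup>+\<omega>. (\<lambda>(x, y). ennreal (\<phi> x * (g (- y) * (- y)) / (T - s))) (Y s \<omega>, Y T \<omega> - Y s \<omega>) \<partial>M)"
        by (simp only: prod.case minus_diff_eq)
      also have "\<dots> = (\<integral>\<^sup>+\<omega>. (\<integral>\<^sup>+\<omega>'. (\<lambda>(x, y). ennreal (\<phi> x * (g (- y) * (- y)) / (T - s))) (Y s \<omega>, Y (T - s) \<omega>') \<partial>M) \<partial>M)"
        using True by (intro two_point_nn_integral) (auto simp: borel_prod[symmetric])
      also have "\<dots> = (\<integral>\<^sup>+\<omega>. ennreal (\<phi> (Y s \<omega>)) * ballot_weight (\<lambda>z. ennreal (g z)) (T - s) \<partial>M)"
      proof (intro nn_integral_cong)
        fix \<omega>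
        have "(\<integral>\<^sup>+\<omega>'. (\<lambda>(x, y). ennreal (\<phi> x * (g (- y) * (- y)) / (T - s))) (Y s \<omega>, Y (T - s) \<omega>') \<partial>M)
          = (\<integral>\<^sup>+\<omega>'. ennreal (\<phi> (Y s \<omega>)) * (ennreal (g (- Y (T - s) \<omega>')) * ennreal (- Y (T - s) \<omega>') / ennreal (T - s)) \<partial>M)"
        proof (intro nn_integral_cong)
          fix \<omega>'
          define z where "z = - Y (T - s) \<omega>'"
          have "ennreal (\<phi> (Y s \<omega>) * (g z * z) / (T - s)) = ennreal (\<phi> (Y s \<omega>)) * (ennreal (g z) * ennreal z / ennreal (T - s))"
            using True bounds(1) nn[of z] by (simp add: gz[symmetric] divide_ennreal ennreal_mult[symmetric])
          then show "(\<lambda>(x, y). ennreal (\<phi> x * (g (- y) * (- y)) / (T - s))) (Y s \<omega>, Y (T - s) \<omega>')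
            = ennreal (\<phi> (Y s \<omega>)) * (ennreal (g (- Y (T - s) \<omega>')) * ennreal (- Y (T - s) \<omega>') / ennreal (T - s))"
            by (simp add: z_def)
        qed
        also have "\<dots> = ennreal (\<phi> (Y s \<omega>)) * ballot_weight (\<lambda>z. ennreal (g z)) (T - s)"
          unfolding ballot_weight_def by (simp add: nn_integral_cmult nn_integral_divide)
        finally show "(\<integral>\<^sup>+\<omega>'. (\<lambda>(x, y). ennreal (\<phi> x * (g (- y) * (- y)) / (T - s))) (Y s \<omega>, Y (T - s) \<omega>') \<partial>M) = \<dots>" .
      qed
      also have "\<dots> = (\<integral>\<^sup>+\<omega>. ennreal (\<phi> (Y s \<omega>)) \<partial>M) * ballot_weight (\<lambda>z. ennreal (g z)) (T - s)"
        by (rule nn_integral_multc) simp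
      finally show ?thesis using True by simp
    qed simp
  qed
  finally show ?thesis .
qed

section \<open>The Markov property at a fixed time\<close>

text \<open>Disjoint blocks of increments are independent, and
  \<open>nn_integral_incr_vector\<close> moves the second block to the start of a fresh copy of the
  path.\<close>

lemma nn_integral_past_future_incr:
  fixes N m :: nat
  assumes d: "d \<ge> 0"
    and [measurable]: "F \<in> borel_measurable (PiM {..<N} (\<lambda>_. borel) \<Otimes>\<^sub>M PiM {..<m} (\<lambda>_. borel))"
  shows "(\<integral>\<^sup>+\<omega>. F (\<lambda>i\<in>{..<N}. incr d i \<omega>, \<lambda>i\<in>{..<m}. incr d (N + i) \<omega>) \<partial>M)
    = (\<integral>\<^sup>+\<omega>. (\<integral>\<^sup>+\<omega>'. F (\<lambda>i\<in>{..<N}. incr d i \<omega>, \<lambda>i\<in>{..<m}. incr d i \<omega>') \<partial>M) \<partial>M)"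
proof -
  have "indep_var (PiM {..<N} (\<lambda>_. borel)) (\<lambda>\<omega>. restrict (\<lambda>i. incr d i \<omega>) {..<N})
     (PiM {N..<N+m} (\<lambda>_. borel)) (\<lambda>\<omega>. restrict (\<lambda>i. incr d i \<omega>) {N..<N+m})"
    by (rule indep_var_restrict[OF indep_incr[OF d, of "N + m"]]) auto
  then have "indep_var (PiM {..<N} (\<lambda>_. borel)) (id \<circ> (\<lambda>\<omega>. restrict (\<lambda>i. incr d i \<omega>) {..<N}))
     (PiM {..<m} (\<lambda>_. borel)) ((\<lambda>f. \<lambda>i\<in>{..<m}. f (N + i)) \<circ> (\<lambda>\<omega>. restrict (\<lambda>i. incr d i \<omega>) {N..<N+m}))"
    by (rule indep_var_compose) (auto intro!: measurable_restrict)
  also have "id \<circ> (\<lambda>\<omega>. restrict (\<lambda>i. incr d i \<omega>) {..<N}) = (\<lambda>\<omega>. \<lambda>i\<in>{..<N}. incr d i \<omega>)" by auto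
  also have "(\<lambda>f. \<lambda>i\<in>{..<m}. f (N + i)) \<circ> (\<lambda>\<omega>. restrict (\<lambda>i. incr d i \<omega>) {N..<N+m}) = (\<lambda>\<omega>. \<lambda>i\<in>{..<m}. incr d (N + i) \<omega>)"
    by (auto simp: fun_eq_iff)
  finally have ind: "indep_var (PiM {..<N} (\<lambda>_. borel)) (\<lambda>\<omega>. \<lambda>i\<in>{..<N}. incr d i \<omega>)
     (PiM {..<m} (\<lambda>_. borel)) (\<lambda>\<omega>. \<lambda>i\<in>{..<m}. incr d (N + i) \<omega>)" .
  have "(\<integral>\<^sup>+\<omega>. F (\<lambda>i\<in>{..<N}. incr d i \<omega>, \<lambda>i\<in>{..<m}. incr d (N + i) \<omega>) \<partial>M)
    = (\<integral>\<^sup>+\<omega>. (\<integral>\<^sup>+\<omega>'. F (\<lambda>i\<in>{..<N}. incr d i \<omega>, \<lambda>i\<in>{..<m}. incr d (N + i) \<omega>') \<partial>M) \<partial>M)"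
    by (rule indep_var_nn_integral[OF ind]) simp
  also have "\<dots> = (\<integral>\<^sup>+\<omega>. (\<integral>\<^sup>+\<omega>'. F (\<lambda>i\<in>{..<N}. incr d i \<omega>, \<lambda>i\<in>{..<m}. incr d i \<omega>') \<partial>M) \<partial>M)"
  proof (rule nn_integral_cong)
    fix \<omega>
    have [measurable]: "(\<lambda>i\<in>{..<N}. incr d i \<omega>) \<in> space (PiM {..<N} (\<lambda>_. borel))"
      by (auto simp: space_PiM)
    have "(\<lambda>y. F (\<lambda>i\<in>{..<N}. incr d i \<omega>, y)) \<in> borel_measurable (PiM {..<m} (\<lambda>_. borel))"
      by measurable
    then show "(\<integral>\<^sup>+\<omega>'. F (\<lambda>i\<in>{..<N}. incr d i \<omega>, \<lambda>i\<in>{..<m}. incr d (N + i) \<omega>') \<partial>M)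
        = (\<integral>\<^sup>+\<omega>'. F (\<lambda>i\<in>{..<N}. incr d i \<omega>, \<lambda>i\<in>{..<m}. incr d i \<omega>') \<partial>M)"
      using nn_integral_incr_vector[OF d, of "\<lambda>i. N + i" m "\<lambda>y. F (\<lambda>i\<in>{..<N}. incr d i \<omega>, y)"] by simp
  qed
  finally show ?thesis .
qed

definition exceeds_from :: "real \<Rightarrow> real \<Rightarrow> ereal \<Rightarrow> real \<Rightarrow> 'a \<Rightarrow> bool" where
  "exceeds_from a c r v \<omega> \<longleftrightarrow> (\<exists>t>0. ereal t < r \<and> v < Y (a + t) \<omega> - Y a \<omega> - c * t)"

text \<open>With \<open>4 ^ n\<close> points of mesh \<open>h / 2 ^ n\<close> the grid reaches up to
  \<open>2 ^ n * h\<close>, so it becomes finer and longer at once. Only finitely many times may be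
  used per stage, yet \<open>r\<close> may be infinite.\<close>

lemma grid_eventually_exceeds:
  fixes Z :: "real \<Rightarrow> real"
  assumes "\<And>t. 0 \<le> t \<Longrightarrow> (Z \<longlongrightarrow> Z t) (at_right t)" "h > 0"
  shows "eventually (\<lambda>n. (\<exists>k\<in>{1..4 ^ n}. ereal (real k * (h / 2 ^ n)) < r \<and> v < Z (real k * (h / 2 ^ n)))
    \<longleftrightarrow> (\<exists>t>0. ereal t < r \<and> v < Z t)) sequentially"
proof (cases "\<exists>t>0. ereal t < r \<and> v < Z t")
  case True
  then obtain t where t: "t > 0" "ereal t < r" "v < Z t" by blast
  obtain b where b: "t < b" "ereal b < r" using ereal_dense2[OF t(2)] by auto
  have t0: "0 \<le> t" using t by simp
  obtain n0 where n0: "\<forall>n\<ge>n0. \<exists>k>0. t < real k * (h / 2 ^ n) \<and> real k * (h / 2 ^ n) < b \<and> v < Z (real k * (h / 2 ^ n))"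
    using dyadic_exceedance[where x=Z, OF assms(1)[OF t0] t0 b(1) t(3) assms(2)] by blast
  have "eventually (\<lambda>n. (b / h) / 2 ^ n < 1) sequentially"
    by (rule order_tendstoD(2)[OF dyadic_tendsto_0]) simp
  moreover have "eventually (\<lambda>n. n \<ge> n0) sequentially" by simp
  ultimately show ?thesis
  proof eventually_elim
    case (elim n)
    then obtain k where k: "k > 0" "real k * (h / 2 ^ n) < b" "v < Z (real k * (h / 2 ^ n))" using n0 by blast
    have "real k < b / h * 2 ^ n" using k(2) assms(2) by (simp add: field_simps)
    also have "\<dots> \<le> 2 ^ n * 2 ^ n"
    proof (intro mult_right_mono)
      have "(b / h) / 2 ^ n * 2 ^ n \<le> 1 * 2 ^ n" using elim by (intro mult_right_mono) auto
      then show "b / h \<le> 2 ^ n" by simp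
    qed simp
    also have "\<dots> = real (4 ^ n)" by (simp add: power_mult_distrib[symmetric])
    finally have "k \<le> 4 ^ n" by (simp only: of_nat_less_iff less_imp_le)
    moreover have "ereal (real k * (h / 2 ^ n)) < r" using k(2) b(2) by (metis less_ereal.simps(1) less_trans)
    ultimately have "\<exists>k\<in>{1..4 ^ n}. ereal (real k * (h / 2 ^ n)) < r \<and> v < Z (real k * (h / 2 ^ n))"
      using k by (intro bexI[of _ k]) auto
    then show ?case using True by blast
  qed
next
  case False
  have "(\<exists>k\<in>{1..4 ^ n}. ereal (real k * (h / 2 ^ n)) < r \<and> v < Z (real k * (h / 2 ^ n)))
    \<longleftrightarrow> (\<exists>t>0. ereal t < r \<and> v < Z t)" for n
  proof
    assume "\<exists>k\<in>{1..4 ^ n}. ereal (real k * (h / 2 ^ n)) < r \<and> v < Z (real k * (h / 2 ^ n))"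
    then obtain k where "k \<in> {1..4 ^ n}" "ereal (real k * (h / 2 ^ n)) < r" "v < Z (real k * (h / 2 ^ n))" by blast
    then show "\<exists>t>0. ereal t < r \<and> v < Z t" using assms(2)
      by (intro exI[of _ "real k * (h / 2 ^ n)"]) auto
  qed (use False in blast)
  then show ?thesis by (intro always_eventually allI)
qed

text \<open>On the grid, the two events and \<open>H\<close> depend on two disjoint blocks of
  increments. The second argument of \<open>H\<close> refers to an integral multiple of
  \<open>a\<close> because this is a grid time at every stage. The switch \<open>b0\<close> turns
  off the condition on the past, so that one statement serves with and without it.\<close>

lemma markov_grid:
  fixes H :: "real \<times> real \<Rightarrow> ennreal" and w :: "real \<Rightarrow> real" and n :: nat
  assumes a: "a > 0" and [measurable]: "H \<in> borel_measurable borel" "w \<in> borel_measurable borel"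
  defines "\<delta> \<equiv> a / 2 ^ n"
  shows "(\<integral>\<^sup>+\<omega>. of_bool (b0 \<or> (\<exists>k\<in>{1..4 ^ n}. ereal (real k * \<delta>) < ereal a \<and> u < Y (real k * \<delta>) \<omega>))
      * H (Y a \<omega>, Y (a + real q * a) \<omega> - Y a \<omega>)
      * of_bool (\<exists>k\<in>{1..4 ^ n}. ereal (real k * \<delta>) < r \<and> w (Y a \<omega>) < Y (a + real k * \<delta>) \<omega> - Y a \<omega> - c * (real k * \<delta>)) \<partial>M)
    = (\<integral>\<^sup>+\<omega>. (\<integral>\<^sup>+\<omega>'. of_bool (b0 \<or> (\<exists>k\<in>{1..4 ^ n}. ereal (real k * \<delta>) < ereal a \<and> u < Y (real k * \<delta>) \<omega>))
      * H (Y a \<omega>, Y (real q * a) \<omega>')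
      * of_bool (\<exists>k\<in>{1..4 ^ n}. ereal (real k * \<delta>) < r \<and> w (Y a \<omega>) < Y (real k * \<delta>) \<omega>' - c * (real k * \<delta>)) \<partial>M) \<partial>M)"
proof -
  define N :: nat where "N = 2 ^ n"
  \<comment> \<open>Long enough for both uses of the future: \<open>q * 2 ^ n\<close> steps cover
    the increment over \<open>q * a\<close>, and \<open>4 ^ n\<close> steps cover the search for an
    exceedance.\<close>
  define m :: nat where "m = q * 2 ^ n + 4 ^ n"
  have \<delta>: "\<delta> > 0" "real N * \<delta> = a" using a by (auto simp: \<delta>_def N_def)
  have q\<delta>: "real (q * 2 ^ n) * \<delta> = real q * a" by (simp add: \<delta>_def)
  have kN: "ereal (real k * \<delta>) < ereal a \<longleftrightarrow> k < N" for k
    using \<delta> by (metis less_ereal.simps(1) mult_less_cancel_right_pos of_nat_less_iff)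
  define F where "F = (\<lambda>(x, y). of_bool (b0 \<or> (\<exists>k\<in>{1..<N}. u < (\<Sum>i<k. x i)))
      * H (\<Sum>i<N. x i, \<Sum>i<q * 2 ^ n. y i)
      * of_bool (\<exists>k\<in>{1..4 ^ n}. ereal (real k * \<delta>) < r \<and> w (\<Sum>i<N. x i) < (\<Sum>i<k. y i) - c * (real k * \<delta>)) :: ennreal)"
  have [measurable]: "H \<in> borel_measurable (borel \<Otimes>\<^sub>M borel)" by (simp add: borel_prod)
  let ?P = "PiM {..<N} (\<lambda>_. borel :: real measure) \<Otimes>\<^sub>M PiM {..<m} (\<lambda>_. borel :: real measure)"
  have S1: "(\<lambda>z. \<Sum>i<k. fst z i) \<in> borel_measurable ?P" if "k \<le> N" for k
    using that by (intro borel_measurable_sum measurable_compose[OF measurable_fst measurable_component_singleton]) auto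
  have S2: "(\<lambda>z. \<Sum>i<k. snd z i) \<in> borel_measurable ?P" if "k \<le> m" for k
    using that by (intro borel_measurable_sum measurable_compose[OF measurable_snd measurable_component_singleton]) auto
  define E1 where "E1 z \<longleftrightarrow> (\<exists>k\<in>{1..<N}. u < (\<Sum>i<k. fst z i))" for z :: "(nat \<Rightarrow> real) \<times> (nat \<Rightarrow> real)"
  define E2 where "E2 z \<longleftrightarrow> (\<exists>k\<in>{1..4 ^ n}. ereal (real k * \<delta>) < r \<and> w (\<Sum>i<N. fst z i) < (\<Sum>i<k. snd z i) - c * (real k * \<delta>))"
    for z :: "(nat \<Rightarrow> real) \<times> (nat \<Rightarrow> real)"
  have E1[measurable]: "Measurable.pred ?P E1"
    unfolding E1_def using S1 by (intro pred_intros_finite borel_measurable_pred_less) auto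
  note [measurable] = S1[OF order_refl]
  have qm: "q * 2 ^ n \<le> m" by (simp add: m_def)
  have km: "k \<in> {1..4 ^ n} \<Longrightarrow> k \<le> m" for k by (auto simp: m_def)
  have E2[measurable]: "Measurable.pred ?P E2"
    unfolding E2_def
  proof (rule pred_intros_finite)
    fix k :: nat assume "k \<in> {1..4 ^ n}"
    then have [measurable]: "(\<lambda>z. \<Sum>i<k. snd z i) \<in> borel_measurable ?P" by (intro S2 km)
    show "Measurable.pred ?P (\<lambda>z. ereal (real k * \<delta>) < r \<and> w (\<Sum>i<N. fst z i) < (\<Sum>i<k. snd z i) - c * (real k * \<delta>))" by measurable
  qed auto
  have F_eq: "F = (\<lambda>z. of_bool (b0 \<or> E1 z) * H (\<Sum>i<N. fst z i, \<Sum>i<q * 2 ^ n. snd z i) * of_bool (E2 z))"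
    unfolding F_def E1_def E2_def case_prod_beta ..
  have F_meas: "F \<in> borel_measurable ?P"
    unfolding F_eq using S2[OF qm] by measurable
  have past: "(\<Sum>i<k. (\<lambda>i\<in>{..<N}. incr \<delta> i \<omega>) i) = Y (real k * \<delta>) \<omega>" if "k \<le> N" for k \<omega>
    using that sum_incr0[of \<delta> \<omega> k] by simp
  have fut: "(\<Sum>i<k. (\<lambda>i\<in>{..<m}. incr \<delta> i \<omega>) i) = Y (real k * \<delta>) \<omega>" if "k \<le> m" for k \<omega>
    using that sum_incr0[of \<delta> \<omega> k] by simp
  have fut': "(\<Sum>i<k. (\<lambda>i\<in>{..<m}. incr \<delta> (N + i) \<omega>) i) = Y (a + real k * \<delta>) \<omega> - Y a \<omega>" if "k \<le> m" for k \<omega>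
  proof -
    have "(\<Sum>i<k. (\<lambda>i\<in>{..<m}. incr \<delta> (N + i) \<omega>) i) = (\<Sum>i<k. incr \<delta> (N + i) \<omega>)" using that by simp
    then show ?thesis unfolding sum_incr using \<delta> by (simp add: distrib_right)
  qed
  have ex_past: "(\<exists>k\<in>{1..<N}. u < (\<Sum>i<k. (\<lambda>i\<in>{..<N}. incr \<delta> i \<omega>) i))
     \<longleftrightarrow> (\<exists>k\<in>{1..4 ^ n}. ereal (real k * \<delta>) < ereal a \<and> u < Y (real k * \<delta>) \<omega>)" for \<omega>
  proof -
    have "k \<le> 4 ^ n" if "k < N" for k using that power_mono[of "2::nat" 4 n] by (simp add: N_def)
    then have "(\<exists>k\<in>{1..<N}. u < (\<Sum>i<k. (\<lambda>i\<in>{..<N}. incr \<delta> i \<omega>) i)) \<longleftrightarrow> (\<exists>k\<in>{1..<N}. u < Y (real k * \<delta>) \<omega>)"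
      by (intro bex_cong refl) (simp only: past[OF less_imp_le] atLeastLessThan_iff)
    also have "\<dots> \<longleftrightarrow> (\<exists>k\<in>{1..4 ^ n}. ereal (real k * \<delta>) < ereal a \<and> u < Y (real k * \<delta>) \<omega>)"
      unfolding kN using \<open>\<And>k. k < N \<Longrightarrow> k \<le> 4 ^ n\<close> by auto
    finally show ?thesis .
  qed
  have F1: "F (\<lambda>i\<in>{..<N}. incr \<delta> i \<omega>, \<lambda>i\<in>{..<m}. incr \<delta> (N + i) \<omega>)
    = of_bool (b0 \<or> (\<exists>k\<in>{1..4 ^ n}. ereal (real k * \<delta>) < ereal a \<and> u < Y (real k * \<delta>) \<omega>))
      * H (Y a \<omega>, Y (a + real q * a) \<omega> - Y a \<omega>)
      * of_bool (\<exists>k\<in>{1..4 ^ n}. ereal (real k * \<delta>) < r \<and> w (Y a \<omega>) < Y (a + real k * \<delta>) \<omega> - Y a \<omega> - c * (real k * \<delta>))" for \<omega>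
  proof -
    have "(\<exists>k\<in>{1..4 ^ n}. ereal (real k * \<delta>) < r \<and> w (Y a \<omega>) < (\<Sum>i<k. (\<lambda>i\<in>{..<m}. incr \<delta> (N + i) \<omega>) i) - c * (real k * \<delta>))
      \<longleftrightarrow> (\<exists>k\<in>{1..4 ^ n}. ereal (real k * \<delta>) < r \<and> w (Y a \<omega>) < Y (a + real k * \<delta>) \<omega> - Y a \<omega> - c * (real k * \<delta>))"
      by (intro bex_cong refl) (simp only: fut'[OF km])
    then show ?thesis
      unfolding F_def prod.case ex_past past[OF order_refl] fut'[OF qm] \<delta> q\<delta> by (simp only:)
  qed
  have F2: "F (\<lambda>i\<in>{..<N}. incr \<delta> i \<omega>, \<lambda>i\<in>{..<m}. incr \<delta> i \<omega>')
    = of_bool (b0 \<or> (\<exists>k\<in>{1..4 ^ n}. ereal (real k * \<delta>) < ereal a \<and> u < Y (real k * \<delta>) \<omega>))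
      * H (Y a \<omega>, Y (real q * a) \<omega>')
      * of_bool (\<exists>k\<in>{1..4 ^ n}. ereal (real k * \<delta>) < r \<and> w (Y a \<omega>) < Y (real k * \<delta>) \<omega>' - c * (real k * \<delta>))" for \<omega> \<omega>'
  proof -
    have "(\<exists>k\<in>{1..4 ^ n}. ereal (real k * \<delta>) < r \<and> w (Y a \<omega>) < (\<Sum>i<k. (\<lambda>i\<in>{..<m}. incr \<delta> i \<omega>') i) - c * (real k * \<delta>))
      \<longleftrightarrow> (\<exists>k\<in>{1..4 ^ n}. ereal (real k * \<delta>) < r \<and> w (Y a \<omega>) < Y (real k * \<delta>) \<omega>' - c * (real k * \<delta>))"
      by (intro bex_cong refl) (simp only: fut[OF km])
    then show ?thesis
      unfolding F_def prod.case ex_past past[OF order_refl] fut[OF qm] \<delta> q\<delta> by (simp only:)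
  qed
  show ?thesis
    using nn_integral_past_future_incr[OF less_imp_le[OF \<delta>(1)] F_meas] unfolding F1 F2 .
qed

lemma right_cont_shift:
  assumes "0 \<le> a" "0 \<le> t"
  shows "((\<lambda>t. Y (a + t) \<omega> - Y a \<omega> - c * t) \<longlongrightarrow> Y (a + t) \<omega> - Y a \<omega> - c * t) (at_right t)"
proof (intro tendsto_intros)
  have f: "filterlim (\<lambda>s. a + s) (at_right (a + t)) (at_right t)"
    unfolding filterlim_at by (auto intro!: tendsto_intros simp: eventually_at_filter)
  have "0 \<le> a + t" using assms by simp
  from filterlim_compose[OF right_cont[OF this] f]
  show "((\<lambda>s. Y (a + s) \<omega>) \<longlongrightarrow> Y (a + t) \<omega>) (at_right t)" .
qed

lemma exceeds_from_measurable[measurable (raw)]: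
  assumes "a \<ge> 0" and [measurable]: "f \<in> borel_measurable N" "w \<in> measurable N M"
  shows "Measurable.pred N (\<lambda>x. exceeds_from a c r (f x) (w x))"
proof -
  have "exceeds_from a c r v \<omega> \<longleftrightarrow> (\<exists>n k. 0 < real k * (1 / 2 ^ n) \<and> ereal (real k * (1 / 2 ^ n)) < r \<and>
    v < Y (a + real k * (1 / 2 ^ n)) \<omega> - Y a \<omega> - c * (real k * (1 / 2 ^ n)))" (is "_ \<longleftrightarrow> ?R") for v \<omega>
  proof
    assume ex: "exceeds_from a c r v \<omega>"
    obtain n where "(\<exists>k\<in>{1..4 ^ n}. ereal (real k * (1 / 2 ^ n)) < r \<and> v < Y (a + real k * (1 / 2 ^ n)) \<omega> - Y a \<omega> - c * (real k * (1 / 2 ^ n)))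
      \<longleftrightarrow> (\<exists>t>0. ereal t < r \<and> v < Y (a + t) \<omega> - Y a \<omega> - c * t)"
      using eventually_happens'[OF sequentially_bot grid_eventually_exceeds[where h=1 and r=r and v=v, OF right_cont_shift[OF assms(1)] zero_less_one]] by blast
    then obtain k where "k \<in> {1..4 ^ n}" "ereal (real k * (1 / 2 ^ n)) < r \<and> v < Y (a + real k * (1 / 2 ^ n)) \<omega> - Y a \<omega> - c * (real k * (1 / 2 ^ n))"
      using ex unfolding exceeds_from_def by blast
    then show ?R by (intro exI[of _ n] exI[of _ k]) auto
  qed (auto simp: exceeds_from_def)
  then show ?thesis by simp
qed

text \<open>For each path the grid indicators are eventually constant, so dominated convergence
  needs only the bound on \<open>H\<close>. With \<open>b0\<close> true the path is restarted at a
  small time \<open>a\<close>; with \<open>q = 0\<close> the statement is applied at time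
  \<open>T\<close> itself.\<close>

lemma markov:
  fixes H :: "real \<times> real \<Rightarrow> ennreal" and w :: "real \<Rightarrow> real"
  assumes a: "a > 0" and [measurable]: "H \<in> borel_measurable borel" "w \<in> borel_measurable borel"
    and H_le: "\<And>z. H z \<le> ennreal K"
  shows "(\<integral>\<^sup>+\<omega>. of_bool (b0 \<or> exceeds 0 (ereal a) u \<omega>) * H (Y a \<omega>, Y (a + real q * a) \<omega> - Y a \<omega>)
      * of_bool (exceeds_from a c r (w (Y a \<omega>)) \<omega>) \<partial>M)
    = (\<integral>\<^sup>+\<omega>. (\<integral>\<^sup>+\<omega>'. of_bool (b0 \<or> exceeds 0 (ereal a) u \<omega>) * H (Y a \<omega>, Y (real q * a) \<omega>')
      * of_bool (exceeds c r (w (Y a \<omega>)) \<omega>') \<partial>M) \<partial>M)"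
proof -
  have [measurable]: "H \<in> borel_measurable (borel \<Otimes>\<^sub>M borel)" by (simp add: borel_prod)
  define \<delta> where "\<delta> n = a / 2 ^ n" for n :: nat
  define E where "E n \<omega> \<longleftrightarrow> (\<exists>k\<in>{1..4 ^ n}. ereal (real k * \<delta> n) < ereal a \<and> u < Y (real k * \<delta> n) \<omega>)" for n \<omega>
  define D where "D n v \<omega> \<longleftrightarrow> (\<exists>k\<in>{1..4 ^ n}. ereal (real k * \<delta> n) < r \<and> v < Y (real k * \<delta> n) \<omega> - c * (real k * \<delta> n))" for n v \<omega>
  define D' where "D' n v \<omega> \<longleftrightarrow> (\<exists>k\<in>{1..4 ^ n}. ereal (real k * \<delta> n) < r \<and> v < Y (a + real k * \<delta> n) \<omega> - Y a \<omega> - c * (real k * \<delta> n))" for n v \<omega>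
  have [measurable]: "Measurable.pred M (E n)" for n unfolding E_def by measurable
  have [measurable]: "Measurable.pred M (\<lambda>\<omega>. D' n (w (Y a \<omega>)) \<omega>)" for n unfolding D'_def by measurable
  have [measurable]: "Measurable.pred (M \<Otimes>\<^sub>M M) (\<lambda>p. D n (w (Y a (fst p))) (snd p))" for n unfolding D_def by measurable
  have [measurable]: "Measurable.pred M (\<lambda>\<omega>. exceeds_from a c r (w (Y a \<omega>)) \<omega>)"
    using a by (intro exceeds_from_measurable) auto
  have E_ev: "eventually (\<lambda>n. E n \<omega> \<longleftrightarrow> exceeds 0 (ereal a) u \<omega>) sequentially" for \<omega>
    using grid_eventually_exceeds[where Z="\<lambda>t. Y t \<omega>" and r="ereal a" and v=u, OF right_cont a]
    by (simp add: E_def exceeds_def \<delta>_def)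
  have D_ev: "eventually (\<lambda>n. D n v \<omega> \<longleftrightarrow> exceeds c r v \<omega>) sequentially" for v \<omega>
    using grid_eventually_exceeds[where Z="\<lambda>t. Y t \<omega> - c * t" and r=r and v=v, OF right_cont_drift a]
    by (simp add: D_def exceeds_def \<delta>_def)
  have D'_ev: "eventually (\<lambda>n. D' n v \<omega> \<longleftrightarrow> exceeds_from a c r v \<omega>) sequentially" for v \<omega>
    using grid_eventually_exceeds[where Z="\<lambda>t. Y (a + t) \<omega> - Y a \<omega> - c * t" and r=r and v=v, OF right_cont_shift[OF less_imp_le[OF a]] a]
    by (simp add: D'_def exceeds_from_def \<delta>_def)
  define L where "L n \<omega> = of_bool (b0 \<or> E n \<omega>) * H (Y a \<omega>, Y (a + real q * a) \<omega> - Y a \<omega>) * of_bool (D' n (w (Y a \<omega>)) \<omega>)" for n \<omega>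
  define R where "R n p = of_bool (b0 \<or> E n (fst p)) * H (Y a (fst p), Y (real q * a) (snd p)) * of_bool (D n (w (Y a (fst p))) (snd p))" for n p
  have bound: "of_bool p * H z * of_bool p' \<le> ennreal K" for p p' z
    using H_le[of z] by (cases p; cases p') auto
  have "(\<lambda>n. \<integral>\<^sup>+\<omega>. L n \<omega> \<partial>M) \<longlonglongrightarrow> (\<integral>\<^sup>+\<omega>. of_bool (b0 \<or> exceeds 0 (ereal a) u \<omega>) * H (Y a \<omega>, Y (a + real q * a) \<omega> - Y a \<omega>)
      * of_bool (exceeds_from a c r (w (Y a \<omega>)) \<omega>) \<partial>M)"
  proof (rule nn_integral_dominated_convergence[where w="\<lambda>_. ennreal K"])
    show "AE \<omega> in M. (\<lambda>n. L n \<omega>) \<longlonglongrightarrow> of_bool (b0 \<or> exceeds 0 (ereal a) u \<omega>) * H (Y a \<omega>, Y (a + real q * a) \<omega> - Y a \<omega>)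
      * of_bool (exceeds_from a c r (w (Y a \<omega>)) \<omega>)"
    proof (intro AE_I2 tendsto_eventually)
      fix \<omega>
      show "eventually (\<lambda>n. L n \<omega> = of_bool (b0 \<or> exceeds 0 (ereal a) u \<omega>) * H (Y a \<omega>, Y (a + real q * a) \<omega> - Y a \<omega>)
        * of_bool (exceeds_from a c r (w (Y a \<omega>)) \<omega>)) sequentially"
        using E_ev[of \<omega>] D'_ev[of "w (Y a \<omega>)" \<omega>] by eventually_elim (simp only: L_def)
    qed
  qed (use bound in \<open>simp_all add: L_def emeasure_space_1\<close>)
  moreover have "(\<lambda>n. \<integral>\<^sup>+p. R n p \<partial>(M \<Otimes>\<^sub>M M)) \<longlonglongrightarrow> (\<integral>\<^sup>+p. of_bool (b0 \<or> exceeds 0 (ereal a) u (fst p)) * H (Y a (fst p), Y (real q * a) (snd p))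
      * of_bool (exceeds c r (w (Y a (fst p))) (snd p)) \<partial>(M \<Otimes>\<^sub>M M))"
  proof (rule nn_integral_dominated_convergence[where w="\<lambda>_. ennreal K"])
    show "AE p in M \<Otimes>\<^sub>M M. (\<lambda>n. R n p) \<longlonglongrightarrow> of_bool (b0 \<or> exceeds 0 (ereal a) u (fst p)) * H (Y a (fst p), Y (real q * a) (snd p))
      * of_bool (exceeds c r (w (Y a (fst p))) (snd p))"
    proof (intro AE_I2 tendsto_eventually)
      fix p
      show "eventually (\<lambda>n. R n p = of_bool (b0 \<or> exceeds 0 (ereal a) u (fst p)) * H (Y a (fst p), Y (real q * a) (snd p))
        * of_bool (exceeds c r (w (Y a (fst p))) (snd p))) sequentially"
        using E_ev[of "fst p"] D_ev[of "w (Y a (fst p))" "snd p"] by eventually_elim (simp only: R_def)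
    qed
    interpret pair_prob_space M M ..
    show "(\<integral>\<^sup>+p. ennreal K \<partial>(M \<Otimes>\<^sub>M M)) < \<infinity>"
      by (simp add: P.emeasure_space_1)
  qed (use bound in \<open>simp_all add: R_def\<close>)
  moreover have "(\<integral>\<^sup>+\<omega>. L n \<omega> \<partial>M) = (\<integral>\<^sup>+p. R n p \<partial>(M \<Otimes>\<^sub>M M))" for n
  proof -
    have "(\<integral>\<^sup>+\<omega>. L n \<omega> \<partial>M) = (\<integral>\<^sup>+\<omega>. (\<integral>\<^sup>+\<omega>'. R n (\<omega>, \<omega>') \<partial>M) \<partial>M)"
      unfolding L_def R_def E_def D_def D'_def \<delta>_def fst_conv snd_conv by (rule markov_grid[OF a]) simp_all
    also have "\<dots> = (\<integral>\<^sup>+p. R n p \<partial>(M \<Otimes>\<^sub>M M))"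
      unfolding R_def by (rule nn_integral_fst) measurable
    finally show ?thesis .
  qed
  ultimately have "(\<integral>\<^sup>+\<omega>. of_bool (b0 \<or> exceeds 0 (ereal a) u \<omega>) * H (Y a \<omega>, Y (a + real q * a) \<omega> - Y a \<omega>)
      * of_bool (exceeds_from a c r (w (Y a \<omega>)) \<omega>) \<partial>M)
    = (\<integral>\<^sup>+p. of_bool (b0 \<or> exceeds 0 (ereal a) u (fst p)) * H (Y a (fst p), Y (real q * a) (snd p))
      * of_bool (exceeds c r (w (Y a (fst p))) (snd p)) \<partial>(M \<Otimes>\<^sub>M M))"
    using LIMSEQ_unique by simp
  also have "\<dots> = (\<integral>\<^sup>+\<omega>. (\<integral>\<^sup>+\<omega>'. of_bool (b0 \<or> exceeds 0 (ereal a) u \<omega>) * H (Y a \<omega>, Y (real q * a) \<omega>')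
      * of_bool (exceeds c r (w (Y a \<omega>)) \<omega>') \<partial>M) \<partial>M)"
    by (subst nn_integral_fst[symmetric]) simp_all
  finally show ?thesis .
qed

end

section \<open>Densities\<close>

locale spos_levy_density = spos_levy +
  fixes p :: "real \<Rightarrow> real \<Rightarrow> ennreal"
  assumes dens: "\<And>t. t > 0 \<Longrightarrow> distributed M lborel (Y t) (\<lambda>x. p x t)"
    and chapman_kolmogorov: "\<And>s t x. s > 0 \<Longrightarrow> t > 0 \<Longrightarrow> p x (s + t) = (\<integral>\<^sup>+y. p (x - y) s * p y t \<partial>lborel)"
    and p_nonpos: "\<And>t x. t \<le> 0 \<Longrightarrow> p x t = 0"
begin

lemma p_space_measurable: "(\<lambda>x. p x t) \<in> borel_measurable borel"
  using distributed_borel_measurable[OF dens, of t] by (cases "t > 0") (auto simp: p_nonpos)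

lemma nn_integral_Y:
  assumes "t > 0" "h \<in> borel_measurable borel"
  shows "(\<integral>\<^sup>+\<omega>. h (Y t \<omega>) \<partial>M) = (\<integral>\<^sup>+x. p x t * h x \<partial>lborel)"
  using distributed_nn_integral[OF dens, of t h] assms by simp

text \<open>Chapman-Kolmogorov at every point expresses \<open>p x t\<close> as the mean of
  \<open>p (x - Y (t - e)) e\<close> for any \<open>e\<close> between \<open>0\<close> and
  \<open>t\<close>. For fixed \<open>e\<close> this uses measurability in the space variable only,
  and the dependence on \<open>t\<close> is carried by the paths. Along \<open>e = 1 / 2 ^ n\<close>
  the approximation is eventually exact.\<close>

lemma measurable_p[measurable (raw)]:
  assumes [measurable]: "h \<in> borel_measurable N" "\<tau> \<in> borel_measurable N"
  shows "(\<lambda>z. p (h z) (\<tau> z)) \<in> borel_measurable N"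
proof (rule borel_measurable_LIMSEQ_order)
  fix n :: nat
  define e where "e = 1 / (2 :: real) ^ n"
  note [measurable] = p_space_measurable[of e]
  show "(\<lambda>z. (\<integral>\<^sup>+\<omega>. p (h z - Y (\<tau> z - 1 / 2 ^ n) \<omega>) (1 / 2 ^ n) \<partial>M) * of_bool (1 / 2 ^ n < \<tau> z)) \<in> borel_measurable N"
    unfolding e_def[symmetric] by measurable
next
  fix z
  show "(\<lambda>n. (\<integral>\<^sup>+\<omega>. p (h z - Y (\<tau> z - 1 / 2 ^ n) \<omega>) (1 / 2 ^ n) \<partial>M) * of_bool (1 / 2 ^ n < \<tau> z)) \<longlonglongrightarrow> p (h z) (\<tau> z)"
  proof (cases "\<tau> z > 0")
    case True
    have "eventually (\<lambda>n. 1 / 2 ^ n < \<tau> z) sequentially"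
      by (rule order_tendstoD(2)[OF dyadic_tendsto_0 True])
    then have "eventually (\<lambda>n. (\<integral>\<^sup>+\<omega>. p (h z - Y (\<tau> z - 1 / 2 ^ n) \<omega>) (1 / 2 ^ n) \<partial>M) * of_bool (1 / 2 ^ n < \<tau> z) = p (h z) (\<tau> z)) sequentially"
    proof eventually_elim
      case (elim n)
      define e where "e = 1 / (2 :: real) ^ n"
      note [measurable] = p_space_measurable[of e]
      have e: "e > 0" "\<tau> z - e > 0" using elim by (auto simp: e_def)
      have "(\<integral>\<^sup>+\<omega>. p (h z - Y (\<tau> z - e) \<omega>) e \<partial>M) = (\<integral>\<^sup>+y. p y (\<tau> z - e) * p (h z - y) e \<partial>lborel)"
        using e by (subst nn_integral_Y[where h="\<lambda>y. p (h z - y) e"]) auto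
      also have "\<dots> = p (h z) (\<tau> z)"
        using chapman_kolmogorov[OF e, of "h z"] by (simp add: mult.commute)
      finally show ?case using elim by (simp add: e_def)
    qed
    then show ?thesis by (rule tendsto_eventually)
  next
    case False
    then have "\<not> 1 / 2 ^ n < \<tau> z" for n by (smt (verit) zero_less_divide_1_iff zero_less_power)
    then show ?thesis using False by (simp add: p_nonpos)
  qed
qed

section \<open>The law of the end point: from almost every level to every level\<close>

definition exit_fun :: "real \<Rightarrow> (real \<Rightarrow> ennreal) \<Rightarrow> real \<Rightarrow> ennreal" where
  "exit_fun T g v = (\<integral>\<^sup>+\<omega>. g (v - Y T \<omega>) * of_bool (exceeds 0 (ereal T) v \<omega>) \<partial>M)"

definition exit_int :: "real \<Rightarrow> (real \<Rightarrow> ennreal) \<Rightarrow> real \<Rightarrow> ennreal" where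
  "exit_int T g v = (\<integral>\<^sup>+s\<in>{0<..<T}. p v s * ballot_weight g (T - s) \<partial>lborel)"

lemma exit_fun_measurable[measurable]:
  assumes [measurable]: "g \<in> borel_measurable borel"
  shows "exit_fun T g \<in> borel_measurable borel"
  unfolding exit_fun_def[abs_def] by measurable

lemma exit_int_measurable[measurable]:
  assumes [measurable]: "g \<in> borel_measurable borel"
  shows "exit_int T g \<in> borel_measurable borel"
  unfolding exit_int_def[abs_def] by measurable

definition test_fun :: "(real \<Rightarrow> real) \<Rightarrow> bool" where
  "test_fun g \<longleftrightarrow> continuous_on UNIV g \<and> (\<forall>z. 0 \<le> g z \<and> g z \<le> 1) \<and> (\<exists>G\<ge>0. \<forall>z. z \<le> 0 \<or> G \<le> z \<longrightarrow> g z = 0)"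

lemma test_fun_measurable: "test_fun g \<Longrightarrow> g \<in> borel_measurable borel"
  by (auto simp: test_fun_def intro: borel_measurable_continuous_onI)

text \<open>The density of \<open>Y s\<close> turns the mean of \<open>\<phi> (Y s)\<close> into an
  integral over the level, so that both sides are tested against the same function of the
  level.\<close>

lemma nn_integral_exit_fun_eq_exit_int:
  assumes T: "T > 0" and g: "test_fun g" and \<phi>: "continuous_on UNIV \<phi>" "\<And>v. 0 \<le> \<phi> v" "\<And>v. \<phi> v \<le> 1"
  shows "(\<integral>\<^sup>+v. ennreal (\<phi> v) * exit_fun T (\<lambda>z. ennreal (g z)) v \<partial>lborel) = (\<integral>\<^sup>+v. ennreal (\<phi> v) * exit_int T (\<lambda>z. ennreal (g z)) v \<partial>lborel)"
proof -
  note [measurable] = test_fun_measurable[OF g]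
  have [measurable]: "\<phi> \<in> borel_measurable borel" using \<phi>(1) by (rule borel_measurable_continuous_onI)
  obtain G where G: "G \<ge> 0" "\<And>z. z \<le> 0 \<Longrightarrow> g z = 0" "\<And>z. z \<ge> G \<Longrightarrow> g z = 0"
    using g by (auto simp: test_fun_def)
  have "(\<integral>\<^sup>+v. ennreal (\<phi> v) * exit_fun T (\<lambda>z. ennreal (g z)) v \<partial>lborel)
    = (\<integral>\<^sup>+s\<in>{0<..<T}. (\<integral>\<^sup>+\<omega>. ennreal (\<phi> (Y s \<omega>)) \<partial>M) * ballot_weight (\<lambda>z. ennreal (g z)) (T - s) \<partial>lborel)"
    unfolding exit_fun_def using g
    by (intro last_exit_identity[where C=1 and G=G] T \<phi> G) (auto simp: test_fun_def)
  also have "\<dots> = (\<integral>\<^sup>+s. (\<integral>\<^sup>+v. ennreal (\<phi> v) * (p v s * ballot_weight (\<lambda>z. ennreal (g z)) (T - s) * indicator {0<..<T} s) \<partial>lborel) \<partial>lborel)"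
  proof (rule nn_integral_cong)
    fix s
    show "(\<integral>\<^sup>+\<omega>. ennreal (\<phi> (Y s \<omega>)) \<partial>M) * ballot_weight (\<lambda>z. ennreal (g z)) (T - s) * indicator {0<..<T} s
      = (\<integral>\<^sup>+v. ennreal (\<phi> v) * (p v s * ballot_weight (\<lambda>z. ennreal (g z)) (T - s) * indicator {0<..<T} s) \<partial>lborel)"
    proof (cases "s \<in> {0<..<T}")
      case True
      then have "(\<integral>\<^sup>+\<omega>. ennreal (\<phi> (Y s \<omega>)) \<partial>M) * ballot_weight (\<lambda>z. ennreal (g z)) (T - s)
        = (\<integral>\<^sup>+v. p v s * ennreal (\<phi> v) * ballot_weight (\<lambda>z. ennreal (g z)) (T - s) \<partial>lborel)"
        by (subst nn_integral_Y[where h="\<lambda>x. ennreal (\<phi> x)"]) (auto simp: nn_integral_multc)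
      then show ?thesis using True by (simp add: ac_simps)
    qed simp
  qed
  also have "\<dots> = (\<integral>\<^sup>+v. (\<integral>\<^sup>+s. ennreal (\<phi> v) * (p v s * ballot_weight (\<lambda>z. ennreal (g z)) (T - s) * indicator {0<..<T} s) \<partial>lborel) \<partial>lborel)"
    by (rule lborel_pair.Fubini') measurable
  also have "\<dots> = (\<integral>\<^sup>+v. ennreal (\<phi> v) * exit_int T (\<lambda>z. ennreal (g z)) v \<partial>lborel)"
    unfolding exit_int_def by (intro nn_integral_cong nn_integral_cmult) measurable
  finally show ?thesis .
qed

text \<open>Half-lines determine the measures, and their indicators are increasing limits of
  continuous weights. In the form of equal measures the result can be integrated against any
  measurable function of the level, such as a density.\<close>

lemma density_exit_fun_eq_exit_int:
  assumes T: "T > 0" and g: "test_fun g"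
  shows "density lborel (exit_fun T (\<lambda>z. ennreal (g z))) = density lborel (exit_int T (\<lambda>z. ennreal (g z)))"
    (is "density lborel ?exit_fun = density lborel ?exit_int")
proof (rule measure_eqI_lessThan)
  note [measurable] = test_fun_measurable[OF g]
  obtain G where G: "G \<ge> 0" "\<And>z. z \<le> 0 \<Longrightarrow> g z = 0" "\<And>z. z \<ge> G \<Longrightarrow> g z = 0"
    using g by (auto simp: test_fun_def)
  \<comment> \<open>For each path the levels that count lie in the window
    \<open>{Y T \<omega>..Y T \<omega> + G}\<close>, so after exchanging the integrals the total
    mass is at most \<open>G\<close>. Comparing measures on half-lines requires this
    finiteness.\<close>
  have exit_fun_fin: "(\<integral>\<^sup>+v. ?exit_fun v \<partial>lborel) < \<infinity>"
  proof -
    interpret P: pair_sigma_finite M lborel ..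
    have "(\<integral>\<^sup>+v. ?exit_fun v \<partial>lborel) \<le> (\<integral>\<^sup>+v. (\<integral>\<^sup>+\<omega>. of_bool (0 \<le> v - Y T \<omega> \<and> v - Y T \<omega> \<le> G) \<partial>M) \<partial>lborel)"
      unfolding exit_fun_def
    proof (intro nn_integral_mono)
      fix v \<omega>
      show "ennreal (g (v - Y T \<omega>)) * of_bool (exceeds 0 (ereal T) v \<omega>) \<le> of_bool (0 \<le> v - Y T \<omega> \<and> v - Y T \<omega> \<le> G)"
      proof (cases "0 \<le> v - Y T \<omega> \<and> v - Y T \<omega> \<le> G")
        case True
        have "g (v - Y T \<omega>) \<le> 1" using g by (simp add: test_fun_def)
        then show ?thesis using True by (simp add: ennreal_le_1)
      next
        case False
        then have "g (v - Y T \<omega>) = 0" using G by (meson linear)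
        then show ?thesis by simp
      qed
    qed
    also have "\<dots> = (\<integral>\<^sup>+\<omega>. (\<integral>\<^sup>+v. of_bool (0 \<le> v - Y T \<omega> \<and> v - Y T \<omega> \<le> G) \<partial>lborel) \<partial>M)"
      by (rule P.Fubini') measurable
    also have "\<dots> = (\<integral>\<^sup>+\<omega>. ennreal G \<partial>M)"
    proof (rule nn_integral_cong)
      fix \<omega>
      have "(\<integral>\<^sup>+v. of_bool (0 \<le> v - Y T \<omega> \<and> v - Y T \<omega> \<le> G) \<partial>lborel) = (\<integral>\<^sup>+v. indicator {Y T \<omega>..Y T \<omega> + G} v \<partial>lborel)"
        by (intro nn_integral_cong) (auto simp: indicator_def algebra_simps)
      then show "(\<integral>\<^sup>+v. of_bool (0 \<le> v - Y T \<omega> \<and> v - Y T \<omega> \<le> G) \<partial>lborel) = ennreal G" using G by simp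
    qed
    also have "\<dots> < \<infinity>" by (simp add: emeasure_space_1)
    finally show ?thesis .
  qed
  fix x :: real
  have "emeasure (density lborel ?exit_fun) {x<..} \<le> (\<integral>\<^sup>+v. ?exit_fun v \<partial>lborel)"
    by (subst emeasure_density) (auto intro!: nn_integral_mono simp: indicator_def)
  then show "emeasure (density lborel ?exit_fun) {x<..} < \<infinity>" using exit_fun_fin by (rule le_less_trans)
  \<comment> \<open>A ramp of slope \<open>n\<close> that starts at \<open>x\<close> and is capped
    at \<open>1\<close>; it increases to the indicator of \<open>{x<..}\<close>.\<close>
  define \<phi> where "\<phi> n v = min 1 (real n * max 0 (v - x))" for n v
  have \<phi>_cont: "continuous_on UNIV (\<phi> n)" for n unfolding \<phi>_def by (intro continuous_intros)
  have [measurable]: "\<phi> n \<in> borel_measurable borel" for n by (rule borel_measurable_continuous_onI[OF \<phi>_cont])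
  have \<phi>_inc: "incseq (\<lambda>n v. ennreal (\<phi> n v) * q v)" for q :: "real \<Rightarrow> ennreal"
    unfolding incseq_def le_fun_def \<phi>_def
    by (intro allI impI mult_right_mono ennreal_leI min.mono) (auto intro!: mult_right_mono)
  have \<phi>_lim: "(\<lambda>n. ennreal (\<phi> n v) * q v) \<longlonglongrightarrow> q v * indicator {x<..} v" for q :: "real \<Rightarrow> ennreal" and v
  proof (cases "x < v")
    case True
    obtain n0 :: nat where n0: "1 / (v - x) < real n0" using reals_Archimedean2 by blast
    have "eventually (\<lambda>n. ennreal (\<phi> n v) * q v = q v * indicator {x<..} v) sequentially"
      unfolding eventually_sequentially
    proof (intro exI[of _ n0] allI impI)
      fix n assume "n0 \<le> n"
      then have "1 / (v - x) \<le> real n" using n0 by simp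
      then have "1 \<le> real n * (v - x)" using True by (simp add: field_simps)
      then show "ennreal (\<phi> n v) * q v = q v * indicator {x<..} v" using True by (simp add: \<phi>_def)
    qed
    then show ?thesis by (rule tendsto_eventually)
  qed (simp add: \<phi>_def)
  have lim: "(\<lambda>n. \<integral>\<^sup>+v. ennreal (\<phi> n v) * q v \<partial>lborel) \<longlonglongrightarrow> (\<integral>\<^sup>+v. q v * indicator {x<..} v \<partial>lborel)"
    if [measurable]: "q \<in> borel_measurable borel" for q
    by (rule nn_integral_LIMSEQ[OF \<phi>_inc _ \<phi>_lim]) measurable
  have "(\<integral>\<^sup>+v. ?exit_fun v * indicator {x<..} v \<partial>lborel) = (\<integral>\<^sup>+v. ?exit_int v * indicator {x<..} v \<partial>lborel)"
  proof (rule LIMSEQ_unique)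
    show "(\<lambda>n. \<integral>\<^sup>+v. ennreal (\<phi> n v) * ?exit_fun v \<partial>lborel) \<longlonglongrightarrow> (\<integral>\<^sup>+v. ?exit_fun v * indicator {x<..} v \<partial>lborel)"
      by (rule lim) measurable
    have "(\<integral>\<^sup>+v. ennreal (\<phi> n v) * ?exit_fun v \<partial>lborel) = (\<integral>\<^sup>+v. ennreal (\<phi> n v) * ?exit_int v \<partial>lborel)" for n
      by (rule nn_integral_exit_fun_eq_exit_int[OF T g \<phi>_cont]) (auto simp: \<phi>_def)
    moreover have "(\<lambda>n. \<integral>\<^sup>+v. ennreal (\<phi> n v) * ?exit_int v \<partial>lborel) \<longlonglongrightarrow> (\<integral>\<^sup>+v. ?exit_int v * indicator {x<..} v \<partial>lborel)"
      by (rule lim) measurable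
    ultimately show "(\<lambda>n. \<integral>\<^sup>+v. ennreal (\<phi> n v) * ?exit_fun v \<partial>lborel) \<longlonglongrightarrow> (\<integral>\<^sup>+v. ?exit_int v * indicator {x<..} v \<partial>lborel)"
      by simp
  qed
  then show "emeasure (density lborel ?exit_fun) {x<..} = emeasure (density lborel ?exit_int) {x<..}"
    by (simp add: emeasure_density)
qed simp_all

lemma nn_integral_exit_fun_exit_int:
  assumes T: "T > 0" and g: "test_fun g" and [measurable]: "h \<in> borel_measurable borel"
  shows "(\<integral>\<^sup>+v. exit_fun T (\<lambda>z. ennreal (g z)) v * h v \<partial>lborel) = (\<integral>\<^sup>+v. exit_int T (\<lambda>z. ennreal (g z)) v * h v \<partial>lborel)"
proof -
  note [measurable] = test_fun_measurable[OF g]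
  have "(\<integral>\<^sup>+v. exit_fun T (\<lambda>z. ennreal (g z)) v * h v \<partial>lborel) = (\<integral>\<^sup>+v. h v \<partial>density lborel (exit_fun T (\<lambda>z. ennreal (g z))))"
    by (subst nn_integral_density) auto
  also have "\<dots> = (\<integral>\<^sup>+v. exit_int T (\<lambda>z. ennreal (g z)) v * h v \<partial>lborel)"
    unfolding density_exit_fun_eq_exit_int[OF T g] by (subst nn_integral_density) auto
  finally show ?thesis .
qed

text \<open>
  Conditioning on \<open>Y a\<close> integrates the level against \<open>p _ a\<close>, so the identity for almost every level
  suffices, and Chapman-Kolmogorov removes the integral again.
\<close>

lemma nn_integral_exceeds_after:
  assumes a: "a > 0" and q: "q > 0" and g: "test_fun g"
  defines "T \<equiv> a + real q * a"
  shows "(\<integral>\<^sup>+\<omega>. ennreal (g (u - Y T \<omega>)) * of_bool (exceeds_from a 0 (ereal (real q * a)) (u - Y a \<omega>) \<omega>) \<partial>M)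
    = (\<integral>\<^sup>+s\<in>{a<..<T}. p u s * ballot_weight (\<lambda>z. ennreal (g z)) (T - s) \<partial>lborel)"
proof -
  note [measurable] = test_fun_measurable[OF g]
  define b where "b = real q * a"
  have b: "b > 0" "T = a + b" using a q by (auto simp: b_def T_def)
  have g1: "g z \<le> 1" for z using g by (simp add: test_fun_def)
  \<comment> \<open>Here \<open>b0\<close> is true, so the condition on the path before
    \<open>a\<close> disappears and its level \<open>0\<close> is a dummy.\<close>
  have "(\<integral>\<^sup>+\<omega>. ennreal (g (u - Y T \<omega>)) * of_bool (exceeds_from a 0 (ereal b) (u - Y a \<omega>) \<omega>) \<partial>M)
    = (\<integral>\<^sup>+\<omega>. of_bool (True \<or> exceeds 0 (ereal a) 0 \<omega>) * (\<lambda>(x, y). ennreal (g (u - x - y))) (Y a \<omega>, Y (a + real q * a) \<omega> - Y a \<omega>)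
      * of_bool (exceeds_from a 0 (ereal b) (u - Y a \<omega>) \<omega>) \<partial>M)"
    unfolding T_def by simp
  also have "\<dots> = (\<integral>\<^sup>+\<omega>. (\<integral>\<^sup>+\<omega>'. of_bool (True \<or> exceeds 0 (ereal a) 0 \<omega>) * (\<lambda>(x, y). ennreal (g (u - x - y))) (Y a \<omega>, Y (real q * a) \<omega>')
      * of_bool (exceeds 0 (ereal b) (u - Y a \<omega>) \<omega>') \<partial>M) \<partial>M)"
    using a g1 by (intro markov[where K=1]) (auto simp: borel_prod[symmetric] ennreal_le_1)
  also have "\<dots> = (\<integral>\<^sup>+\<omega>. exit_fun b (\<lambda>z. ennreal (g z)) (u - Y a \<omega>) \<partial>M)"
    unfolding exit_fun_def b_def by simp
  also have "\<dots> = (\<integral>\<^sup>+x. p x a * exit_fun b (\<lambda>z. ennreal (g z)) (u - x) \<partial>lborel)"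
    using a by (intro nn_integral_Y) auto
  also have "\<dots> = (\<integral>\<^sup>+v. p (u - v) a * exit_fun b (\<lambda>z. ennreal (g z)) v \<partial>lborel)"
    by (subst nn_integral_real_affine[where c="-1" and t=u]) auto
  also have "\<dots> = (\<integral>\<^sup>+v. exit_fun b (\<lambda>z. ennreal (g z)) v * p (u - v) a \<partial>lborel)"
    by (simp add: mult.commute)
  also have "\<dots> = (\<integral>\<^sup>+v. exit_int b (\<lambda>z. ennreal (g z)) v * p (u - v) a \<partial>lborel)"
    using b g by (intro nn_integral_exit_fun_exit_int) auto
  also have "\<dots> = (\<integral>\<^sup>+v. (\<integral>\<^sup>+s. p v s * ballot_weight (\<lambda>z. ennreal (g z)) (b - s) * indicator {0<..<b} s * p (u - v) a \<partial>lborel) \<partial>lborel)"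
    unfolding exit_int_def by (intro nn_integral_cong nn_integral_multc[symmetric]) measurable
  also have "\<dots> = (\<integral>\<^sup>+s. (\<integral>\<^sup>+v. p v s * ballot_weight (\<lambda>z. ennreal (g z)) (b - s) * indicator {0<..<b} s * p (u - v) a \<partial>lborel) \<partial>lborel)"
    by (rule lborel_pair.Fubini') measurable
  also have "\<dots> = (\<integral>\<^sup>+s. p u (a + s) * ballot_weight (\<lambda>z. ennreal (g z)) (b - s) * indicator {0<..<b} s \<partial>lborel)"
  proof (rule nn_integral_cong)
    fix s
    show "(\<integral>\<^sup>+v. p v s * ballot_weight (\<lambda>z. ennreal (g z)) (b - s) * indicator {0<..<b} s * p (u - v) a \<partial>lborel)
      = p u (a + s) * ballot_weight (\<lambda>z. ennreal (g z)) (b - s) * indicator {0<..<b} s"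
    proof (cases "s \<in> {0<..<b}")
      case True
      have "(\<integral>\<^sup>+v. p v s * ballot_weight (\<lambda>z. ennreal (g z)) (b - s) * p (u - v) a \<partial>lborel)
        = (\<integral>\<^sup>+v. p (u - v) a * p v s * ballot_weight (\<lambda>z. ennreal (g z)) (b - s) \<partial>lborel)"
        by (simp add: ac_simps)
      also have "\<dots> = (\<integral>\<^sup>+v. p (u - v) a * p v s \<partial>lborel) * ballot_weight (\<lambda>z. ennreal (g z)) (b - s)"
        by (rule nn_integral_multc) measurable
      also have "(\<integral>\<^sup>+v. p (u - v) a * p v s \<partial>lborel) = p u (a + s)"
        using True a by (intro chapman_kolmogorov[symmetric]) auto
      finally show ?thesis using True by simp
    qed simp
  qed
  also have "\<dots> = (\<integral>\<^sup>+s\<in>{a<..<T}. p u s * ballot_weight (\<lambda>z. ennreal (g z)) (T - s) \<partial>lborel)"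
    by (subst (2) nn_integral_real_affine[where c=1 and t=a])
      (auto simp: b algebra_simps indicator_def intro!: nn_integral_cong)
  finally show ?thesis unfolding b_def .
qed

text \<open>A restart at \<open>a i\<close> sees exactly the exceedances between \<open>a i\<close>
  and \<open>T\<close>, and these exhaust all of them as \<open>a i\<close> decreases to
  \<open>0\<close>. No continuity in the level is required, since for each \<open>i\<close> the
  identity already holds at the given level.\<close>

lemma exit_fun_eq_exit_int:
  assumes T: "T > 0" and g: "test_fun g"
  shows "exit_fun T (\<lambda>z. ennreal (g z)) u = exit_int T (\<lambda>z. ennreal (g z)) u"
proof -
  note [measurable] = test_fun_measurable[OF g]
  have g1: "g z \<le> 1" for z using g by (simp add: test_fun_def)
  define a where "a i = T / 2 ^ Suc i" for i
  \<comment> \<open>Chosen so that \<open>a i + q i * a i = T\<close>: the time left after the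
    restart has to be an integral multiple of the restart time.\<close>
  define q :: "nat \<Rightarrow> nat" where "q i = 2 ^ Suc i - 1" for i
  have q: "q i > 0" for i using one_less_power[of "2 :: nat" "Suc i"] by (simp add: q_def)
  have a: "a i > 0" for i using T by (simp add: a_def)
  have aq: "a i + real (q i) * a i = T" for i by (simp add: a_def q_def of_nat_diff field_simps)
  have a_lim: "a \<longlonglongrightarrow> 0"
    using dyadic_tendsto_0[of "T / 2"] by (simp add: a_def[abs_def])
  have a_mono: "a j \<le> a i" if "i \<le> j" for i j
    using that T by (simp add: a_def frac_le power_increasing)
  define E where "E i \<omega> \<longleftrightarrow> exceeds_from (a i) 0 (ereal (real (q i) * a i)) (u - Y (a i) \<omega>) \<omega>" for i \<omega>
  have E_iff: "E i \<omega> \<longleftrightarrow> (\<exists>t. a i < t \<and> t < T \<and> u < Y t \<omega>)" for i \<omega>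
  proof
    assume "E i \<omega>"
    then obtain t where "0 < t" "t < real (q i) * a i" "u < Y (a i + t) \<omega>"
      by (auto simp: E_def exceeds_from_def)
    then show "\<exists>t. a i < t \<and> t < T \<and> u < Y t \<omega>" using aq[of i] by (intro exI[of _ "a i + t"]) auto
  next
    assume "\<exists>t. a i < t \<and> t < T \<and> u < Y t \<omega>"
    then obtain t where "a i < t" "t < T" "u < Y t \<omega>" by blast
    then show "E i \<omega>" unfolding E_def exceeds_from_def using aq[of i] by (intro exI[of _ "t - a i"]) auto
  qed
  have [measurable]: "Measurable.pred M (E i)" for i
    unfolding E_def using a[of i] by (intro exceeds_from_measurable) auto
  have "(\<lambda>i. \<integral>\<^sup>+\<omega>. ennreal (g (u - Y T \<omega>)) * of_bool (E i \<omega>) \<partial>M) \<longlonglongrightarrow> exit_fun T (\<lambda>z. ennreal (g z)) u"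
    unfolding exit_fun_def
  proof (rule nn_integral_dominated_convergence[where w="\<lambda>_. 1"])
    show "AE \<omega> in M. (\<lambda>i. ennreal (g (u - Y T \<omega>)) * of_bool (E i \<omega>)) \<longlonglongrightarrow> ennreal (g (u - Y T \<omega>)) * of_bool (exceeds 0 (ereal T) u \<omega>)"
    proof (intro AE_I2 tendsto_eventually)
      fix \<omega>
      have "eventually (\<lambda>i. E i \<omega> \<longleftrightarrow> exceeds 0 (ereal T) u \<omega>) sequentially"
      proof (cases "exceeds 0 (ereal T) u \<omega>")
        case True
        then obtain t where t: "0 < t" "t < T" "u < Y t \<omega>" by (auto simp: exceeds_def)
        show ?thesis using order_tendstoD(2)[OF a_lim t(1)]
          by eventually_elim (use t True in \<open>auto simp: E_iff\<close>)
      next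
        case False
        then have "E i \<omega> \<longleftrightarrow> exceeds 0 (ereal T) u \<omega>" for i
          using a[of i] unfolding E_iff exceeds_def by (auto intro: less_trans)
        then show ?thesis by (intro always_eventually allI)
      qed
      then show "eventually (\<lambda>i. ennreal (g (u - Y T \<omega>)) * of_bool (E i \<omega>) = ennreal (g (u - Y T \<omega>)) * of_bool (exceeds 0 (ereal T) u \<omega>)) sequentially"
        by eventually_elim simp
    qed
  qed (use g1 in \<open>auto simp: emeasure_space_1 ennreal_le_1 of_bool_def\<close>)
  moreover have "(\<lambda>i. \<integral>\<^sup>+s\<in>{a i<..<T}. p u s * ballot_weight (\<lambda>z. ennreal (g z)) (T - s) \<partial>lborel) \<longlonglongrightarrow> exit_int T (\<lambda>z. ennreal (g z)) u"
    unfolding exit_int_def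
  proof (rule nn_integral_LIMSEQ)
    show "incseq (\<lambda>i s. p u s * ballot_weight (\<lambda>z. ennreal (g z)) (T - s) * indicator {a i<..<T} s)"
      unfolding incseq_def le_fun_def
      by (intro allI impI mult_left_mono indicator_leI) (auto dest: a_mono intro: le_less_trans)
    fix s
    show "(\<lambda>i. p u s * ballot_weight (\<lambda>z. ennreal (g z)) (T - s) * indicator {a i<..<T} s) \<longlonglongrightarrow> p u s * ballot_weight (\<lambda>z. ennreal (g z)) (T - s) * indicator {0<..<T} s"
    proof (cases "0 < s")
      case True
      show ?thesis
        by (rule tendsto_eventually, use order_tendstoD(2)[OF a_lim True] in eventually_elim)
          (use True in \<open>auto simp: indicator_def\<close>)
    next
      case False
      then have "s \<notin> {a i<..<T}" for i using a[of i] by auto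
      then show ?thesis using False by simp
    qed
  qed measurable
  moreover have "(\<integral>\<^sup>+\<omega>. ennreal (g (u - Y T \<omega>)) * of_bool (E i \<omega>) \<partial>M)
    = (\<integral>\<^sup>+s\<in>{a i<..<T}. p u s * ballot_weight (\<lambda>z. ennreal (g z)) (T - s) \<partial>lborel)" for i
    using nn_integral_exceeds_after[OF a[of i] q[of i] g, of u] unfolding aq E_def .
  ultimately show ?thesis using LIMSEQ_unique by simp
qed

text \<open>By \<open>exit_law\<close>, the density of the distance \<open>u - Y T\<close> on the
  event that the path exceeded \<open>u\<close> and ended below it. The factor
  \<open>ennreal z\<close> vanishes for \<open>z \<le> 0\<close>, so integrals over the whole line
  see only positive distances.\<close>

definition exit_density :: "real \<Rightarrow> real \<Rightarrow> real \<Rightarrow> ennreal" where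
  "exit_density T u z = ennreal z * (\<integral>\<^sup>+s\<in>{0<..<T}. p u s / ennreal (T - s) * p (- z) (T - s) \<partial>lborel)"

lemma exit_density_measurable[measurable]: "exit_density T u \<in> borel_measurable borel"
  unfolding exit_density_def[abs_def] by measurable

text \<open>Writing the ballot weight with the density of \<open>Y (T - s)\<close> and substituting
  \<open>z = - y\<close> makes the distance below the level the outer variable.\<close>

lemma exit_int_eq_exit_density:
  assumes [measurable]: "g \<in> borel_measurable borel"
  shows "exit_int T g u = (\<integral>\<^sup>+z. g z * exit_density T u z \<partial>lborel)"
proof -
  have "exit_int T g u = (\<integral>\<^sup>+s. (\<integral>\<^sup>+z. g z * ennreal z * (p u s / ennreal (T - s) * p (- z) (T - s) * indicator {0<..<T} s) \<partial>lborel) \<partial>lborel)"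
    unfolding exit_int_def
  proof (rule nn_integral_cong)
    fix s
    show "p u s * ballot_weight g (T - s) * indicator {0<..<T} s
      = (\<integral>\<^sup>+z. g z * ennreal z * (p u s / ennreal (T - s) * p (- z) (T - s) * indicator {0<..<T} s) \<partial>lborel)"
    proof (cases "s \<in> {0<..<T}")
      case True
      then have "ballot_weight g (T - s) = (\<integral>\<^sup>+y. p y (T - s) * (g (- y) * ennreal (- y)) \<partial>lborel) / ennreal (T - s)"
        unfolding ballot_weight_def by (subst nn_integral_Y[where h="\<lambda>y. g (- y) * ennreal (- y)"]) auto
      also have "(\<integral>\<^sup>+y. p y (T - s) * (g (- y) * ennreal (- y)) \<partial>lborel) = (\<integral>\<^sup>+z. p (- z) (T - s) * (g z * ennreal z) \<partial>lborel)"
        by (subst nn_integral_real_affine[where c="-1" and t=0]) auto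
      finally have "p u s * ballot_weight g (T - s) = p u s / ennreal (T - s) * (\<integral>\<^sup>+z. p (- z) (T - s) * (g z * ennreal z) \<partial>lborel)"
        by (simp add: divide_ennreal_def ac_simps)
      also have "\<dots> = (\<integral>\<^sup>+z. p u s / ennreal (T - s) * (p (- z) (T - s) * (g z * ennreal z)) \<partial>lborel)"
        by (rule nn_integral_cmult[symmetric]) measurable
      finally have "p u s * ballot_weight g (T - s) = (\<integral>\<^sup>+z. p u s / ennreal (T - s) * (p (- z) (T - s) * (g z * ennreal z)) \<partial>lborel)" .
      then show ?thesis using True by (simp add: ac_simps)
    qed simp
  qed
  also have "\<dots> = (\<integral>\<^sup>+z. (\<integral>\<^sup>+s. g z * ennreal z * (p u s / ennreal (T - s) * p (- z) (T - s) * indicator {0<..<T} s) \<partial>lborel) \<partial>lborel)"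
    by (rule lborel_pair.Fubini') measurable
  also have "\<dots> = (\<integral>\<^sup>+z. g z * exit_density T u z \<partial>lborel)"
    unfolding exit_density_def mult.assoc[symmetric, of "g _" "ennreal _"]
    by (intro nn_integral_cong nn_integral_cmult) measurable
  finally show ?thesis .
qed

text \<open>Test functions increase to indicators of half-lines, which determine a finite measure.
  The condition \<open>Y T \<omega> < u\<close> appears explicitly because a general
  \<open>g\<close>, unlike a test function, need not vanish at nonpositive distances.\<close>

lemma exit_law:
  assumes T: "T > 0" and [measurable]: "g \<in> borel_measurable borel"
  shows "(\<integral>\<^sup>+\<omega>. g (u - Y T \<omega>) * of_bool (Y T \<omega> < u \<and> exceeds 0 (ereal T) u \<omega>) \<partial>M)
    = (\<integral>\<^sup>+z. g z * exit_density T u z \<partial>lborel)"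
proof -
  define \<mu> where "\<mu> = distr (density M (\<lambda>\<omega>. of_bool (Y T \<omega> < u \<and> exceeds 0 (ereal T) u \<omega>))) borel (\<lambda>\<omega>. u - Y T \<omega>)"
  have \<mu>: "(\<integral>\<^sup>+z. h z \<partial>\<mu>) = (\<integral>\<^sup>+\<omega>. h (u - Y T \<omega>) * of_bool (Y T \<omega> < u \<and> exceeds 0 (ereal T) u \<omega>) \<partial>M)"
    if [measurable]: "h \<in> borel_measurable borel" for h
    unfolding \<mu>_def by (subst nn_integral_distr, simp, simp, subst nn_integral_density) (auto simp: mult.commute)
  have "\<mu> = density lborel (exit_density T u)"
  proof (rule measure_eqI_lessThan)
    fix x :: real
    have "emeasure \<mu> {x<..} = (\<integral>\<^sup>+z. indicator {x<..} z \<partial>\<mu>)" by (simp add: \<mu>_def)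
    also have "\<dots> = (\<integral>\<^sup>+\<omega>. indicator {x<..} (u - Y T \<omega>) * of_bool (Y T \<omega> < u \<and> exceeds 0 (ereal T) u \<omega>) \<partial>M)"
      by (rule \<mu>) simp
    finally have \<mu>x: "emeasure \<mu> {x<..} = \<dots>" .
    have "\<dots> \<le> (\<integral>\<^sup>+\<omega>. 1 \<partial>M)" by (intro nn_integral_mono) (auto simp: indicator_def)
    then show "emeasure \<mu> {x<..} < \<infinity>" unfolding \<mu>x by (simp add: emeasure_space_1 le_less_trans)
    \<comment> \<open>Neither measure charges nonpositive distances and test functions vanish there,
      so a half-line that starts below \<open>0\<close> is cut at \<open>0\<close>.\<close>
    define y where "y = max 0 x"
    \<comment> \<open>A trapezoid supported between \<open>y\<close> and \<open>y + n\<close>, with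
      flanks of slope \<open>n\<close> and capped at \<open>1\<close>. Slope and support grow with
      \<open>n\<close>, which makes the sequence increasing.\<close>
    define h where "h n z = min 1 (real n * max 0 (min (z - y) (y + real n - z)))" for n z
    have y: "y \<ge> 0" by (simp add: y_def)
    have h_test: "test_fun (h n)" for n
      unfolding test_fun_def
    proof (intro conjI exI[of _ "y + real n"])
      show "continuous_on UNIV (h n)" unfolding h_def by (intro continuous_intros)
      show "\<forall>z. 0 \<le> h n z \<and> h n z \<le> 1" by (auto simp: h_def)
      show "\<forall>z. z \<le> 0 \<or> y + real n \<le> z \<longrightarrow> h n z = 0" using y by (auto simp: h_def)
    qed (use y in simp)
    have [measurable]: "h n \<in> borel_measurable borel" for n using h_test by (rule test_fun_measurable)
    have h_mono: "h m z \<le> h n z" if "m \<le> n" for m n z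
      unfolding h_def using that by (intro min.mono mult_mono max.mono) auto
    have h_ev: "eventually (\<lambda>n. ennreal (h n z) = indicator {y<..} z) sequentially" for z
    proof (cases "y < z")
      case True
      obtain n0 :: nat where n0: "max (1 / (z - y)) (1 + z - y) < real n0" using reals_Archimedean2 by blast
      show ?thesis
        unfolding eventually_sequentially
      proof (intro exI[of _ n0] allI impI)
        fix n assume n: "n0 \<le> n"
        then have "1 / (z - y) \<le> real n" "1 + z - y \<le> real n" using n0 by auto
        then have 1: "1 \<le> real n * (z - y)" "1 \<le> y + real n - z" using True by (auto simp: field_simps)
        have "1 \<le> real n" using \<open>1 + z - y \<le> real n\<close> True by simp
        then have "1 \<le> real n * (y + real n - z)" using 1(2) mult_mono[of 1 "real n" 1 "y + real n - z"] by simp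
        then have "1 \<le> real n * min (z - y) (y + real n - z)" using 1 by (auto simp: min_def)
        then have "h n z = 1" using True 1 by (auto simp: h_def max_def)
        then show "ennreal (h n z) = indicator {y<..} z" using True by simp
      qed
    next
      case False
      then have "h n z = 0" for n by (auto simp: h_def)
      then show ?thesis using False by simp
    qed
    have h_lim: "(\<lambda>n. ennreal (h n z) * k) \<longlonglongrightarrow> indicator {y<..} z * k" for z k
      by (rule tendsto_eventually, use h_ev[of z] in eventually_elim) simp
    have "(\<lambda>n. exit_fun T (\<lambda>z. ennreal (h n z)) u) \<longlonglongrightarrow> exit_fun T (indicator {y<..}) u"
      unfolding exit_fun_def
      by (rule nn_integral_LIMSEQ)
        (auto simp: incseq_def le_fun_def intro!: mult_right_mono ennreal_leI h_mono h_lim h_lim[of _ 1, simplified])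
    moreover have "(\<lambda>n. \<integral>\<^sup>+z. ennreal (h n z) * exit_density T u z \<partial>lborel) \<longlonglongrightarrow> (\<integral>\<^sup>+z. indicator {y<..} z * exit_density T u z \<partial>lborel)"
      by (rule nn_integral_LIMSEQ)
        (auto simp: incseq_def le_fun_def intro!: mult_right_mono ennreal_leI h_mono h_lim h_lim[of _ 1, simplified])
    ultimately have "exit_fun T (indicator {y<..}) u = (\<integral>\<^sup>+z. indicator {y<..} z * exit_density T u z \<partial>lborel)"
      unfolding exit_fun_eq_exit_int[OF T h_test] by (subst (asm) exit_int_eq_exit_density, simp) (rule LIMSEQ_unique)
    moreover have "exit_fun T (indicator {y<..}) u = emeasure \<mu> {x<..}"
      unfolding \<mu>x exit_fun_def by (intro nn_integral_cong) (auto simp: indicator_def y_def)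
    moreover have "(\<integral>\<^sup>+z. indicator {y<..} z * exit_density T u z \<partial>lborel) = emeasure (density lborel (exit_density T u)) {x<..}"
      by (subst emeasure_density) (auto intro!: nn_integral_cong simp: indicator_def y_def exit_density_def ennreal_neg)
    ultimately show "emeasure \<mu> {x<..} = emeasure (density lborel (exit_density T u)) {x<..}" by simp
  qed (simp_all add: \<mu>_def)
  then have "(\<integral>\<^sup>+z. g z \<partial>\<mu>) = (\<integral>\<^sup>+z. exit_density T u z * g z \<partial>lborel)"
    by (simp add: nn_integral_density)
  then show ?thesis by (simp add: \<mu> mult.commute)
qed

end

section \<open>No jump at the fixed time \<open>T\<close>\<close>

context spos_levy
begin

text \<open>A path above \<open>u\<close> at \<open>T\<close> but not earlier jumps upwards at
  \<open>T\<close>. By stationarity the increment over the last stretch of length \<open>h\<close>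
  has the law of \<open>Y h\<close>, which tends to \<open>0\<close> in probability by
  right-continuity at \<open>0\<close>. So a jump larger than \<open>e\<close> has probability zero,
  and what remains is the event that \<open>Y T\<close> lies within \<open>e\<close> above
  \<open>u\<close>.\<close>

lemma AE_exceeds_if_above:
  assumes T: "T > 0"
  shows "AE \<omega> in M. u < Y T \<omega> \<longrightarrow> exceeds 0 (ereal T) u \<omega>"
proof -
  define P where "P = prob {\<omega>\<in>space M. u < Y T \<omega> \<and> \<not> exceeds 0 (ereal T) u \<omega>}"
  have step: "P \<le> prob {\<omega>\<in>space M. u < Y T \<omega> \<and> Y T \<omega> \<le> u + e}" if e: "e > 0" for e
  proof -
    define h where "h n = T / 2 ^ Suc n" for n
    have h: "0 < h n" "h n < T" for n
    proof -
      have "(1::real) < 2 ^ Suc n" by (rule one_less_power) auto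
      then show "0 < h n" "h n < T" using T by (auto simp: h_def field_simps)
    qed
    have h_lim: "h \<longlonglongrightarrow> 0" using dyadic_tendsto_0[of "T / 2"] by (simp add: h_def[abs_def])
    have jump: "prob {\<omega>\<in>space M. e < Y T \<omega> - Y (T - h n) \<omega>} = prob {\<omega>\<in>space M. e < Y (h n) \<omega>}" for n
    proof -
      have "measure (distr M borel (\<lambda>\<omega>. Y (T - h n + h n) \<omega> - Y (T - h n) \<omega>)) {e<..} = measure (distr M borel (Y (h n))) {e<..}"
        using h[of n] by (subst stationary) auto
      then show ?thesis by (simp add: measure_distr vimage_def Int_def conj_commute)
    qed
    have "(\<lambda>n. prob {\<omega>\<in>space M. e < Y (h n) \<omega>}) \<longlonglongrightarrow> 0"
    proof -
      have "(\<lambda>n. \<integral>\<omega>. indicator {e<..} (Y (h n) \<omega>) \<partial>M) \<longlonglongrightarrow> (\<integral>\<omega>. 0 \<partial>M :: real)"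
      proof (rule integral_dominated_convergence[where w="\<lambda>_. 1"])
        show "AE \<omega> in M. (\<lambda>n. indicator {e<..} (Y (h n) \<omega>)) \<longlonglongrightarrow> (0 :: real)"
        proof (intro AE_I2 tendsto_eventually)
          fix \<omega>
          have "(\<lambda>n. Y (h n) \<omega>) \<longlonglongrightarrow> Y 0 \<omega>"
            using h by (intro right_cont_seq[where x="\<lambda>t. Y t \<omega>", OF right_cont h_lim]) (auto intro: less_imp_le)
          then have "(\<lambda>n. Y (h n) \<omega>) \<longlonglongrightarrow> 0" by simp
          from order_tendstoD(2)[OF this e]
          show "eventually (\<lambda>n. indicator {e<..} (Y (h n) \<omega>) = (0 :: real)) sequentially"
            by eventually_elim simp
        qed
      qed auto
      moreover have "(\<integral>\<omega>. indicator {e<..} (Y (h n) \<omega>) \<partial>M) = prob {\<omega>\<in>space M. e < Y (h n) \<omega>}" for n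
      proof -
        have "(\<integral>\<omega>. indicator {e<..} (Y (h n) \<omega>) \<partial>M) = (\<integral>\<omega>. indicator {\<omega>\<in>space M. e < Y (h n) \<omega>} \<omega> \<partial>M :: real)"
          by (intro Bochner_Integration.integral_cong) (auto simp: indicator_def)
        then show ?thesis by simp
      qed
      ultimately show ?thesis by simp
    qed
    then have lim: "(\<lambda>n. prob {\<omega>\<in>space M. u < Y T \<omega> \<and> Y T \<omega> \<le> u + e} + prob {\<omega>\<in>space M. e < Y (h n) \<omega>}) \<longlonglongrightarrow> prob {\<omega>\<in>space M. u < Y T \<omega> \<and> Y T \<omega> \<le> u + e} + 0"
      by (intro tendsto_intros)
    have "P \<le> prob {\<omega>\<in>space M. u < Y T \<omega> \<and> Y T \<omega> \<le> u + e} + prob {\<omega>\<in>space M. e < Y (h n) \<omega>}" for n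
    proof -
      have "P \<le> prob ({\<omega>\<in>space M. u < Y T \<omega> \<and> Y T \<omega> \<le> u + e} \<union> {\<omega>\<in>space M. e < Y T \<omega> - Y (T - h n) \<omega>})"
        unfolding P_def
      proof (rule finite_measure_mono)
        show "{\<omega>\<in>space M. u < Y T \<omega> \<and> \<not> exceeds 0 (ereal T) u \<omega>} \<subseteq> {\<omega>\<in>space M. u < Y T \<omega> \<and> Y T \<omega> \<le> u + e} \<union> {\<omega>\<in>space M. e < Y T \<omega> - Y (T - h n) \<omega>}"
        proof
          fix \<omega> assume \<omega>: "\<omega> \<in> {\<omega>\<in>space M. u < Y T \<omega> \<and> \<not> exceeds 0 (ereal T) u \<omega>}"
          then have "\<not> u < Y (T - h n) \<omega>" using h[of n] unfolding exceeds_def by auto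
          then show "\<omega> \<in> {\<omega>\<in>space M. u < Y T \<omega> \<and> Y T \<omega> \<le> u + e} \<union> {\<omega>\<in>space M. e < Y T \<omega> - Y (T - h n) \<omega>}"
            using \<omega> by auto
        qed
      qed measurable
      also have "\<dots> \<le> prob {\<omega>\<in>space M. u < Y T \<omega> \<and> Y T \<omega> \<le> u + e} + prob {\<omega>\<in>space M. e < Y T \<omega> - Y (T - h n) \<omega>}"
        by (rule measure_Un_le) measurable
      finally show ?thesis unfolding jump .
    qed
    then show ?thesis using lim by (simp add: LIMSEQ_le_const)
  qed
  \<comment> \<open>Now \<open>e\<close> tends to \<open>0\<close>: because
    \<open>u < Y T \<omega>\<close> is strict, these events decrease to the empty set.\<close>
  have "(\<lambda>n. prob {\<omega>\<in>space M. u < Y T \<omega> \<and> Y T \<omega> \<le> u + 1 / real (Suc n)}) \<longlonglongrightarrow> prob (\<Inter>n. {\<omega>\<in>space M. u < Y T \<omega> \<and> Y T \<omega> \<le> u + 1 / real (Suc n)})"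
  proof (rule finite_Lim_measure_decseq)
    show "decseq (\<lambda>n. {\<omega>\<in>space M. u < Y T \<omega> \<and> Y T \<omega> \<le> u + 1 / real (Suc n)})"
      unfolding decseq_def
    proof (intro allI impI subsetI)
      fix m n :: nat and \<omega> assume "m \<le> n" "\<omega> \<in> {\<omega>\<in>space M. u < Y T \<omega> \<and> Y T \<omega> \<le> u + 1 / real (Suc n)}"
      moreover from \<open>m \<le> n\<close> have "1 / real (Suc n) \<le> 1 / real (Suc m)" by (intro frac_le) auto
      ultimately show "\<omega> \<in> {\<omega>\<in>space M. u < Y T \<omega> \<and> Y T \<omega> \<le> u + 1 / real (Suc m)}" by auto
    qed
    have "{\<omega>\<in>space M. u < Y T \<omega> \<and> Y T \<omega> \<le> u + 1 / real (Suc n)} \<in> events" for n by measurable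
    then show "range (\<lambda>n. {\<omega>\<in>space M. u < Y T \<omega> \<and> Y T \<omega> \<le> u + 1 / real (Suc n)}) \<subseteq> events" by blast
  qed
  also have "(\<Inter>n. {\<omega>\<in>space M. u < Y T \<omega> \<and> Y T \<omega> \<le> u + 1 / real (Suc n)}) = {}"
  proof -
    have "\<exists>n. \<not> y \<le> u + 1 / real (Suc n)" if less: "u < y" for y
    proof -
      obtain n where "inverse (real (Suc n)) < y - u" using reals_Archimedean[of "y - u"] less by (metis diff_gt_0_iff_gt)
      then show ?thesis by (intro exI[of _ n]) (simp add: inverse_eq_divide)
    qed
    then show ?thesis by blast
  qed
  finally have "P \<le> 0"
    using step by (intro LIMSEQ_le_const[where a=P]) (auto intro!: exI[of _ 0])
  then have "P = 0" unfolding P_def by (simp add: antisym)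
  then have "AE \<omega> in M. \<not> (u < Y T \<omega> \<and> \<not> exceeds 0 (ereal T) u \<omega>)"
    unfolding P_def by (subst (asm) prob_Collect_eq_0) auto
  then show ?thesis by eventually_elim simp
qed

end

context spos_levy_density
begin

lemma AE_Y_neq:
  assumes "T > 0"
  shows "AE \<omega> in M. Y T \<omega> \<noteq> u"
proof -
  have "emeasure (distr M lborel (Y T)) {u} = emeasure (density lborel (\<lambda>x. p x T)) {u}"
    unfolding distributed_distr_eq_density[OF dens[OF assms]] ..
  also have "\<dots> = (\<integral>\<^sup>+x. p x T * indicator {u} x \<partial>lborel)"
    by (subst emeasure_density) auto
  also have "\<dots> = 0"
    by (subst nn_integral_0_iff_AE) (auto intro!: AE_I[where N="{u}"] simp: indicator_def)
  finally have "emeasure M {\<omega>\<in>space M. Y T \<omega> = u} = 0"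
    by (subst (asm) emeasure_distr) (auto simp: vimage_def Int_def conj_commute)
  then show ?thesis by (intro AE_I[where N="{\<omega>\<in>space M. Y T \<omega> = u}"]) auto
qed

section \<open>The two probabilities\<close>

text \<open>The value \<open>Y T = u\<close> has probability zero, and \<open>Y T > u\<close> almost
  surely entails an exceedance before \<open>T\<close>. What remains is the case
  \<open>Y T < u\<close>, whose probability is \<open>exit_law\<close> with
  \<open>g = 1\<close>.\<close>

lemma prob_exceeds:
  fixes u :: real
  assumes T: "T > 0"
  defines "I \<equiv> (\<integral>\<^sup>+s\<in>{0<..<T}. p u s * ballot_weight (\<lambda>_. 1) (T - s) \<partial>lborel)"
  shows "I < \<infinity>" "prob {\<omega>\<in>space M. exceeds 0 (ereal T) u \<omega>} = prob {\<omega>\<in>space M. u < Y T \<omega>} + enn2real I"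
proof -
  have "I = (\<integral>\<^sup>+\<omega>. 1 * of_bool (Y T \<omega> < u \<and> exceeds 0 (ereal T) u \<omega>) \<partial>M)"
    unfolding I_def exit_int_def[symmetric] by (subst exit_law[OF T]) (simp_all add: exit_int_eq_exit_density)
  also have "\<dots> = (\<integral>\<^sup>+\<omega>. indicator {\<omega>\<in>space M. Y T \<omega> < u \<and> exceeds 0 (ereal T) u \<omega>} \<omega> \<partial>M)"
    by (intro nn_integral_cong) (auto simp: indicator_def)
  also have "\<dots> = emeasure M {\<omega>\<in>space M. Y T \<omega> < u \<and> exceeds 0 (ereal T) u \<omega>}"
    by (rule nn_integral_indicator) measurable
  finally have I: "I = emeasure M {\<omega>\<in>space M. Y T \<omega> < u \<and> exceeds 0 (ereal T) u \<omega>}" .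
  then show "I < \<infinity>" by (simp add: emeasure_eq_measure)
  have "prob {\<omega>\<in>space M. exceeds 0 (ereal T) u \<omega>}
    = prob ({\<omega>\<in>space M. u < Y T \<omega>} \<union> {\<omega>\<in>space M. Y T \<omega> < u \<and> exceeds 0 (ereal T) u \<omega>})"
    using AE_Y_neq[OF T, of u] AE_exceeds_if_above[OF T, of u]
    by (intro finite_measure_eq_AE) auto
  also have "\<dots> = prob {\<omega>\<in>space M. u < Y T \<omega>} + prob {\<omega>\<in>space M. Y T \<omega> < u \<and> exceeds 0 (ereal T) u \<omega>}"
    by (intro finite_measure_Union) auto
  finally show "prob {\<omega>\<in>space M. exceeds 0 (ereal T) u \<omega>} = prob {\<omega>\<in>space M. u < Y T \<omega>} + enn2real I"
    by (simp add: I measure_def)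
qed

text \<open>A path that has not exceeded \<open>u\<close> before \<open>T\<close> almost surely has
  \<open>Y T < u\<close>, so the event is \<open>EJ\<close> without \<open>EK\<close>. For
  \<open>EJ\<close> the past is irrelevant and the density of \<open>Y T\<close> suffices; for
  \<open>EK\<close> it is \<open>exit_law\<close> with the tail as weight.\<close>

lemma prob_exceeds_from:
  fixes u c :: real and r :: ereal
  assumes T: "T > 0"
  defines "tail \<equiv> \<lambda>z. prob {\<omega>\<in>space M. exceeds c r z \<omega>}"
  defines "J \<equiv> (\<integral>\<^sup>+z\<in>{0<..}. ennreal (tail z) * p (u - z) T \<partial>lborel)"
    and "K \<equiv> (\<integral>\<^sup>+z. ennreal (tail z) * exit_density T u z \<partial>lborel)"
  shows "J < \<infinity>" "K < \<infinity>"
    "prob {\<omega>\<in>space M. \<not> exceeds 0 (ereal T) u \<omega> \<and> exceeds_from T c r (u - Y T \<omega>) \<omega>} = enn2real J - enn2real K"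
proof -
  have [measurable]: "Measurable.pred M (\<lambda>\<omega>. exceeds_from T c r (u - Y T \<omega>) \<omega>)"
    using T by (intro exceeds_from_measurable) auto
  have tail_eq: "ennreal (tail z) = (\<integral>\<^sup>+\<omega>. of_bool (exceeds c r z \<omega>) \<partial>M)" for z
  proof -
    have "(\<integral>\<^sup>+\<omega>. of_bool (exceeds c r z \<omega>) \<partial>M) = (\<integral>\<^sup>+\<omega>. indicator {\<omega>\<in>space M. exceeds c r z \<omega>} \<omega> \<partial>M)"
      by (intro nn_integral_cong) (auto simp: indicator_def)
    also have "\<dots> = emeasure M {\<omega>\<in>space M. exceeds c r z \<omega>}" by (rule nn_integral_indicator) measurable
    finally show ?thesis by (simp add: tail_def emeasure_eq_measure)
  qed
  have tail_meas[measurable]: "(\<lambda>z. ennreal (tail z)) \<in> borel_measurable borel"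
    unfolding tail_eq by measurable
  \<comment> \<open>Both sets at once: \<open>b0\<close> true leads to \<open>EJ\<close> and
    \<open>b0\<close> false to \<open>EK\<close>. The Markov property turns the event after
    \<open>T\<close> into the tail at the distance \<open>u - Y T \<omega>\<close>.\<close>
  have joint: "emeasure M {\<omega>\<in>space M. (b0 \<or> exceeds 0 (ereal T) u \<omega>) \<and> Y T \<omega> < u \<and> exceeds_from T c r (u - Y T \<omega>) \<omega>}
    = (\<integral>\<^sup>+\<omega>. ennreal (tail (u - Y T \<omega>)) * of_bool (Y T \<omega> < u \<and> (b0 \<or> exceeds 0 (ereal T) u \<omega>)) \<partial>M)" for b0
  proof -
    have "emeasure M {\<omega>\<in>space M. (b0 \<or> exceeds 0 (ereal T) u \<omega>) \<and> Y T \<omega> < u \<and> exceeds_from T c r (u - Y T \<omega>) \<omega>}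
      = (\<integral>\<^sup>+\<omega>. indicator {\<omega>\<in>space M. (b0 \<or> exceeds 0 (ereal T) u \<omega>) \<and> Y T \<omega> < u \<and> exceeds_from T c r (u - Y T \<omega>) \<omega>} \<omega> \<partial>M)"
      by (rule nn_integral_indicator[symmetric]) measurable
    also have "\<dots> = (\<integral>\<^sup>+\<omega>. of_bool (b0 \<or> exceeds 0 (ereal T) u \<omega>) * (\<lambda>(x, y). of_bool (x < u)) (Y T \<omega>, Y (T + real 0 * T) \<omega> - Y T \<omega>)
      * of_bool (exceeds_from T c r (u - Y T \<omega>) \<omega>) \<partial>M)"
      by (intro nn_integral_cong) (auto simp: indicator_def)
    also have "\<dots> = (\<integral>\<^sup>+\<omega>. (\<integral>\<^sup>+\<omega>'. of_bool (b0 \<or> exceeds 0 (ereal T) u \<omega>) * (\<lambda>(x, y). of_bool (x < u)) (Y T \<omega>, Y (real 0 * T) \<omega>')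
      * of_bool (exceeds c r (u - Y T \<omega>) \<omega>') \<partial>M) \<partial>M)"
      using T by (intro markov[where K=1]) (auto simp: borel_prod[symmetric])
    also have "\<dots> = (\<integral>\<^sup>+\<omega>. of_bool (Y T \<omega> < u \<and> (b0 \<or> exceeds 0 (ereal T) u \<omega>)) * ennreal (tail (u - Y T \<omega>)) \<partial>M)"
    proof (rule nn_integral_cong)
      fix \<omega>
      have "(\<integral>\<^sup>+\<omega>'. of_bool (b0 \<or> exceeds 0 (ereal T) u \<omega>) * (\<lambda>(x, y). of_bool (x < u)) (Y T \<omega>, Y (real 0 * T) \<omega>')
        * of_bool (exceeds c r (u - Y T \<omega>) \<omega>') \<partial>M)
        = (\<integral>\<^sup>+\<omega>'. of_bool (Y T \<omega> < u \<and> (b0 \<or> exceeds 0 (ereal T) u \<omega>)) * of_bool (exceeds c r (u - Y T \<omega>) \<omega>') \<partial>M)"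
        by (intro nn_integral_cong) auto
      also have "\<dots> = of_bool (Y T \<omega> < u \<and> (b0 \<or> exceeds 0 (ereal T) u \<omega>)) * ennreal (tail (u - Y T \<omega>))"
        unfolding tail_eq by (rule nn_integral_cmult) measurable
      finally show "(\<integral>\<^sup>+\<omega>'. of_bool (b0 \<or> exceeds 0 (ereal T) u \<omega>) * (\<lambda>(x, y). of_bool (x < u)) (Y T \<omega>, Y (real 0 * T) \<omega>')
        * of_bool (exceeds c r (u - Y T \<omega>) \<omega>') \<partial>M) = \<dots>" .
    qed
    finally show ?thesis by (simp only: mult.commute)
  qed
  define EJ where "EJ = {\<omega>\<in>space M. Y T \<omega> < u \<and> exceeds_from T c r (u - Y T \<omega>) \<omega>}"
  define EK where "EK = {\<omega>\<in>space M. exceeds 0 (ereal T) u \<omega> \<and> Y T \<omega> < u \<and> exceeds_from T c r (u - Y T \<omega>) \<omega>}"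
  have [measurable]: "EJ \<in> events" "EK \<in> events" unfolding EJ_def EK_def by measurable
  have K: "K = emeasure M EK"
    unfolding K_def EK_def using joint[of False] by (simp add: exit_law[OF T, symmetric])
  have "J = (\<integral>\<^sup>+x. p x T * (ennreal (tail (u - x)) * of_bool (x < u)) \<partial>lborel)"
    unfolding J_def by (subst (2) nn_integral_real_affine[where c="-1" and t=u])
      (auto simp: indicator_def ac_simps intro!: nn_integral_cong)
  also have "\<dots> = (\<integral>\<^sup>+\<omega>. ennreal (tail (u - Y T \<omega>)) * of_bool (Y T \<omega> < u) \<partial>M)"
    using T by (intro nn_integral_Y[symmetric]) auto
  finally have J: "J = emeasure M EJ"
    unfolding EJ_def using joint[of True] by simp
  show "J < \<infinity>" "K < \<infinity>" unfolding J K by (auto simp: emeasure_eq_measure)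
  have "prob {\<omega>\<in>space M. \<not> exceeds 0 (ereal T) u \<omega> \<and> exceeds_from T c r (u - Y T \<omega>) \<omega>} = prob (EJ - EK)"
    using AE_Y_neq[OF T, of u] AE_exceeds_if_above[OF T, of u]
    by (intro finite_measure_eq_AE) (auto simp: EJ_def EK_def)
  also have "\<dots> = prob EJ - prob EK"
    by (intro finite_measure_Diff) (auto simp: EJ_def EK_def)
  finally show "prob {\<omega>\<in>space M. \<not> exceeds 0 (ereal T) u \<omega> \<and> exceeds_from T c r (u - Y T \<omega>) \<omega>} = enn2real J - enn2real K"
    by (simp add: J K measure_def)
qed

end

section \<open>From the given process to a regular version, and from the completion to measurable
  events\<close>

lemma (in prob_space) indep_vars_cong_AE:
  fixes n :: nat and U V :: "nat \<Rightarrow> 'a \<Rightarrow> real"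
  assumes U: "indep_vars (\<lambda>_. borel) U {..<n}" and [measurable]: "\<And>i. i < n \<Longrightarrow> V i \<in> borel_measurable M"
    and AE: "\<And>i. i < n \<Longrightarrow> AE \<omega> in M. U i \<omega> = V i \<omega>"
  shows "indep_vars (\<lambda>_. borel) V {..<n}"
proof (cases "n = 0")
  case True
  then show ?thesis using U by (simp add: indep_vars_def indep_sets_def)
next
  case False
  then have ne: "{..<n} \<noteq> {}" by (simp add: lessThan_empty_iff)
  have [measurable]: "U i \<in> borel_measurable M" if "i < n" for i
    using U that by (auto simp: indep_vars_def)
  have "distr M (PiM {..<n} (\<lambda>_. borel)) (\<lambda>x. \<lambda>i\<in>{..<n}. V i x) = distr M (PiM {..<n} (\<lambda>_. borel)) (\<lambda>x. \<lambda>i\<in>{..<n}. U i x)"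
  proof (rule distr_cong_AE)
    have "AE \<omega> in M. \<forall>i\<in>{..<n}. U i \<omega> = V i \<omega>" by (subst AE_finite_all) (use AE in auto)
    then show "AE \<omega> in M. (\<lambda>i\<in>{..<n}. V i \<omega>) = (\<lambda>i\<in>{..<n}. U i \<omega>)"
      by eventually_elim (auto simp: fun_eq_iff)
  qed (auto intro!: measurable_restrict)
  also have "\<dots> = PiM {..<n} (\<lambda>i. distr M borel (U i))"
    using indep_vars_iff_distr_eq_PiM'[THEN iffD1, OF ne _ U] by simp
  also have "\<dots> = PiM {..<n} (\<lambda>i. distr M borel (V i))"
    using AE by (intro PiM_cong distr_cong_AE) auto
  finally show ?thesis
    by (subst indep_vars_iff_distr_eq_PiM'[OF ne]) auto
qed

text \<open>Path properties given almost surely are needed for every path. A linear drift is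
  continuous and deterministic, so it leaves the jumps alone and shifts each increment by a
  constant; \<open>max 0 t\<close> keeps the process at zero before time \<open>0\<close>.\<close>

lemma spos_levy_modification:
  assumes X: "spectrally_positive_levy_process M X"
  obtains X' where "\<And>c. spos_levy M (\<lambda>t \<omega>. X' t \<omega> - c * max 0 t)"
    and "AE \<omega> in M. \<forall>t\<ge>0. X' t \<omega> = X t \<omega>"
proof -
  have ps: "prob_space M" and X_meas: "\<And>t. t \<ge> 0 \<Longrightarrow> X t \<in> borel_measurable M"
    and X0: "AE \<omega> in M. X 0 \<omega> = 0"
    and ind: "\<And>(t :: nat \<Rightarrow> real) n. 0 \<le> t 0 \<Longrightarrow> (\<forall>i<n. t i \<le> t (Suc i)) \<Longrightarrow>
        prob_space.indep_vars M (\<lambda>_. borel) (\<lambda>i \<omega>. X (t (Suc i)) \<omega> - X (t i) \<omega>) {..<n}"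
    and stat: "\<And>s h. 0 \<le> s \<Longrightarrow> 0 \<le> h \<Longrightarrow> distr M borel (\<lambda>\<omega>. X (s + h) \<omega> - X s \<omega>) = distr M borel (X h)"
    and cadlag: "AE \<omega> in M. cadlag_on_nonneg (\<lambda>t. X t \<omega>)"
    and pos: "AE \<omega> in M. \<forall>t>0. \<forall>l. ((\<lambda>s. X s \<omega>) \<longlongrightarrow> l) (at_left t) \<longrightarrow> l \<le> X t \<omega>"
    using X unfolding spectrally_positive_levy_process_def levy_process_def by blast+
  interpret prob_space M by (rule ps)
  define good where "good \<omega> \<longleftrightarrow> X 0 \<omega> = 0 \<and> cadlag_on_nonneg (\<lambda>t. X t \<omega>) \<and>
    (\<forall>t>0. \<forall>l. ((\<lambda>s. X s \<omega>) \<longlongrightarrow> l) (at_left t) \<longrightarrow> l \<le> X t \<omega>)" for \<omega>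
  have "AE \<omega> in M. good \<omega>" unfolding good_def using X0 cadlag pos by eventually_elim simp
  then obtain N where N: "{\<omega>\<in>space M. \<not> good \<omega>} \<subseteq> N" "emeasure M N = 0" "N \<in> sets M" by (rule AE_E)
  \<comment> \<open>The set of bad paths need not be measurable, so the zero path is put on a
    measurable null set \<open>N\<close> that contains it. The condition \<open>0 < t\<close> makes
    the value at time \<open>0\<close> exactly zero.\<close>
  define X' where "X' t \<omega> = (if \<omega> \<in> space M - N \<and> 0 < t then X t \<omega> else 0)" for t \<omega>
  have X'_eq: "X' t \<omega> = X t \<omega>" if "\<omega> \<in> space M - N" "t \<ge> 0" for t \<omega>
    using that N(1) by (cases "t = 0") (auto simp: X'_def good_def)
  have AE_eq: "AE \<omega> in M. \<forall>t\<ge>0. X' t \<omega> = X t \<omega>"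
    using N by (intro AE_I[where N=N]) (auto simp: X'_eq)
  have X'_nonpos: "X' t \<omega> = 0" if "t \<le> 0" for t \<omega> using that by (simp add: X'_def)
  have X'_bad: "X' t \<omega> = 0" if "\<omega> \<notin> space M - N" for t \<omega> using that by (auto simp: X'_def)
  have X'_meas[measurable]: "X' t \<in> borel_measurable M" for t
  proof (cases "t > 0")
    case True
    then have [measurable]: "X t \<in> borel_measurable M" by (intro X_meas) simp
    note [measurable] = N(3)
    have "(\<lambda>\<omega>. if \<omega> \<in> space M - N then X t \<omega> else 0) \<in> borel_measurable M" by measurable
    then show ?thesis using True by (simp add: X'_def[abs_def])
  qed (simp add: X'_def[abs_def])
  have X'_right: "((\<lambda>s. X' s \<omega>) \<longlongrightarrow> X' t \<omega>) (at_right t)" if "t \<ge> 0" for t \<omega>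
  proof (cases "\<omega> \<in> space M - N")
    case True
    then have "((\<lambda>s. X s \<omega>) \<longlongrightarrow> X t \<omega>) (at_right t)"
      using N(1) that by (auto simp: good_def cadlag_on_nonneg_def)
    moreover have "eventually (\<lambda>s. X s \<omega> = X' s \<omega>) (at_right t)"
      using X'_eq[OF True] that by (auto simp: eventually_at_filter)
    ultimately show ?thesis unfolding X'_eq[OF True that] by (rule Lim_transform_eventually)
  next
    case False
    show ?thesis unfolding X'_bad[OF False] by (rule tendsto_const)
  qed
  have X'_left: "\<exists>l\<le>X' t \<omega>. ((\<lambda>s. X' s \<omega>) \<longlongrightarrow> l) (at_left t)" if t: "t > 0" for t \<omega>
  proof (cases "\<omega> \<in> space M - N")
    case True
    then have "good \<omega>" using N(1) by auto
    then obtain l where l: "((\<lambda>s. X s \<omega>) \<longlongrightarrow> l) (at_left t)" "l \<le> X t \<omega>"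
      using t unfolding good_def cadlag_on_nonneg_def by blast
    moreover have "eventually (\<lambda>s. X s \<omega> = X' s \<omega>) (at_left t)"
      unfolding eventually_at_left_field using t X'_eq[OF True] by (intro exI[of _ 0]) auto
    ultimately have "((\<lambda>s. X' s \<omega>) \<longlongrightarrow> l) (at_left t)" by (auto intro: Lim_transform_eventually)
    then show ?thesis using l(2) X'_eq[OF True, of t] t by auto
  next
    case False
    show ?thesis unfolding X'_bad[OF False] by (intro exI[of _ 0]) simp
  qed
  have levy: "spos_levy M (\<lambda>t \<omega>. X' t \<omega> - c * max 0 t)" for c
  proof unfold_locales
    show "(\<lambda>\<omega>. X' t \<omega> - c * max 0 t) \<in> borel_measurable M" for t by measurable
    show "X' t \<omega> - c * max 0 t = 0" if "t \<le> 0" for t \<omega> using that by (simp add: X'_nonpos)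
    show "((\<lambda>s. X' s \<omega> - c * max 0 s) \<longlongrightarrow> X' t \<omega> - c * max 0 t) (at_right t)" if "t \<ge> 0" for t \<omega>
      by (intro tendsto_intros X'_right that)
    show "\<exists>l\<le>X' t \<omega> - c * max 0 t. ((\<lambda>s. X' s \<omega> - c * max 0 s) \<longlongrightarrow> l) (at_left t)" if t: "t > 0" for t \<omega>
    proof -
      obtain l where "l \<le> X' t \<omega>" "((\<lambda>s. X' s \<omega>) \<longlongrightarrow> l) (at_left t)" using X'_left[OF t] by blast
      then show ?thesis by (intro exI[of _ "l - c * max 0 t"] conjI tendsto_intros) auto
    qed
    show "indep_vars (\<lambda>_. borel) (\<lambda>i \<omega>. X' (t (Suc i)) \<omega> - c * max 0 (t (Suc i)) - (X' (t i) \<omega> - c * max 0 (t i))) {..<n}"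
      if t: "0 \<le> t 0" "\<And>i. i < n \<Longrightarrow> t i \<le> t (Suc i)" for t :: "nat \<Rightarrow> real" and n
    proof -
      have t_nonneg: "0 \<le> t i" if "i \<le> n" for i
        using that
      proof (induction i)
        case (Suc i)
        then show ?case using t(2)[of i] by simp
      qed (rule t(1))
      have "indep_vars (\<lambda>_. borel) (\<lambda>i \<omega>. X' (t (Suc i)) \<omega> - X' (t i) \<omega>) {..<n}"
      proof (rule indep_vars_cong_AE)
        show "indep_vars (\<lambda>_. borel) (\<lambda>i \<omega>. X (t (Suc i)) \<omega> - X (t i) \<omega>) {..<n}"
          using t by (intro ind) auto
        show "AE \<omega> in M. X (t (Suc i)) \<omega> - X (t i) \<omega> = X' (t (Suc i)) \<omega> - X' (t i) \<omega>" if "i < n" for i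
          using AE_eq by eventually_elim (use t_nonneg that in simp)
      qed measurable
      then have "indep_vars (\<lambda>_. borel) (\<lambda>i \<omega>. (\<lambda>x. x - (c * max 0 (t (Suc i)) - c * max 0 (t i))) (X' (t (Suc i)) \<omega> - X' (t i) \<omega>)) {..<n}"
        by (rule indep_vars_compose2) measurable
      then show ?thesis by (simp add: algebra_simps)
    qed
    show "distr M borel (\<lambda>\<omega>. X' (s + h) \<omega> - c * max 0 (s + h) - (X' s \<omega> - c * max 0 s)) = distr M borel (\<lambda>\<omega>. X' h \<omega> - c * max 0 h)"
      if s: "0 \<le> s" and h: "0 \<le> h" for s h
    proof -
      note [measurable] = X_meas[OF s] X_meas[OF h] X_meas[OF add_nonneg_nonneg[OF s h]]
      have "distr M borel (\<lambda>\<omega>. X' (s + h) \<omega> - c * max 0 (s + h) - (X' s \<omega> - c * max 0 s))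
        = distr M borel (\<lambda>\<omega>. X (s + h) \<omega> - X s \<omega> - c * h)"
      proof (rule distr_cong_AE)
        show "AE \<omega> in M. X' (s + h) \<omega> - c * max 0 (s + h) - (X' s \<omega> - c * max 0 s) = X (s + h) \<omega> - X s \<omega> - c * h"
          using AE_eq by eventually_elim (use s h in \<open>simp add: algebra_simps\<close>)
      qed auto
      also have "\<dots> = distr (distr M borel (\<lambda>\<omega>. X (s + h) \<omega> - X s \<omega>)) borel (\<lambda>x. x - c * h)"
        by (subst distr_distr) (auto simp: comp_def)
      also have "\<dots> = distr M borel (\<lambda>\<omega>. X h \<omega> - c * h)"
        unfolding stat[OF s h] by (subst distr_distr) (auto simp: comp_def)
      also have "\<dots> = distr M borel (\<lambda>\<omega>. X' h \<omega> - c * max 0 h)"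
      proof (rule distr_cong_AE)
        show "AE \<omega> in M. X h \<omega> - c * h = X' h \<omega> - c * max 0 h"
          using AE_eq by eventually_elim (use h in simp)
      qed auto
      finally show ?thesis .
    qed
  qed
  show ?thesis by (rule that[OF levy AE_eq])
qed

lemma distributed_minus_const:
  fixes X Y :: "'a \<Rightarrow> real"
  assumes X: "distributed M lborel X f" and Y: "Y \<in> borel_measurable M" "AE \<omega> in M. Y \<omega> = X \<omega> - k"
  shows "distributed M lborel Y (\<lambda>x. f (x + k))"
proof -
  have f[measurable]: "f \<in> borel_measurable borel" using distributed_borel_measurable[OF X] by simp
  note [measurable] = Y(1)
  have "distr M lborel Y = density lborel (\<lambda>x. f (x + k))"
  proof (rule measure_eqI)
    fix A assume "A \<in> sets (distr M lborel Y)"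
    then have A[measurable]: "A \<in> sets borel" by simp
    have "emeasure (distr M lborel Y) A = (\<integral>\<^sup>+x. indicator A x \<partial>distr M lborel Y)"
      by simp
    also have "\<dots> = (\<integral>\<^sup>+\<omega>. indicator A (Y \<omega>) \<partial>M)"
      by (rule nn_integral_distr) auto
    also have "\<dots> = (\<integral>\<^sup>+\<omega>. indicator A (X \<omega> - k) \<partial>M)"
      using Y(2) by (intro nn_integral_cong_AE) (auto elim: eventually_mono)
    also have "\<dots> = (\<integral>\<^sup>+x. f x * indicator A (x - k) \<partial>lborel)"
      by (rule distributed_nn_integral[OF X, symmetric]) measurable
    also have "\<dots> = (\<integral>\<^sup>+x. f (x + k) * indicator A x \<partial>lborel)"
      by (subst nn_integral_real_affine[where c=1 and t=k]) (auto simp: add.commute)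
    also have "\<dots> = emeasure (density lborel (\<lambda>x. f (x + k))) A"
      by (subst emeasure_density) auto
    finally show "emeasure (distr M lborel Y) A = \<dots>" .
  qed simp
  then show ?thesis by (simp add: distributed_def)
qed

text \<open>\<open>P\<close> differs from the measurable \<open>Q\<close> only inside a null set, so
  it is an event of the completion with the same probability. This carries statements about suprema
  over to \<open>exceeds\<close> and \<open>exceeds_from\<close>.\<close>

lemma measure_completion_Collect:
  assumes [measurable]: "Measurable.pred M Q" and AE: "AE \<omega> in M. P \<omega> \<longleftrightarrow> Q \<omega>"
  shows "\<P>(\<omega> in completion M. P \<omega>) = \<P>(\<omega> in M. Q \<omega>)"
proof -
  have Q: "{\<omega>\<in>space M. Q \<omega>} \<in> sets M" by measurable
  obtain N where N: "{\<omega>\<in>space M. \<not> (P \<omega> \<longleftrightarrow> Q \<omega>)} \<subseteq> N" "emeasure M N = 0" "N \<in> sets M"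
    using AE by (rule AE_E)
  have "{\<omega>\<in>space M. P \<omega>} = ({\<omega>\<in>space M. Q \<omega>} - N) \<union> ({\<omega>\<in>space M. P \<omega>} \<inter> N)"
    using N(1) by auto
  moreover have "({\<omega>\<in>space M. Q \<omega>} - N) \<union> ({\<omega>\<in>space M. P \<omega>} \<inter> N) \<in> sets (completion M)"
    using N Q by (intro sets_completionI[of _ "{\<omega>\<in>space M. Q \<omega>} - N" "{\<omega>\<in>space M. P \<omega>} \<inter> N" N]) (auto simp: null_sets_def)
  ultimately have "{\<omega>\<in>space M. P \<omega>} \<in> sets (completion M)" by simp
  then have "measure (completion M) {\<omega>\<in>space M. P \<omega>} = measure (completion M) {\<omega>\<in>space M. Q \<omega>}"
    using AE Q by (intro measure_eq_AE) (auto simp: AE_completion elim: eventually_mono)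
  then show ?thesis using Q by simp
qed

theorem theorem4:
  fixes M :: "'a measure"
    and X :: "real \<Rightarrow> 'a \<Rightarrow> real"
    and f :: "real \<Rightarrow> real \<Rightarrow> ennreal"
    and c1 c2 u T :: real
    and S :: ereal
    and A B :: real
    and I J K :: ennreal
  assumes "spectrally_positive_levy_process M X"
    and "transition_density M X f"
    and "c1 \<ge> 0" and "c2 \<ge> 0" and "u > 0"
    and "0 < T" and "ereal T < S"
  defines "A \<equiv> \<P>(\<omega> in completion M. sup_before (ereal T) (\<lambda>t. X t \<omega> - c1 * t) > ereal u)"
    and "B \<equiv> \<P>(\<omega> in completion M.
               sup_before (ereal T) (\<lambda>t. X t \<omega> - c1 * t) \<le> ereal u \<and>
               sup_before_pos (S - ereal T) (\<lambda>t. X (t + T) \<omega> - X T \<omega> - c2 * t)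
                 > ereal (u - X T \<omega> + c1 * T))"
    and "I \<equiv> (\<integral>\<^sup>+ s\<in>{0<..<T}.
               (\<integral>\<^sup>+ \<omega>. ennreal (neg_part (X (T - s) \<omega> - c1 * (T - s))) \<partial>M) / ennreal (T - s)
               * f (u + c1 * s) s \<partial>lborel)"
    and "J \<equiv> (\<integral>\<^sup>+ z\<in>{0<..}.
               ennreal (tail_sup M X c2 (S - ereal T) z) * f (- z + u + c1 * T) T \<partial>lborel)"
    and "K \<equiv> (\<integral>\<^sup>+ z\<in>{0<..}.
               ennreal z * ennreal (tail_sup M X c2 (S - ereal T) z)
               * (\<integral>\<^sup>+ s\<in>{0<..<T}.
                    f (u + c1 * s) s / ennreal (T - s) * f (- z + c1 * (T - s)) (T - s) \<partial>lborel)
               \<partial>lborel)"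
  shows "\<P>(\<omega> in completion M. sup_before S (\<lambda>t. X t \<omega> - piecewise_drift c1 c2 T t) > ereal u)
           = A + B
    \<and> I < \<infinity> \<and> J < \<infinity> \<and> K < \<infinity>
    \<and> A = \<P>(\<omega> in M. X T \<omega> - c1 * T > u) + enn2real I
    \<and> B = enn2real J - enn2real K"
proof -
  note T = \<open>0 < T\<close> and u = \<open>u > 0\<close> and TS = \<open>ereal T < S\<close>
  obtain X' where levy: "\<And>c. spos_levy M (\<lambda>t \<omega>. X' t \<omega> - c * max 0 t)"
    and X'_eq: "AE \<omega> in M. \<forall>t\<ge>0. X' t \<omega> = X t \<omega>"
    using spos_levy_modification[OF assms(1)] by blast
  define Y where "Y t \<omega> = X' t \<omega> - c1 * max 0 t" for t \<omega>
  define p where "p x t = (if t > 0 then f (x + c1 * t) t else 0)" for x t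
  define r where "r = S - ereal T"
  \<comment> \<open>\<open>Y\<close> already contains the drift \<open>c1\<close>; the drift left
    over after \<open>T\<close> may have either sign.\<close>
  define c where "c = c2 - c1"
  have dist: "distributed M lborel (X t) (\<lambda>x. f x t)" if "t > 0" for t
    using assms(2) that by (simp add: transition_density_def)
  have f_meas: "(\<lambda>x. f x t) \<in> borel_measurable borel" if "t > 0" for t
    using distributed_borel_measurable[OF dist[OF that]] by simp
  interpret spos_levy M Y using levy[of c1] unfolding Y_def[abs_def] .
  interpret spos_levy_density M Y p
  proof unfold_locales
    fix t :: real assume t: "t > 0"
    have "AE \<omega> in M. Y t \<omega> = X t \<omega> - c1 * t"
      using X'_eq by eventually_elim (use t in \<open>simp add: Y_def\<close>)
    from distributed_minus_const[OF dist[OF t] Y_measurable this]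
    show "distributed M lborel (Y t) (\<lambda>x. p x t)" using t by (simp add: p_def)
  next
    fix s t x :: real assume s: "s > 0" and t: "t > 0"
    note [measurable] = f_meas[OF s] f_meas[OF t]
    have "p x (s + t) = (\<integral>\<^sup>+y. f (x + c1 * (s + t) - y) s * f y t \<partial>lborel)"
      using assms(2) s t by (simp add: p_def transition_density_def)
    \<comment> \<open>Replacing \<open>y\<close> by \<open>y + c1 * t\<close> splits the shift
      \<open>c1 * (s + t)\<close> into \<open>c1 * s\<close> and \<open>c1 * t\<close>, so the
      identity at every point survives the change of drift.\<close>
    also have "\<dots> = (\<integral>\<^sup>+y. p (x - y) s * p y t \<partial>lborel)"
      using s t by (subst nn_integral_real_affine[where c=1 and t="c1 * t"]) (auto simp: p_def algebra_simps)
    finally show "p x (s + t) = (\<integral>\<^sup>+y. p (x - y) s * p y t \<partial>lborel)" .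
  qed (simp add: p_def)
  have [measurable]: "Measurable.pred M (\<lambda>\<omega>. exceeds_from T c r (u - Y T \<omega>) \<omega>)"
    using T by (intro exceeds_from_measurable) auto
  have Y_eq: "AE \<omega> in M. \<forall>t\<ge>0. X t \<omega> = Y t \<omega> + c1 * t"
    using X'_eq by eventually_elim (simp add: Y_def)
  have less_r: "ereal t < r \<longleftrightarrow> ereal (t + T) < S" for t
    unfolding r_def by (cases S) auto
  have sup_T: "AE \<omega> in M. ereal u < sup_before (ereal T) (\<lambda>t. X t \<omega> - c1 * t) \<longleftrightarrow> exceeds 0 (ereal T) u \<omega>"
    using Y_eq
  proof eventually_elim
    case (elim \<omega>)
    have "ereal u < sup_before (ereal T) (\<lambda>t. X t \<omega> - c1 * t) \<longleftrightarrow> (\<exists>t\<ge>0. t < T \<and> u < Y t \<omega>)"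
      unfolding sup_before_def less_SUP_iff using elim by auto
    also have "\<dots> \<longleftrightarrow> exceeds 0 (ereal T) u \<omega>"
      unfolding exceeds_def
    proof
      assume "\<exists>t\<ge>0. t < T \<and> u < Y t \<omega>"
      then obtain t where t: "t \<ge> 0" "t < T" "u < Y t \<omega>" by blast
      \<comment> \<open>The path starts at \<open>0\<close>, below \<open>u\<close>, so leaving time
        \<open>0\<close> out of \<open>exceeds\<close> loses nothing.\<close>
      then have "t \<noteq> 0" using u by auto
      then show "\<exists>t>0. ereal t < ereal T \<and> u < Y t \<omega> - 0 * t" using t by (intro exI[of _ t]) auto
    qed (auto intro: less_imp_le)
    finally show ?case .
  qed
  have sup_from: "AE \<omega> in M. ereal (u - X T \<omega> + c1 * T) < sup_before_pos (S - ereal T) (\<lambda>t. X (t + T) \<omega> - X T \<omega> - c2 * t)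
      \<longleftrightarrow> exceeds_from T c r (u - Y T \<omega>) \<omega>"
    using Y_eq
  proof eventually_elim
    case (elim \<omega>)
    have "X (t + T) \<omega> - X T \<omega> - c2 * t = Y (T + t) \<omega> - Y T \<omega> - c * t" if "t > 0" for t
      using elim T that by (simp add: c_def algebra_simps)
    moreover have "u - X T \<omega> + c1 * T = u - Y T \<omega>" using elim T by simp
    ultimately show ?case
      unfolding sup_before_pos_def less_SUP_iff exceeds_from_def r_def by auto
  qed
  have sup_tail: "AE \<omega> in M. ereal z < sup_before (S - ereal T) (\<lambda>t. X t \<omega> - c2 * t) \<longleftrightarrow> exceeds c r z \<omega>" if z: "z > 0" for z
    using Y_eq
  proof eventually_elim
    case (elim \<omega>)
    have "X t \<omega> - c2 * t = Y t \<omega> - c * t" if "t \<ge> 0" for t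
      using elim that by (simp add: c_def algebra_simps)
    then have "ereal z < sup_before (S - ereal T) (\<lambda>t. X t \<omega> - c2 * t) \<longleftrightarrow> (\<exists>t\<ge>0. ereal t < r \<and> z < Y t \<omega> - c * t)"
      unfolding sup_before_def less_SUP_iff r_def by auto
    also have "\<dots> \<longleftrightarrow> exceeds c r z \<omega>"
      unfolding exceeds_def
    proof
      assume "\<exists>t\<ge>0. ereal t < r \<and> z < Y t \<omega> - c * t"
      then obtain t where t: "t \<ge> 0" "ereal t < r" "z < Y t \<omega> - c * t" by blast
      then have "t \<noteq> 0" using z by auto
      then show "\<exists>t>0. ereal t < r \<and> z < Y t \<omega> - c * t" using t by (intro exI[of _ t]) auto
    qed (auto intro: less_imp_le)
    finally show ?case .
  qed
  have sup_all: "AE \<omega> in M. ereal u < sup_before S (\<lambda>t. X t \<omega> - piecewise_drift c1 c2 T t)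
      \<longleftrightarrow> exceeds 0 (ereal T) u \<omega> \<or> exceeds_from T c r (u - Y T \<omega>) \<omega>"
    using Y_eq
  proof eventually_elim
    case (elim \<omega>)
    have drift: "X t \<omega> - piecewise_drift c1 c2 T t = (if t \<le> T then Y t \<omega> else Y t \<omega> - c * (t - T))" if "t \<ge> 0" for t
      using elim that by (simp add: piecewise_drift_def c_def algebra_simps)
    have "ereal u < sup_before S (\<lambda>t. X t \<omega> - piecewise_drift c1 c2 T t)
      \<longleftrightarrow> (\<exists>t\<ge>0. ereal t < S \<and> u < (if t \<le> T then Y t \<omega> else Y t \<omega> - c * (t - T)))"
      unfolding sup_before_def less_SUP_iff using drift by auto
    also have "\<dots> \<longleftrightarrow> exceeds 0 (ereal T) u \<omega> \<or> exceeds_from T c r (u - Y T \<omega>) \<omega>"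
    proof
      assume "\<exists>t\<ge>0. ereal t < S \<and> u < (if t \<le> T then Y t \<omega> else Y t \<omega> - c * (t - T))"
      then obtain t where t: "t \<ge> 0" "ereal t < S" "u < (if t \<le> T then Y t \<omega> else Y t \<omega> - c * (t - T))" by blast
      consider "t < T" | "t = T" | "t > T" by linarith
      then show "exceeds 0 (ereal T) u \<omega> \<or> exceeds_from T c r (u - Y T \<omega>) \<omega>"
      proof cases
        case 1
        then have "t > 0" using t u by (cases "t = 0") auto
        then show ?thesis using 1 t unfolding exceeds_def by auto
      next
        case 2
        \<comment> \<open>Time \<open>T\<close> itself belongs to neither event. Right-continuity
          moves the exceedance to a slightly later time, for which \<open>T < S\<close> leaves
          room.\<close>
        define Z where "Z = (\<lambda>t. Y (T + t) \<omega> - Y T \<omega> - c * t)"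
        have rc: "(Z \<longlongrightarrow> Z s) (at_right s)" if "0 \<le> s" for s
          unfolding Z_def using right_cont_shift[of T s \<omega> c] T that by simp
        have "ereal 0 < r" using TS less_r[of 0] by simp
        then obtain b where b: "0 < b" "ereal b < r" using ereal_dense2[of 0 r] by (auto simp: zero_ereal_def)
        have "u - Y T \<omega> < Z 0" using 2 t by (simp add: Z_def)
        from dyadic_exceedance[OF rc[OF order_refl] order_refl b(1) this zero_less_one]
        obtain s where s: "0 < s" "s < b" "u - Y T \<omega> < Z s" by blast
        then have "ereal s < r" using b(2) by (metis less_ereal.simps(1) less_trans)
        then show ?thesis using s unfolding exceeds_from_def Z_def by blast
      next
        case 3
        then show ?thesis unfolding exceeds_from_def using t less_r[of "t - T"]
          by (intro disjI2 exI[of _ "t - T"]) auto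
      qed
    next
      assume "exceeds 0 (ereal T) u \<omega> \<or> exceeds_from T c r (u - Y T \<omega>) \<omega>"
      then show "\<exists>t\<ge>0. ereal t < S \<and> u < (if t \<le> T then Y t \<omega> else Y t \<omega> - c * (t - T))"
      proof
        assume "exceeds 0 (ereal T) u \<omega>"
        then obtain t where t: "0 < t" "t < T" "u < Y t \<omega>" by (auto simp: exceeds_def)
        then have "ereal t < S" using TS by (metis less_ereal.simps(1) less_trans)
        then show ?thesis using t by (intro exI[of _ t]) auto
      next
        assume "exceeds_from T c r (u - Y T \<omega>) \<omega>"
        then obtain t where "0 < t" "ereal t < r" "u - Y T \<omega> < Y (T + t) \<omega> - Y T \<omega> - c * t"
          by (auto simp: exceeds_from_def)
        then show ?thesis using less_r[of t] T by (intro exI[of _ "T + t"]) (auto simp: add.commute)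
      qed
    qed
    finally show ?case .
  qed
  have A: "A = prob {\<omega>\<in>space M. exceeds 0 (ereal T) u \<omega>}"
    unfolding A_def using sup_T by (intro measure_completion_Collect) auto
  have B: "B = prob {\<omega>\<in>space M. \<not> exceeds 0 (ereal T) u \<omega> \<and> exceeds_from T c r (u - Y T \<omega>) \<omega>}"
    unfolding B_def
  proof (rule measure_completion_Collect)
    show "AE \<omega> in M. (sup_before (ereal T) (\<lambda>t. X t \<omega> - c1 * t) \<le> ereal u \<and>
               sup_before_pos (S - ereal T) (\<lambda>t. X (t + T) \<omega> - X T \<omega> - c2 * t) > ereal (u - X T \<omega> + c1 * T))
      \<longleftrightarrow> \<not> exceeds 0 (ereal T) u \<omega> \<and> exceeds_from T c r (u - Y T \<omega>) \<omega>"
      using sup_T sup_from by eventually_elim (simp add: not_less[symmetric])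
  qed measurable
  have tail: "tail_sup M X c2 (S - ereal T) z = prob {\<omega>\<in>space M. exceeds c r z \<omega>}" if "z > 0" for z
    using sup_tail[OF that] by (intro measure_completion_Collect) auto
  have "\<P>(\<omega> in completion M. sup_before S (\<lambda>t. X t \<omega> - piecewise_drift c1 c2 T t) > ereal u)
    = prob {\<omega>\<in>space M. exceeds 0 (ereal T) u \<omega> \<or> exceeds_from T c r (u - Y T \<omega>) \<omega>}"
    using sup_all by (intro measure_completion_Collect) auto
  also have "\<dots> = prob ({\<omega>\<in>space M. exceeds 0 (ereal T) u \<omega>} \<union>
      {\<omega>\<in>space M. \<not> exceeds 0 (ereal T) u \<omega> \<and> exceeds_from T c r (u - Y T \<omega>) \<omega>})"
    by (rule arg_cong[where f=prob]) auto
  also have "\<dots> = A + B"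
    unfolding A B by (intro finite_measure_Union) auto
  finally have total: "\<P>(\<omega> in completion M. sup_before S (\<lambda>t. X t \<omega> - piecewise_drift c1 c2 T t) > ereal u) = A + B" .
  have I: "I = (\<integral>\<^sup>+s\<in>{0<..<T}. p u s * ballot_weight (\<lambda>_. 1) (T - s) \<partial>lborel)"
    unfolding I_def
  proof (rule nn_integral_cong)
    fix s
    show "(\<integral>\<^sup>+ \<omega>. ennreal (neg_part (X (T - s) \<omega> - c1 * (T - s))) \<partial>M) / ennreal (T - s) * f (u + c1 * s) s * indicator {0<..<T} s
      = p u s * ballot_weight (\<lambda>_. 1) (T - s) * indicator {0<..<T} s"
    proof (cases "s \<in> {0<..<T}")
      case True
      have "(\<integral>\<^sup>+ \<omega>. ennreal (neg_part (X (T - s) \<omega> - c1 * (T - s))) \<partial>M) = (\<integral>\<^sup>+ \<omega>. 1 * ennreal (- Y (T - s) \<omega>) \<partial>M)"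
      proof (rule nn_integral_cong_AE)
        show "AE \<omega> in M. ennreal (neg_part (X (T - s) \<omega> - c1 * (T - s))) = 1 * ennreal (- Y (T - s) \<omega>)"
          using Y_eq by eventually_elim (use True in \<open>auto simp: neg_part_def min_def ennreal_neg\<close>)
      qed
      then show ?thesis using True by (simp add: ballot_weight_def p_def mult.commute)
    qed simp
  qed
  have J: "J = (\<integral>\<^sup>+z\<in>{0<..}. ennreal (prob {\<omega>\<in>space M. exceeds c r z \<omega>}) * p (u - z) T \<partial>lborel)"
    unfolding J_def
  proof (rule nn_integral_cong)
    fix z
    show "ennreal (tail_sup M X c2 (S - ereal T) z) * f (- z + u + c1 * T) T * indicator {0<..} z
      = ennreal (prob {\<omega>\<in>space M. exceeds c r z \<omega>}) * p (u - z) T * indicator {0<..} z"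
    proof (cases "z > 0")
      case True
      then show ?thesis unfolding tail[OF True] using T by (simp add: p_def)
    qed simp
  qed
  have K: "K = (\<integral>\<^sup>+z. ennreal (prob {\<omega>\<in>space M. exceeds c r z \<omega>}) * exit_density T u z \<partial>lborel)"
    unfolding K_def
  proof (rule nn_integral_cong)
    fix z
    have "(\<integral>\<^sup>+ s\<in>{0<..<T}. f (u + c1 * s) s / ennreal (T - s) * f (- z + c1 * (T - s)) (T - s) \<partial>lborel)
      = (\<integral>\<^sup>+ s\<in>{0<..<T}. p u s / ennreal (T - s) * p (- z) (T - s) \<partial>lborel)"
      by (intro nn_integral_cong) (auto simp: p_def indicator_def)
    \<comment> \<open>\<open>tail\<close> is established for positive \<open>z\<close> only;
      elsewhere both sides vanish through the factor \<open>z\<close>.\<close>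
    moreover have "ennreal z = 0" if "\<not> z > 0" using that by (simp add: ennreal_neg)
    ultimately show "ennreal z * ennreal (tail_sup M X c2 (S - ereal T) z)
        * (\<integral>\<^sup>+ s\<in>{0<..<T}. f (u + c1 * s) s / ennreal (T - s) * f (- z + c1 * (T - s)) (T - s) \<partial>lborel) * indicator {0<..} z
      = ennreal (prob {\<omega>\<in>space M. exceeds c r z \<omega>}) * exit_density T u z"
      by (cases "z > 0") (simp_all only: tail exit_density_def, simp_all add: ac_simps)
  qed
  have "prob {\<omega>\<in>space M. u < Y T \<omega>} = \<P>(\<omega> in M. X T \<omega> - c1 * T > u)"
  proof (rule finite_measure_eq_AE)
    have [measurable]: "X T \<in> borel_measurable M" using distributed_measurable[OF dist[OF T]] by simp
    show "{\<omega>\<in>space M. X T \<omega> - c1 * T > u} \<in> events" by measurable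
    show "AE \<omega> in M. \<omega> \<in> {\<omega>\<in>space M. u < Y T \<omega>} \<longleftrightarrow> \<omega> \<in> {\<omega>\<in>space M. X T \<omega> - c1 * T > u}"
      using Y_eq by eventually_elim (use T in auto)
  qed measurable
  then show ?thesis
    using total prob_exceeds[OF T, of u] prob_exceeds_from[OF T, where c=c and r=r and u=u] unfolding A B I J K by simp
qed

end
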